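(* Let $(K|K_0,v)$ be a valued function field of characteristic $p>0$ over a perfect base field $K_0$ on which $v$ is trivial. Then the number of distinct distances modulo $vK$ of elements in Artin--Schreier defect extensions of $(K,v)$ (that is, the number of classes modulo $vK$ of the cuts $\mathrm{dist}(b,K)$, where $b$ ranges over $L\setminus K$ and $L|K$ ranges over all Artin--Schreier defect extensions of $(K,v)$) is bounded by $2\cdot \mathrm{trdeg}\, K|K_0$.
   Context: Valuations are written additively: $vK$ is the value group and $Kv$ the residue field. A valued function field $(K|K_0,v)$ is a finitely generated field extension $K|K_0$ together with a valuation $v$ on $K$. An extension of $v$ to the algebraic closure $\tilde K$ of $K$ is fixed, also denoted $v$; $\widetilde{vK}$ denotes the divisible hull of $vK$. Distance: for $a$ in an algebraic extension of $K$, put $v(a-K)=\{v(a-c)\mid c\in K\}$. The distance $\mathrm{dist}(a,K)$ is the cut in $\widetilde{vK}$ whose lower cut set is the smallest initial segment of $\widetilde{vK}$ containing $v(a-K)\cap\widetilde{vK}$. For $\alpha\in\widetilde{vK}$, $\alpha+\mathrm{dist}(a,K)$ is the cut obtained by adding $\alpha$ to all elements of the lower cut set. Two distances are equal modulo $vK$ if one is obtained from the other by adding some $\alpha\in vK$; otherwise they are distinct modulo $vK$. For $\mathrm{char}\,K=p>0$, an Artin--Schreier extension of $K$ is a Galois extension $L|K$ of degree $p$; it is generated by some $\vartheta$ (an Artin--Schreier generator) with $\vartheta^p-\vartheta\in K$. For a finite normal extension $L|K$ one has $[L:K]=d\cdot e\cdot f\cdot g$, where $g$ is the number of extensions of $v$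 from $K$ to $L$, $e$ their common ramification index and $f$ their common inertia degree; the extension has nontrivial defect if $d>1$. An Artin--Schreier defect extension is an Artin--Schreier extension with nontrivial defect (then the extension of $v$ to $L$ is unique and $(L|K,v)$ is immediate). *)

theory Defs
  imports "HOL-Algebra.Algebraic_Closure_Type" "HOL-Algebra.Generated_Fields"
    "HOL-Library.Poly_Mapping"
begin

text \<open>
  All fields are subfields (in the sense of HOL-Algebra) of one ambient field, the type
  \<open>'a\<close>, regarded as a ring record. In the theorem it is an algebraic closure of \<open>K\<close>.
\<close>

abbreviation ambient :: "'a::field ring"  (\<open>\<Omega>\<close>)
  where "\<Omega> \<equiv> ring_of_type_algebra"


subsection \<open>Field extensions\<close>

definition finitely_generated_over :: "'a::field set \<Rightarrow> 'a set \<Rightarrow> bool"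
  where "finitely_generated_over K0 K \<longleftrightarrow>
    subfield K0 \<Omega> \<and> subfield K \<Omega> \<and> (\<exists>S. finite S \<and> K = generate_field \<Omega> (K0 \<union> S))"

definition perfect_field :: "'a::field set \<Rightarrow> bool"
  where "perfect_field K0 \<longleftrightarrow>
    subfield K0 \<Omega> \<and> (CHAR('a) = 0 \<or> (\<lambda>x. x ^ CHAR('a)) ` K0 = K0)"

text \<open>
  Multivariate polynomials whose variables are named by elements of the field, and their
  value when each variable is substituted by its name.
\<close>

definition self_eval :: "(('a::field \<Rightarrow>\<^sub>0 nat) \<Rightarrow>\<^sub>0 'a) \<Rightarrow> 'a"
  where "self_eval P = (\<Sum>m\<in>Poly_Mapping.keys P.
    Poly_Mapping.lookup P m * (\<Prod>x\<in>Poly_Mapping.keys m. x ^ Poly_Mapping.lookup m x))"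

definition algebraically_independent :: "'a::field set \<Rightarrow> 'a set \<Rightarrow> bool"
  where "algebraically_independent K0 B \<longleftrightarrow>
    (\<forall>P. range (Poly_Mapping.lookup P) \<subseteq> K0 \<and>
         (\<forall>m\<in>Poly_Mapping.keys P. Poly_Mapping.keys m \<subseteq> B) \<and> self_eval P = 0 \<longrightarrow> P = 0)"

definition transcendence_basis :: "'a::field set \<Rightarrow> 'a set \<Rightarrow> 'a set \<Rightarrow> bool"
  where "transcendence_basis K0 K B \<longleftrightarrow>
    B \<subseteq> K \<and> algebraically_independent K0 B \<and>
    (\<forall>x\<in>K. ring.algebraic \<Omega> (generate_field \<Omega> (K0 \<union> B)) x)"

text \<open>
  Meaningful for extensions of finite transcendence degree only, where all transcendence
  bases are finite and of the same cardinality.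
\<close>

definition trdeg :: "'a::field set \<Rightarrow> 'a set \<Rightarrow> nat"
  where "trdeg K0 K = card (SOME B. finite B \<and> transcendence_basis K0 K B)"

definition aut :: "'a::field set \<Rightarrow> 'a set \<Rightarrow> ('a \<Rightarrow> 'a) set"
  where "aut K L = {\<sigma> \<in> ring_iso (\<Omega>\<lparr>carrier := L\<rparr>) (\<Omega>\<lparr>carrier := L\<rparr>). \<forall>c\<in>K. \<sigma> c = c}"

definition galois_extension :: "'a::field set \<Rightarrow> 'a set \<Rightarrow> bool"
  where "galois_extension K L \<longleftrightarrow>
    subfield K \<Omega> \<and> subfield L \<Omega> \<and> K \<subseteq> L \<and>
    (\<forall>x\<in>L. ring.algebraic \<Omega> K x) \<and> {x\<in>L. \<forall>\<sigma>\<in>aut K L. \<sigma> x = x} = K"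

definition artin_schreier_extension :: "'a::field set \<Rightarrow> 'a set \<Rightarrow> bool"
  where "artin_schreier_extension K L \<longleftrightarrow>
    CHAR('a) > 0 \<and> galois_extension K L \<and> ring.dimension \<Omega> CHAR('a) K L"


subsection \<open>Valuations\<close>

text \<open>
  Valuations are written additively and only ever evaluated at nonzero elements, so that no
  value \<open>\<infinity>\<close> has to be adjoined to the ordered group; \<open>v 0\<close> is irrelevant.
\<close>

definition valuation_on :: "'a::field set \<Rightarrow> ('a \<Rightarrow> 'g::linordered_ab_group_add) \<Rightarrow> bool"
  where "valuation_on L v \<longleftrightarrow>
    (\<forall>x\<in>L - {0}. \<forall>y\<in>L - {0}. v (x * y) = v x + v y \<and>
       (x + y \<noteq> 0 \<longrightarrow> min (v x) (v y) \<le> v (x + y)))"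

definition value_group :: "('a::field \<Rightarrow> 'g::linordered_ab_group_add) \<Rightarrow> 'a set \<Rightarrow> 'g set"
  where "value_group v L = v ` (L - {0})"

definition valuation_ring :: "('a::field \<Rightarrow> 'g::linordered_ab_group_add) \<Rightarrow> 'a set \<Rightarrow> 'a set"
  where "valuation_ring v L = {x\<in>L. x = 0 \<or> 0 \<le> v x}"

definition valuation_ideal :: "('a::field \<Rightarrow> 'g::linordered_ab_group_add) \<Rightarrow> 'a set \<Rightarrow> 'a set"
  where "valuation_ideal v L = {x\<in>L. x = 0 \<or> 0 < v x}"

definition residue_field ::
    "('a::field \<Rightarrow> 'g::linordered_ab_group_add) \<Rightarrow> 'a set \<Rightarrow> 'a set ring"
  where "residue_field v L = \<Omega>\<lparr>carrier := valuation_ring v L\<rparr> Quot valuation_ideal v L"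

text \<open>The canonical image of the residue field of \<open>K\<close> in the residue field of \<open>L\<close>.\<close>

definition residue_subfield ::
    "('a::field \<Rightarrow> 'g::linordered_ab_group_add) \<Rightarrow> 'a set \<Rightarrow> 'a set \<Rightarrow> 'a set set"
  where "residue_subfield v K L = (\<lambda>x. valuation_ideal v L +>\<^bsub>\<Omega>\<^esub> x) ` valuation_ring v K"

definition ramification_index ::
    "('a::field \<Rightarrow> 'g::linordered_ab_group_add) \<Rightarrow> 'a set \<Rightarrow> 'a set \<Rightarrow> nat"
  where "ramification_index v K L =
    card (value_group v L // {(\<alpha>, \<beta>). \<alpha> - \<beta> \<in> value_group v K})"

definition inertia_degree ::
    "('a::field \<Rightarrow> 'g::linordered_ab_group_add) \<Rightarrow> 'a set \<Rightarrow> 'a set \<Rightarrow> nat"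
  where "inertia_degree v K L =
    ring.dim (residue_field v L) (residue_subfield v K L) (carrier (residue_field v L))"

text \<open>
  The extensions to \<open>L\<close> of the restriction of \<open>v\<close> to \<open>K\<close>. When \<open>L\<close> is algebraic over \<open>K\<close> and
  \<open>'g\<close> contains the divisible hull of the value group of \<open>K\<close>, as it does when \<open>v\<close> is defined
  on an algebraic closure of \<open>K\<close>, every extension with values in any ordered group containing
  this value group is equivalent over it to exactly one extension with values in \<open>'g\<close>.
\<close>

definition valuation_extensions ::
    "('a::field \<Rightarrow> 'g::linordered_ab_group_add) \<Rightarrow> 'a set \<Rightarrow> 'a set \<Rightarrow> ('a \<Rightarrow> 'g) set"
  where "valuation_extensions v K L =
    {w \<in> extensional (L - {0}). valuation_on L w \<and> (\<forall>x\<in>K - {0}. w x = v x)}"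

text \<open>
  The defect \<open>d\<close> of a finite normal extension is the natural number determined by
  \<open>[L : K] = d \<cdot> e \<cdot> f \<cdot> g\<close>.
\<close>

definition has_defect ::
    "('a::field \<Rightarrow> 'g::linordered_ab_group_add) \<Rightarrow> 'a set \<Rightarrow> 'a set \<Rightarrow> nat \<Rightarrow> bool"
  where "has_defect v K L d \<longleftrightarrow>
    ring.dimension \<Omega>
      (d * ramification_index v K L * inertia_degree v K L * card (valuation_extensions v K L)) K L"

definition artin_schreier_defect_extension ::
    "('a::field \<Rightarrow> 'g::linordered_ab_group_add) \<Rightarrow> 'a set \<Rightarrow> 'a set \<Rightarrow> bool"
  where "artin_schreier_defect_extension v K L \<longleftrightarrow>
    artin_schreier_extension K L \<and> (\<exists>d>1. has_defect v K L d)"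


subsection \<open>Distances\<close>

text \<open>
  The divisible hull of \<open>G\<close> inside \<open>'g\<close>. For \<open>G\<close> the value group of \<open>K\<close> and \<open>v\<close> defined on an
  algebraic closure of \<open>K\<close> it coincides with the value group of the closure, so it is divisible.
\<close>

definition divisible_hull :: "'g::linordered_ab_group_add set \<Rightarrow> 'g set"
  where "divisible_hull G = {\<gamma>. \<exists>n>0. (\<Sum>i<n::nat. \<gamma>) \<in> G}"

text \<open>
  A cut is represented by its lower cut set. The condition \<open>c \<noteq> a\<close> discards the
  value \<open>\<infinity>\<close>, which is not in the divisible hull.
\<close>

definition dist_cut ::
    "('a::field \<Rightarrow> 'g::linordered_ab_group_add) \<Rightarrow> 'a set \<Rightarrow> 'a \<Rightarrow> 'g set"
  where "dist_cut v K a =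
    {\<gamma> \<in> divisible_hull (value_group v K).
       \<exists>\<delta> \<in> {v (a - c) | c. c \<in> K \<and> c \<noteq> a} \<inter> divisible_hull (value_group v K). \<gamma> \<le> \<delta>}"

definition equal_modulo :: "'g::linordered_ab_group_add set \<Rightarrow> ('g set \<times> 'g set) set"
  where "equal_modulo G = {(C, D). \<exists>\<alpha>\<in>G. D = (+) \<alpha> ` C}"

definition artin_schreier_defect_distances ::
    "('a::field \<Rightarrow> 'g::linordered_ab_group_add) \<Rightarrow> 'a set \<Rightarrow> 'g set set"
  where "artin_schreier_defect_distances v K =
    {dist_cut v K b | b L. artin_schreier_defect_extension v K L \<and> b \<in> L - K}"

end

theory Submission
  imports Defs
begin

text \<open>
  Write \<open>p\<close> for the characteristic and \<open>n\<close> for the transcendence degree. Every Artin--Schreier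
  defect extension of \<open>K\<close> is generated by some \<open>\<theta>\<close> with \<open>\<theta>^p - \<theta> \<in> K\<close>, and the values
  \<open>v (\<theta> - c)\<close> for \<open>c \<in> K\<close> are negative and have no maximum. By Kaplansky's lemma polynomials of
  degree less than \<open>p\<close> have eventually constant value as \<open>c\<close> approaches \<open>\<theta>\<close>. Hence the linear term
  of the Taylor expansion dominates, and all elements of \<open>K(\<theta>) - K\<close> have the distance of \<open>\<theta>\<close>
  modulo \<open>vK\<close>.

  If some \<open>c \<in> K\<close> satisfies \<open>p v(\<theta> - c') < v(\<theta> - c)\<close> for all \<open>c' \<in> K\<close>, then \<open>\<theta>\<close> has the same
  distance as the \<open>p\<close>-th root of \<open>\<theta>^p - \<theta> + c\<close>. Elements of \<open>K^(1/p)\<close> whose distances are pairwise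
  distinct modulo \<open>vK\<close> generate a tower of extensions of degree \<open>p\<close>, so that at most \<open>n\<close> distances
  arise in this way, since \<open>[K^(1/p) : K] \<le> p^n\<close>. Otherwise the lower cut set of the distance consists
  of the elements below a proper convex subgroup of the divisible hull of \<open>vK\<close>, and there are at
  most \<open>n\<close> of these, since the rank of \<open>v\<close> is bounded by \<open>n\<close>.
\<close>

subsection \<open>Subfields of the ambient field\<close>

text \<open>Two obstacles shape the proof. In a tower over K generated by p-th roots, the field E
  reached so far might approximate the next root better than K does. It does not, since every
  element of E - K has a distance that is already represented: an element of E closer to the new
  root than all of K would share the distance of that root. Moreover, K need not be purely
  transcendental over K0. With F = K0(B) for a transcendence basis B, Frobenius gives
  [K^(1/p) : F^(1/p)] = [K : F] and perfectness of K0 gives F^(1/p) = F(B^(1/p)); the finite degree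
  [K : F] then cancels when degrees over F are compared.

  The p-th root \<eta> of \<theta>^p - \<theta> + c works because Frobenius is additive: (\<theta> -
  \<eta>)^p = \<theta> - c, so p v(\<theta> - \<eta>) = v(\<theta> - c), and v(\<theta> - \<eta>)
  exceeds all v(\<theta> - c'). The values v(\<theta> - c) are negative because the valuation
  extends uniquely: if y = \<theta> - c' had positive value, a conjugate y + 1 would have value 0.
  The factor 2 is the sum of two bounds by n, one for each case.\<close>

lemma ambient_simps [simp]:
  "carrier (\<Omega> :: 'a::field ring) = UNIV"
  "x \<oplus>\<^bsub>\<Omega>\<^esub> y = x + (y::'a::field)" "x \<otimes>\<^bsub>\<Omega>\<^esub> y = x * y" "\<zero>\<^bsub>\<Omega>\<^esub> = (0::'a)" "\<one>\<^bsub>\<Omega>\<^esub> = (1::'a)"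
  by (auto simp: ring_of_type_algebra_def)

lemma ambient_field: "field (\<Omega> :: 'a::field ring)"
  by (rule field_from_type_algebra)

interpretation amb: domain "\<Omega> :: 'a::field ring"
  by (rule field.axioms(1)[OF ambient_field])

lemma ambient_a_inv [simp]: "\<ominus>\<^bsub>\<Omega>\<^esub> x = - (x::'a::field)"
  using amb.minus_equality[of "- x" x] by simp

lemma ambient_a_minus [simp]: "x \<ominus>\<^bsub>\<Omega>\<^esub> y = x - (y::'a::field)"
  by (simp add: a_minus_def)

lemma ambient_m_inv [simp]: "x \<noteq> 0 \<Longrightarrow> inv\<^bsub>\<Omega>\<^esub> x = inverse (x::'a::field)"
  by (rule amb.inv_char) auto

lemma ambient_nat_pow [simp]: "x [^]\<^bsub>\<Omega>\<^esub> (n::nat) = (x::'a::field) ^ n"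
  by (induction n) (auto simp: mult.commute)

abbreviation adjoin :: "'a::field set \<Rightarrow> 'a \<Rightarrow> 'a set"
  where "adjoin \<equiv> amb.simple_extension"

abbreviation gen :: "'a::field set \<Rightarrow> 'a set"
  where "gen \<equiv> generate_field \<Omega>"

lemma subfield_ambientI:
  assumes "1 \<in> F" "\<And>x y. x \<in> F \<Longrightarrow> y \<in> F \<Longrightarrow> x + y \<in> F" "\<And>x y. x \<in> F \<Longrightarrow> y \<in> F \<Longrightarrow> x * y \<in> F"
    "\<And>x. x \<in> F \<Longrightarrow> - x \<in> F" "\<And>x. x \<in> F \<Longrightarrow> x \<noteq> 0 \<Longrightarrow> inverse x \<in> F"
  shows "subfield F (\<Omega> :: 'a::field ring)"
  using assms by (intro field.subfieldI'[OF ambient_field] amb.subringI) auto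

locale ambient_subfield =
  fixes F :: "'a::field set"
  assumes subfield: "subfield F \<Omega>"
begin

lemma one_mem [simp, intro]: "1 \<in> F"
  and zero_mem [simp, intro]: "0 \<in> F"
  and add_mem [simp, intro]: "x \<in> F \<Longrightarrow> y \<in> F \<Longrightarrow> x + y \<in> F"
  and mult_mem [simp, intro]: "x \<in> F \<Longrightarrow> y \<in> F \<Longrightarrow> x * y \<in> F"
  and uminus_mem [simp, intro]: "x \<in> F \<Longrightarrow> - x \<in> F"
  using subringE[OF subfieldE(1)[OF subfield]] by auto

lemma diff_mem [simp, intro]: "x \<in> F \<Longrightarrow> y \<in> F \<Longrightarrow> x - y \<in> F"
  using add_mem[of x "- y"] by simp

lemma inverse_mem [simp, intro]: "x \<in> F \<Longrightarrow> inverse x \<in> F"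
  using amb.subfield_m_inv(1)[OF subfield, of x] by (cases "x = 0") auto

lemma divide_mem [simp, intro]: "x \<in> F \<Longrightarrow> y \<in> F \<Longrightarrow> x / y \<in> F"
  by (simp add: divide_inverse)

lemma power_mem [simp, intro]: "x \<in> F \<Longrightarrow> x ^ n \<in> F"
  by (induction n) auto

lemma of_nat_mem [simp, intro]: "of_nat n \<in> F"
  by (induction n) auto

lemma sum_mem [intro]: "(\<And>i. i \<in> I \<Longrightarrow> f i \<in> F) \<Longrightarrow> sum f I \<in> F"
  by (induction I rule: infinite_finite_induct) auto

lemma prod_mem [intro]: "(\<And>i. i \<in> I \<Longrightarrow> f i \<in> F) \<Longrightarrow> prod f I \<in> F"
  by (induction I rule: infinite_finite_induct) auto

lemma uminus_mem_iff [simp]: "- x \<in> F \<longleftrightarrow> x \<in> F"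
  using uminus_mem[of "- x"] by auto

end

subsection \<open>Polynomials with coefficients in a subfield\<close>

definition polys :: "'a::field set \<Rightarrow> 'a poly set"
  where "polys F = {f. \<forall>i. coeff f i \<in> F}"

context ambient_subfield
begin

lemma polysD: "f \<in> polys F \<Longrightarrow> coeff f i \<in> F"
  by (auto simp: polys_def)

lemma polys_add [intro]: "f \<in> polys F \<Longrightarrow> g \<in> polys F \<Longrightarrow> f + g \<in> polys F"
  and polys_diff [intro]: "f \<in> polys F \<Longrightarrow> g \<in> polys F \<Longrightarrow> f - g \<in> polys F"
  and polys_monom [intro]: "c \<in> F \<Longrightarrow> monom c n \<in> polys F"
  and polys_pderiv [intro]: "f \<in> polys F \<Longrightarrow> pderiv f \<in> polys F"
  and polys_0 [simp, intro]: "0 \<in> polys F"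
  and polys_1 [simp, intro]: "1 \<in> polys F"
  by (auto simp: polys_def coeff_pderiv coeff_monom simp del: of_nat_Suc)

lemma polys_mult [intro]: "f \<in> polys F \<Longrightarrow> g \<in> polys F \<Longrightarrow> f * g \<in> polys F"
  by (auto simp: polys_def coeff_mult)

lemma polys_pCons [intro]: "c \<in> F \<Longrightarrow> f \<in> polys F \<Longrightarrow> pCons c f \<in> polys F"
  by (auto simp: polys_def coeff_pCons split: nat.splits)

lemma polys_sum [intro]: "(\<And>i. i \<in> I \<Longrightarrow> f i \<in> polys F) \<Longrightarrow> sum f I \<in> polys F"
  by (induction I rule: infinite_finite_induct) auto

lemma polys_prod [intro]: "(\<And>i. i \<in> I \<Longrightarrow> f i \<in> polys F) \<Longrightarrow> prod f I \<in> polys F"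
  by (induction I rule: infinite_finite_induct) auto

lemma poly_mem [intro]: "f \<in> polys F \<Longrightarrow> c \<in> F \<Longrightarrow> poly f c \<in> F"
  by (auto simp: poly_altdef polys_def)

lemma polys_division:
  assumes "f \<in> polys F" "degree f > 0" "g \<in> polys F"
  obtains q r where "q \<in> polys F" "r \<in> polys F" "g = q * f + r" "degree r < degree f"
    "degree q = degree g - degree f"
proof -
  have "\<exists>q r. q \<in> polys F \<and> r \<in> polys F \<and> g = q * f + r \<and> degree r < degree f"
    using assms(3)
  proof (induction "degree g" arbitrary: g rule: less_induct)
    case less
    show ?case
    proof (cases "degree g < degree f")
      case True
      then show ?thesis
        using less.prems by (intro exI[of _ 0] exI[of _ g]) auto
    next
      case False
      define h where "h = monom (lead_coeff g / lead_coeff f) (degree g - degree f)"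
      have f0: "f \<noteq> 0" and g0: "g \<noteq> 0" using assms(2) False by auto
      have h: "h \<in> polys F" unfolding h_def using less.prems assms(1) by (intro polys_monom divide_mem polysD)
      have h0: "h \<noteq> 0" using f0 g0 by (auto simp: h_def)
      have degh: "degree h = degree g - degree f"
        unfolding h_def by (rule degree_monom_eq) (use f0 g0 in auto)
      have deg: "degree (h * f) = degree g" 
        using False f0 h0 degh by (subst degree_mult_eq) auto
      have "lead_coeff (h * f) = lead_coeff g"
        using f0 by (simp only: lead_coeff_mult degh) (simp add: h_def)
      then have "coeff (g - h * f) (degree g) = 0" by (simp add: deg)
      moreover have "degree (g - h * f) \<le> degree g" using degree_diff_le_max[of g "h * f"] deg by simp
      ultimately have "degree (g - h * f) < degree g"
        using assms(2) False
        by (metis bot_nat_0.not_eq_extremum leading_coeff_0_iff le_neq_implies_less degree_0 less_le_trans linorder_not_less)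
      moreover have "g - h * f \<in> polys F" using h less.prems assms(1) by auto
      ultimately obtain q r where qr: "q \<in> polys F" "r \<in> polys F" "g - h * f = q * f + r" "degree r < degree f"
        using less.hyps by blast
      show ?thesis
        using qr h by (intro exI[of _ "q + h"] exI[of _ r]) (auto simp: algebra_simps)
    qed
  qed
  then obtain q r where qr: "q \<in> polys F" "r \<in> polys F" "g = q * f + r" "degree r < degree f" by blast
  have "degree q = degree g - degree f"
  proof (cases "q = 0")
    case False
    then have "degree (q * f) = degree q + degree f"
      using assms(2) by (subst degree_mult_eq) auto
    then show ?thesis using qr(3,4) by (simp add: degree_add_eq_left)
  qed (use qr in auto)
  with qr that show ?thesis by blast
qed

text \<open>Repeated division by \<open>f\<close> produces the digits. The clause on vanishing
  digits matters later: a polynomial of degree p can have a nonzero digit of index p only if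
  \<open>f\<close> is linear.\<close>

lemma polys_adic_expansion:
  assumes "f \<in> polys F" "degree f > 0" "g \<in> polys F"
  shows "\<exists>s. (\<forall>j. s j \<in> polys F \<and> degree (s j) < degree f)
    \<and> (\<forall>j. degree g < j * degree f \<longrightarrow> s j = 0) \<and> g = (\<Sum>j\<le>degree g. s j * f ^ j)"
  using assms(3)
proof (induction "degree g" arbitrary: g rule: less_induct)
  case less
  show ?case
  proof (cases "degree g < degree f")
    case True
    have "(\<Sum>j\<le>degree g. (if j = 0 then g else 0) * f ^ j) = (\<Sum>j\<in>{0}. g)"
      by (subst sum.remove[of _ 0]) auto
    then show ?thesis
      using True less.prems assms(2)
      by (intro exI[of _ "\<lambda>j. if j = 0 then g else 0"]) auto
  next
    case False
    obtain q r where qr: "q \<in> polys F" "r \<in> polys F" "g = q * f + r" "degree r < degree f"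
      "degree q = degree g - degree f"
      using polys_division[OF assms(1,2) less.prems] by metis
    have lt: "degree q < degree g" using qr(5) assms(2) False by auto
    obtain s where s: "\<forall>j. s j \<in> polys F \<and> degree (s j) < degree f"
      "\<forall>j. degree q < j * degree f \<longrightarrow> s j = 0" "q = (\<Sum>j\<le>degree q. s j * f ^ j)"
      using less.hyps[OF lt qr(1)] by blast
    have z: "s j = 0" if "j > degree q" for j
    proof -
      have "j \<le> j * degree f" using assms(2) by simp
      then show ?thesis using s(2) that by (meson less_le_trans)
    qed
    \<comment> \<open>The remainder becomes the lowest digit and the digits of the quotient move up
      by one place.\<close>
    let ?s = "\<lambda>j. case j of 0 \<Rightarrow> r | Suc i \<Rightarrow> s i"
    have "q = (\<Sum>j<degree g. s j * f ^ j)"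
      by (subst s(3), intro sum.mono_neutral_left) (use lt z in auto)
    then have "g = (\<Sum>j<degree g. s j * f ^ j) * f + r" using qr(3) by simp
    also have "\<dots> = (\<Sum>j<Suc (degree g). ?s j * f ^ j)"
      by (subst sum.lessThan_Suc_shift) (simp add: sum_distrib_left sum_distrib_right mult_ac)
    finally have "g = (\<Sum>j\<le>degree g. ?s j * f ^ j)" by (simp only: lessThan_Suc_atMost)
    moreover have "\<forall>j. ?s j \<in> polys F \<and> degree (?s j) < degree f"
      using s(1) qr(2,4) by (auto split: nat.splits)
    moreover have "\<forall>j. degree g < j * degree f \<longrightarrow> ?s j = 0"
      using s(2) qr(5) False by (auto split: nat.splits)
    ultimately show ?thesis by blast
  qed
qed

end

text \<open>Hasse derivatives give the Taylor coefficients in any characteristic.\<close>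

definition hasse :: "nat \<Rightarrow> 'a::field poly \<Rightarrow> 'a poly"
  where "hasse i f = (\<Sum>k\<le>degree f. monom (of_nat ((k + i) choose i) * coeff f (k + i)) k)"

lemma coeff_hasse: "coeff (hasse i f) k = of_nat ((k + i) choose i) * coeff f (k + i)"
proof -
  have "coeff (hasse i f) k = (\<Sum>j\<le>degree f. if j = k then of_nat ((k + i) choose i) * coeff f (k + i) else 0)"
    by (auto simp: hasse_def coeff_sum intro!: sum.cong)
  also have "\<dots> = of_nat ((k + i) choose i) * coeff f (k + i)"
    using coeff_eq_0[of f "k + i"] by (cases "k \<le> degree f") auto
  finally show ?thesis .
qed

lemma degree_hasse: "degree (hasse i f) \<le> degree f - i"
  by (rule degree_le) (auto simp: coeff_hasse coeff_eq_0)

lemma hasse_0 [simp]: "hasse 0 f = f"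
  by (rule poly_eqI) (simp add: coeff_hasse)

lemma hasse_degree: "hasse (degree f) f = [:lead_coeff f:]"
  by (rule poly_eqI) (auto simp: coeff_hasse coeff_pCons coeff_eq_0 split: nat.splits)

lemma hasse_1: "hasse 1 f = pderiv f"
  by (rule poly_eqI) (simp add: coeff_hasse coeff_pderiv)

text \<open>This carries information on the Taylor coefficients of \<open>f\<close> over to those of
  its derivative. It is applied with \<open>Suc i\<close> below the characteristic, where the factor
  is a unit of value 0.\<close>

lemma hasse_pderiv: "hasse i (pderiv f) = smult (of_nat (Suc i)) (hasse (Suc i) f)"
proof (rule poly_eqI)
  fix k
  have "Suc (k + i) * ((k + i) choose i) = (Suc (k + i) choose Suc i) * Suc i"
    by (rule Suc_times_binomial_eq)
  then have "of_nat (Suc (k + i)) * (of_nat ((k + i) choose i) :: 'a) = of_nat (Suc (k + i) choose Suc i) * of_nat (Suc i)"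
    by (metis of_nat_mult)
  then show "coeff (hasse i (pderiv f)) k = coeff (smult (of_nat (Suc i)) (hasse (Suc i) f)) k"
    by (simp add: coeff_hasse coeff_pderiv mult_ac del: of_nat_Suc)
qed

lemma (in ambient_subfield) polys_hasse [intro]: "f \<in> polys F \<Longrightarrow> hasse i f \<in> polys F"
  by (auto simp: polys_def coeff_hasse)

text \<open>Expanding the Hasse derivatives gives a sum over pairs (i, k) with k + i at most the
  degree. Regrouped by n = k + i, it consists of the binomial expansions of (c + e)^n.\<close>

lemma poly_taylor: "poly f (c + e) = (\<Sum>i\<le>degree f. poly (hasse i f) c * e ^ i)"
proof -
  let ?n = "degree f"
  have "poly (hasse i f) c = (\<Sum>k\<le>?n. if k + i \<le> ?n then of_nat ((k + i) choose i) * coeff f (k + i) * c ^ k else 0)" for i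
    using coeff_eq_0[of f] by (auto simp: hasse_def poly_sum poly_monom intro!: sum.cong)
  then have "(\<Sum>i\<le>?n. poly (hasse i f) c * e ^ i) = 
     (\<Sum>i\<le>?n. \<Sum>k\<le>?n. if k + i \<le> ?n then of_nat ((k + i) choose i) * coeff f (k + i) * c ^ k * e ^ i else 0)"
    by (simp add: sum_distrib_right if_distrib[of "\<lambda>x. x * _"] cong: if_cong)
  also have "\<dots> = (\<Sum>(i, k)\<in>{..?n} \<times> {..?n}. if k + i \<le> ?n then of_nat ((k + i) choose i) * coeff f (k + i) * c ^ k * e ^ i else 0)"
    by (simp add: sum.cartesian_product)
  also have "\<dots> = (\<Sum>(i, k)\<in>{(i, k). k + i \<le> ?n}. of_nat ((k + i) choose i) * coeff f (k + i) * c ^ k * e ^ i)"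
    by (intro sum.mono_neutral_cong_right) (auto split: if_splits)
  also have "\<dots> = (\<Sum>(n, i)\<in>(SIGMA n:{..?n}. {..n}). of_nat (n choose i) * coeff f n * c ^ (n - i) * e ^ i)"
    by (rule sum.reindex_bij_witness[of _ "\<lambda>(n, i). (i, n - i)" "\<lambda>(i, k). (k + i, i)"]) auto
  also have "\<dots> = (\<Sum>n\<le>?n. \<Sum>i\<le>n. of_nat (n choose i) * coeff f n * c ^ (n - i) * e ^ i)"
    by (subst sum.Sigma) auto
  also have "\<dots> = (\<Sum>n\<le>?n. coeff f n * (e + c) ^ n)"
    by (intro sum.cong refl, subst binomial_ring) (auto simp: sum_distrib_left mult_ac intro!: sum.cong)
  finally show ?thesis by (simp add: poly_altdef add.commute)
qed

subsection \<open>Valued fields\<close>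

text \<open>The same sum as in \<open>divisible_hull\<close>; the type \<open>'g\<close> offers no
  scalar multiplication, so division by n is always expressed by comparing multiples.\<close>

definition nmul :: "nat \<Rightarrow> 'g::linordered_ab_group_add \<Rightarrow> 'g"
  where "nmul n \<gamma> = (\<Sum>i<n. \<gamma>)"

lemma nmul_0 [simp]: "nmul 0 x = 0"
  and nmul_Suc: "nmul (Suc n) x = nmul n x + x"
  and nmul_1 [simp]: "nmul (Suc 0) x = x"
  by (simp_all add: nmul_def)

lemma nmul_zero [simp]: "nmul n 0 = 0"
  by (simp add: nmul_def)

lemma nmul_add_left: "nmul (m + n) x = nmul m x + nmul n x"
  by (induction n) (simp_all add: nmul_Suc add_ac)

lemma nmul_add: "nmul n (x + y) = nmul n x + nmul n y"
  by (simp add: nmul_def sum.distrib)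

lemma nmul_uminus [simp]: "nmul n (- x) = - nmul n x"
  by (simp add: nmul_def sum_negf)

lemma nmul_diff: "nmul n (x - y) = nmul n x - nmul n y"
  by (simp add: nmul_def sum_subtractf)

lemma nmul_nmul: "nmul m (nmul n x) = nmul (m * n) x"
  by (induction m) (simp_all add: nmul_Suc nmul_add_left add.commute)

lemma nmul_strict_mono: "x < y \<Longrightarrow> 0 < n \<Longrightarrow> nmul n x < nmul n y"
  unfolding nmul_def by (rule sum_strict_mono) (auto simp: lessThan_empty_iff)

lemma nmul_mono: "x \<le> y \<Longrightarrow> nmul n x \<le> nmul n y"
  unfolding nmul_def by (rule sum_mono)

lemma nmul_less_iff [simp]: "0 < n \<Longrightarrow> nmul n x < nmul n y \<longleftrightarrow> x < y"
  using nmul_strict_mono[of x y n] nmul_mono[of y x n] by (auto simp: not_less[symmetric])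

lemma nmul_le_iff [simp]: "0 < n \<Longrightarrow> nmul n x \<le> nmul n y \<longleftrightarrow> x \<le> y"
  using nmul_less_iff[of n y x] by (simp add: not_less[symmetric])

lemma nmul_eq_iff [simp]: "0 < n \<Longrightarrow> nmul n x = nmul n y \<longleftrightarrow> x = y"
  by (simp add: eq_iff)

lemma nmul_pos_iff [simp]: "0 < n \<Longrightarrow> 0 < nmul n x \<longleftrightarrow> 0 < x"
  and nmul_neg_iff [simp]: "0 < n \<Longrightarrow> nmul n x < 0 \<longleftrightarrow> x < 0"
  and nmul_eq_0_iff [simp]: "0 < n \<Longrightarrow> nmul n x = 0 \<longleftrightarrow> x = 0"
  using nmul_less_iff[of n 0 x] nmul_less_iff[of n x 0] nmul_eq_iff[of n x 0] by simp_all

lemma nmul_nonneg: "0 \<le> x \<Longrightarrow> 0 \<le> nmul n x"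
  using nmul_mono[of 0 x n] by simp

lemma nmul_mono_left: "m \<le> n \<Longrightarrow> 0 \<le> x \<Longrightarrow> nmul m x \<le> nmul n x"
  using nmul_add_left[of m "n - m" x] nmul_nonneg[of x "n - m"] by simp

lemma divisible_hull_def': "divisible_hull G = {\<gamma>. \<exists>n>0. nmul n \<gamma> \<in> G}"
  by (simp add: divisible_hull_def nmul_def)

lemma divisible_hull_incl: "\<gamma> \<in> G \<Longrightarrow> \<gamma> \<in> divisible_hull G"
  unfolding divisible_hull_def' by (auto intro!: exI[of _ "Suc 0"])

lemma divisible_hull_mono: "G \<subseteq> H \<Longrightarrow> divisible_hull G \<subseteq> divisible_hull H"
  unfolding divisible_hull_def' by auto

lemma divisible_hull_root: "0 < n \<Longrightarrow> nmul n \<gamma> \<in> divisible_hull G \<Longrightarrow> \<gamma> \<in> divisible_hull G"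
proof -
  assume "0 < n" "nmul n \<gamma> \<in> divisible_hull G"
  then obtain m where "0 < m" "nmul (m * n) \<gamma> \<in> G" by (auto simp: divisible_hull_def' nmul_nmul)
  with \<open>0 < n\<close> show ?thesis by (auto simp: divisible_hull_def' intro!: exI[of _ "m * n"])
qed

locale ordered_subgroup =
  fixes G :: "'g::linordered_ab_group_add set"
  assumes zero_mem [simp, intro]: "0 \<in> G"
    and add_mem [simp, intro]: "x \<in> G \<Longrightarrow> y \<in> G \<Longrightarrow> x + y \<in> G"
    and uminus_mem [simp, intro]: "x \<in> G \<Longrightarrow> - x \<in> G"
begin

lemma diff_mem [simp, intro]: "x \<in> G \<Longrightarrow> y \<in> G \<Longrightarrow> x - y \<in> G"
  using add_mem[of x "- y"] by simp

lemma uminus_mem_iff [simp]: "- x \<in> G \<longleftrightarrow> x \<in> G"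
  using uminus_mem[of "- x"] by auto

lemma nmul_mem [simp, intro]: "x \<in> G \<Longrightarrow> nmul n x \<in> G"
  by (induction n) (auto simp: nmul_Suc)

lemma divisible_hull_subgroup: "ordered_subgroup (divisible_hull G)"
proof
  fix x y assume "x \<in> divisible_hull G" "y \<in> divisible_hull G"
  then obtain m n where mn: "0 < m" "0 < n" "nmul m x \<in> G" "nmul n y \<in> G"
    unfolding divisible_hull_def' by auto
  have "nmul (m * n) (x + y) = nmul n (nmul m x) + nmul m (nmul n y)"
    by (simp add: nmul_add nmul_nmul mult.commute)
  then show "x + y \<in> divisible_hull G"
    unfolding divisible_hull_def' using mn by (auto intro!: exI[of _ "m * n"])
qed (auto simp: divisible_hull_def')

lemma equiv_equal_modulo: "equiv UNIV (equal_modulo G)"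
proof (rule equivI)
  show "refl (equal_modulo G)"
    by (rule refl_onI) (auto simp: equal_modulo_def intro!: bexI[of _ 0])
  show "sym (equal_modulo G)"
  proof (rule symI)
    fix C D assume "(C, D) \<in> equal_modulo G"
    then obtain \<alpha> where \<alpha>: "\<alpha> \<in> G" "D = (+) \<alpha> ` C" by (auto simp: equal_modulo_def)
    then have "C = (+) (- \<alpha>) ` D" by (simp add: image_image)
    then show "(D, C) \<in> equal_modulo G"
      unfolding equal_modulo_def using uminus_mem[OF \<alpha>(1)] by blast
  qed
  show "trans (equal_modulo G)"
  proof (rule transI)
    fix C D E assume "(C, D) \<in> equal_modulo G" "(D, E) \<in> equal_modulo G"
    then obtain \<alpha> \<beta> where \<alpha>: "\<alpha> \<in> G" "D = (+) \<alpha> ` C" and \<beta>: "\<beta> \<in> G" "E = (+) \<beta> ` D"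
      by (auto simp: equal_modulo_def)
    then have "E = (+) (\<beta> + \<alpha>) ` C" by (simp add: image_image add.assoc)
    then show "(C, E) \<in> equal_modulo G" using \<alpha>(1) \<beta>(1) by (auto simp: equal_modulo_def)
  qed
qed simp

end

lemma divisible_hull_idem: "divisible_hull (divisible_hull G) = divisible_hull G"
proof
  show "divisible_hull (divisible_hull G) \<subseteq> divisible_hull G"
  proof
    fix \<gamma> assume "\<gamma> \<in> divisible_hull (divisible_hull G)"
    then obtain n where "0 < n" "nmul n \<gamma> \<in> divisible_hull G"
      by (auto simp: divisible_hull_def'[of "divisible_hull G"])
    then show "\<gamma> \<in> divisible_hull G" by (rule divisible_hull_root)
  qed
  show "divisible_hull G \<subseteq> divisible_hull (divisible_hull G)"
    by (rule subsetI) (rule divisible_hull_incl)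
qed

locale valued =
  fixes v :: "'a::field \<Rightarrow> 'g::linordered_ab_group_add"
  assumes valuation: "valuation_on UNIV v"
begin

lemma v_mult: "x \<noteq> 0 \<Longrightarrow> y \<noteq> 0 \<Longrightarrow> v (x * y) = v x + v y"
  using valuation by (auto simp: valuation_on_def)

lemma v_add: "x \<noteq> 0 \<Longrightarrow> y \<noteq> 0 \<Longrightarrow> x + y \<noteq> 0 \<Longrightarrow> min (v x) (v y) \<le> v (x + y)"
  using valuation by (auto simp: valuation_on_def)

lemma v_1 [simp]: "v 1 = 0"
  using v_mult[of 1 1] by simp

lemma v_uminus [simp]: "v (- x) = v x"
proof (cases "x = 0")
  case False
  have "v (- 1) + v (- 1) = 0" using v_mult[of "- 1" "- 1"] by simp
  then have "v (- 1) = 0" by (simp add: double_zero)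
  then show ?thesis using v_mult[of "- 1" x] False by simp
qed simp

lemma v_minus_commute: "v (x - y) = v (y - x)"
  using v_uminus[of "x - y"] by simp

lemma v_inverse: "x \<noteq> 0 \<Longrightarrow> v (inverse x) = - v x"
  using v_mult[of x "inverse x"] by (simp add: eq_neg_iff_add_eq_0 add.commute)

lemma v_divide: "x \<noteq> 0 \<Longrightarrow> y \<noteq> 0 \<Longrightarrow> v (x / y) = v x - v y"
  by (simp add: divide_inverse v_mult v_inverse)

lemma v_power: "x \<noteq> 0 \<Longrightarrow> v (x ^ n) = nmul n (v x)"
  by (induction n) (auto simp: v_mult nmul_Suc add.commute)

text \<open>Lower bounds on values that treat \<open>v 0\<close> as infinite.\<close>

definition vge :: "'g \<Rightarrow> 'a \<Rightarrow> bool" where "vge \<gamma> x \<longleftrightarrow> x = 0 \<or> \<gamma> \<le> v x"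

definition vgt :: "'g \<Rightarrow> 'a \<Rightarrow> bool" where "vgt \<gamma> x \<longleftrightarrow> x = 0 \<or> \<gamma> < v x"

lemma vge_0 [simp]: "vge \<gamma> 0" and vgt_0 [simp]: "vgt \<gamma> 0"
  by (simp_all add: vge_def vgt_def)

lemma vge_add: "vge \<gamma> x \<Longrightarrow> vge \<gamma> y \<Longrightarrow> vge \<gamma> (x + y)"
  using v_add[of x y] by (cases "x = 0"; cases "y = 0"; cases "x + y = 0") (auto simp: vge_def min_def split: if_splits)

lemma vgt_add: "vgt \<gamma> x \<Longrightarrow> vgt \<gamma> y \<Longrightarrow> vgt \<gamma> (x + y)"
  using v_add[of x y] by (cases "x = 0"; cases "y = 0"; cases "x + y = 0") (auto simp: vgt_def min_def split: if_splits)

lemma vge_uminus [simp]: "vge \<gamma> (- x) = vge \<gamma> x" and vgt_uminus [simp]: "vgt \<gamma> (- x) = vgt \<gamma> x"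
  by (simp_all add: vge_def vgt_def)

lemma vge_diff: "vge \<gamma> x \<Longrightarrow> vge \<gamma> y \<Longrightarrow> vge \<gamma> (x - y)"
  using vge_add[of \<gamma> x "- y"] by simp

lemma vgt_sum: "(\<And>i. i \<in> I \<Longrightarrow> vgt \<gamma> (f i)) \<Longrightarrow> vgt \<gamma> (sum f I)"
  by (induction I rule: infinite_finite_induct) (auto intro: vgt_add)

lemma v_add_eq:
  assumes "x \<noteq> 0" "vgt (v x) y"
  shows "x + y \<noteq> 0" "v (x + y) = v x"
proof -
  show ne: "x + y \<noteq> 0"
    using assms v_uminus[of y] by (auto simp: vgt_def add_eq_0_iff)
  show "v (x + y) = v x"
  proof (cases "y = 0")
    case False
    then have "v x < v y" using assms(2) by (simp add: vgt_def)
    moreover have "min (v x) (v y) \<le> v (x + y)" using v_add assms ne False by blast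
    moreover have "min (v (x + y)) (v y) \<le> v x" using v_add[of "x + y" "- y"] assms ne False by simp
    ultimately show ?thesis by (auto simp: min_def split: if_splits)
  qed simp
qed

lemma v_eqI: "x \<noteq> 0 \<Longrightarrow> vgt (v x) (y - x) \<Longrightarrow> y \<noteq> 0 \<and> v y = v x"
  using v_add_eq[of x "y - x"] by simp

lemma v_sum_dominant:
  assumes "finite J" "j \<in> J" "t j \<noteq> 0" "\<And>i. i \<in> J \<Longrightarrow> i \<noteq> j \<Longrightarrow> vgt (v (t j)) (t i)"
  shows "sum t J \<noteq> 0" "v (sum t J) = v (t j)"
proof -
  have "vgt (v (t j)) (sum t (J - {j}))" using assms(4) by (intro vgt_sum) auto
  then show "sum t J \<noteq> 0" "v (sum t J) = v (t j)"
    using v_add_eq[OF assms(3)] sum.remove[OF assms(1,2), of t] by auto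
qed

lemma vge_mult: "vge \<gamma> x \<Longrightarrow> vge \<delta> y \<Longrightarrow> vge (\<gamma> + \<delta>) (x * y)"
  by (cases "x = 0"; cases "y = 0") (auto simp: vge_def v_mult intro: add_mono)

end

locale valued_subfield = valued v + ambient_subfield F
  for v :: "'a::field \<Rightarrow> 'g::linordered_ab_group_add" and F :: "'a set"
begin

sublocale value_group: ordered_subgroup "value_group v F"
proof
  show "0 \<in> value_group v F"
    unfolding value_group_def by (rule image_eqI[of _ _ 1]) auto
  show "x + y \<in> value_group v F" if "x \<in> value_group v F" "y \<in> value_group v F" for x y
  proof -
    obtain a b where "a \<in> F - {0}" "b \<in> F - {0}" "x = v a" "y = v b"
      using \<open>x \<in> _\<close> \<open>y \<in> _\<close> by (auto simp: value_group_def)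
    then show ?thesis
      unfolding value_group_def by (intro image_eqI[of _ _ "a * b"]) (auto simp: v_mult)
  qed
  show "- x \<in> value_group v F" if "x \<in> value_group v F" for x
  proof -
    obtain a where "a \<in> F - {0}" "x = v a"
      using \<open>x \<in> _\<close> by (auto simp: value_group_def)
    then show ?thesis
      unfolding value_group_def by (intro image_eqI[of _ _ "inverse a"]) (auto simp: v_inverse)
  qed
qed

lemma value_groupI [intro]: "x \<in> F \<Longrightarrow> x \<noteq> 0 \<Longrightarrow> v x \<in> value_group v F"
  by (auto simp: value_group_def)

end

lemma (in valued) valued_subfieldI: "subfield F \<Omega> \<Longrightarrow> valued_subfield v F"
  by (intro valued_subfield.intro ambient_subfield.intro valued_axioms)

lemma value_group_mono: "F \<subseteq> E \<Longrightarrow> value_group v F \<subseteq> value_group v E"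
  by (auto simp: value_group_def)

subsection \<open>Kaplansky's lemma\<close>

text \<open>An element outside \<open>F\<close> of an immediate extension behaves like this. The
  property is stated for a single element, so that it can also be transferred to p-th roots outside
  any extension known to be immediate.\<close>

locale approximation = valued_subfield v F
  for v :: "'a::field \<Rightarrow> 'g::linordered_ab_group_add" and F :: "'a set" +
  fixes b :: 'a
  assumes b_notin: "b \<notin> F"
    and no_max: "c \<in> F \<Longrightarrow> \<exists>c'\<in>F. v (b - c) < v (b - c')"
begin

text \<open>The filter of elements of \<open>F\<close> approaching \<open>b\<close>. It takes the
  place of a pseudo-convergent sequence with limit \<open>b\<close>, so no cofinal sequence of
  values has to be chosen.\<close>

definition near :: "'a filter"
  where "near = (INF c\<in>F. principal {c'\<in>F. v (b - c) \<le> v (b - c')})"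

lemma eventually_near:
  "eventually P near \<longleftrightarrow> (\<exists>c\<in>F. \<forall>c'\<in>F. v (b - c) \<le> v (b - c') \<longrightarrow> P c')"
proof -
  have "eventually P near \<longleftrightarrow> (\<exists>c\<in>F. eventually P (principal {c'\<in>F. v (b - c) \<le> v (b - c')}))"
    unfolding near_def
  proof (rule eventually_INF_base)
    show "F \<noteq> {}" using zero_mem by auto
    fix x y assume "x \<in> F" "y \<in> F"
    then show "\<exists>z\<in>F. principal {c'\<in>F. v (b - z) \<le> v (b - c')} \<le>
        inf (principal {c'\<in>F. v (b - x) \<le> v (b - c')}) (principal {c'\<in>F. v (b - y) \<le> v (b - c')})"
      by (cases "v (b - x) \<le> v (b - y)")
         (auto simp: not_le intro: bexI[of _ x] bexI[of _ y])
  qed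
  then show ?thesis by (auto simp: eventually_principal)
qed

lemma near_nontrivial: "near \<noteq> bot"
  unfolding trivial_limit_def eventually_near by blast

lemma near_ex: "eventually P near \<Longrightarrow> \<exists>c\<in>F. P c"
  unfolding eventually_near by blast

lemma near_mem: "eventually (\<lambda>c. c \<in> F) near"
  unfolding eventually_near by (intro bexI[of _ 0]) auto

lemma neq_mem [simp]: "c \<in> F \<Longrightarrow> b \<noteq> c" "c \<in> F \<Longrightarrow> c \<noteq> b"
  using b_notin by auto

lemma near_greater: "c \<in> F \<Longrightarrow> eventually (\<lambda>c'. v (b - c) < v (b - c')) near"
  unfolding eventually_near using no_max[of c] by (meson less_le_trans)

text \<open>If no value passes \<delta>, then none equals it either, because every value is exceeded
  by another one.\<close>

lemma eventually_nmul_cases: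
  assumes "0 < h"
  shows "eventually (\<lambda>c. \<delta> < nmul h (v (b - c))) near \<or> (\<forall>c\<in>F. nmul h (v (b - c)) < \<delta>)"
proof (cases "\<exists>c\<in>F. \<delta> < nmul h (v (b - c))")
  case True
  then obtain c where c: "c \<in> F" "\<delta> < nmul h (v (b - c))" by blast
  have "\<delta> < nmul h (v (b - c'))" if "v (b - c) \<le> v (b - c')" for c'
    using c(2) nmul_mono[OF that, of h] by simp
  with c(1) show ?thesis unfolding eventually_near by auto
next
  case False
  have "nmul h (v (b - c)) < \<delta>" if c: "c \<in> F" for c
  proof -
    obtain c' where "c' \<in> F" "v (b - c) < v (b - c')" using no_max[OF c] by blast
    then show ?thesis using False assms nmul_less_iff[of h "v (b - c)" "v (b - c')"]
      by (metis less_le_trans linorder_not_less)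
  qed
  then show ?thesis by blast
qed

lemma eventually_not_constant:
  assumes "0 < h" shows "\<not> eventually (\<lambda>c. nmul h (v (b - c)) = \<delta>) near"
proof
  assume *: "eventually (\<lambda>c. nmul h (v (b - c)) = \<delta>) near"
  then obtain c where c: "c \<in> F" "nmul h (v (b - c)) = \<delta>" using near_ex by blast
  have "eventually (\<lambda>c'. False) near"
    using * near_greater[OF c(1)]
    by eventually_elim (metis assms c(2) nmul_less_iff less_irrefl)
  then show False using near_nontrivial by (simp add: trivial_limit_def)
qed

text \<open>The difference of the two sides is a linear function of v(b - c) with nonzero slope, and
  v(b - c) increases without maximum, so the sign is eventually constant.\<close>

lemma eventually_compare:
  assumes "m \<noteq> n"
  shows "eventually (\<lambda>c. \<alpha> + nmul m (v (b - c)) < \<beta> + nmul n (v (b - c))) near \<or>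
         eventually (\<lambda>c. \<beta> + nmul n (v (b - c)) < \<alpha> + nmul m (v (b - c))) near"
  using assms
proof (induction m n arbitrary: \<alpha> \<beta> rule: linorder_wlog)
  case (le m n)
  define d where "d = n - m"
  have d: "0 < d" "n = m + d" using le by (auto simp: d_def)
  have *: "\<alpha> + nmul m (v (b - c)) < \<beta> + nmul n (v (b - c)) \<longleftrightarrow> \<alpha> - \<beta> < nmul d (v (b - c))"
    "\<beta> + nmul n (v (b - c)) < \<alpha> + nmul m (v (b - c)) \<longleftrightarrow> nmul d (v (b - c)) < \<alpha> - \<beta>" for c
    unfolding d(2) nmul_add_left by (simp_all add: algebra_simps)
  show ?case
    unfolding * using eventually_nmul_cases[OF d(1), of "\<alpha> - \<beta>"]
    by (elim disjE) (auto intro: eventually_mono[OF near_mem])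
next
  case (sym m n)
  then show ?case by blast
qed

text \<open>Ostrowski's observation on finitely many linear functions with distinct slopes: one of
  them is eventually the strict minimum. This is what makes sums of terms with such values
  computable.\<close>

lemma eventually_dominant:
  assumes "finite J" "J \<noteq> {}" "inj_on e J"
  shows "\<exists>j\<in>J. eventually (\<lambda>c. \<forall>i\<in>J. i \<noteq> j \<longrightarrow> \<rho> j + nmul (e j) (v (b - c)) < \<rho> i + nmul (e i) (v (b - c))) near"
  using assms
proof (induction J rule: finite_ne_induct)
  case (singleton x)
  then show ?case by auto
next
  case (insert k J)
  then obtain j where j: "j \<in> J"
    "eventually (\<lambda>c. \<forall>i\<in>J. i \<noteq> j \<longrightarrow> \<rho> j + nmul (e j) (v (b - c)) < \<rho> i + nmul (e i) (v (b - c))) near"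
    by (auto simp: inj_on_insert)
  have "e j \<noteq> e k" using insert j by (auto simp: inj_on_def)
  from eventually_compare[OF this, of "\<rho> j" "\<rho> k"] show ?case
  proof
    assume "eventually (\<lambda>c. \<rho> j + nmul (e j) (v (b - c)) < \<rho> k + nmul (e k) (v (b - c))) near"
    with j(2) show ?thesis
      by (intro bexI[of _ j]) (use j in \<open>auto elim: eventually_elim2\<close>)
  next
    assume "eventually (\<lambda>c. \<rho> k + nmul (e k) (v (b - c)) < \<rho> j + nmul (e j) (v (b - c))) near"
    with j(2) have "eventually (\<lambda>c. \<forall>i\<in>insert k J. i \<noteq> k \<longrightarrow> \<rho> k + nmul (e k) (v (b - c)) < \<rho> i + nmul (e i) (v (b - c))) near"
      by eventually_elim (metis insertE less_trans)
    then show ?thesis by blast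
  qed
qed

end

section \<open>Values of polynomials near the approximated element\<close>

context approximation
begin

text \<open>The eventual value is required to be that of \<open>poly f b\<close>, not merely to be
  constant; in particular \<open>b\<close> is not a root of a stable polynomial.\<close>

definition stable :: "'a poly \<Rightarrow> bool"
  where "stable f \<longleftrightarrow> poly f b \<noteq> 0 \<and>
    eventually (\<lambda>c. poly f c \<noteq> 0 \<and> v (poly f c) = v (poly f b)) near"

definition dominant_term :: "'a poly \<Rightarrow> nat \<Rightarrow> 'a \<Rightarrow> bool"
  where "dominant_term f h = (\<lambda>c. (\<forall>i\<in>{1..degree f}. i \<noteq> h \<longrightarrow> hasse i f \<noteq> 0 \<longrightarrow>
        v (poly (hasse h f) b) + nmul h (v (b - c)) < v (poly (hasse i f) b) + nmul i (v (b - c)))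
      \<and> poly f b \<noteq> poly f c
      \<and> v (poly f b - poly f c) = v (poly (hasse h f) b) + nmul h (v (b - c)))"

text \<open>In the Taylor expansion of f(b) at c the coefficients are Hasse derivatives of smaller
  degree, hence stable. So the values of the summands are linear functions of v(b - c) with distinct
  slopes, and one summand dominates. Stability also allows the coefficients in
  \<open>dominant_term\<close> to be evaluated at \<open>b\<close> instead of c.\<close>

lemma taylor_dominant:
  assumes f: "f \<in> polys F" "0 < degree f"
    and stable: "\<And>q. q \<in> polys F \<Longrightarrow> q \<noteq> 0 \<Longrightarrow> degree q < degree f \<Longrightarrow> stable q"
  obtains h where "1 \<le> h" "h \<le> degree f" "hasse h f \<noteq> 0"
    "eventually (dominant_term f h) near"
proof -
  define B where "B i = v (poly (hasse i f) b)" for i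
  define J where "J = {i\<in>{1..degree f}. hasse i f \<noteq> 0}"
  have finJ: "finite J" by (simp add: J_def)
  have "degree f \<in> J" using f(2) by (auto simp: J_def hasse_degree)
  then have neJ: "J \<noteq> {}" by blast
  have st: "stable (hasse i f)" if "i \<in> J" for i
    using that degree_hasse[of i f] f by (intro stable) (auto simp: J_def)
  obtain h where h: "h \<in> J"
    "eventually (\<lambda>c. \<forall>i\<in>J. i \<noteq> h \<longrightarrow> B h + nmul h (v (b - c)) < B i + nmul i (v (b - c))) near"
    using eventually_dominant[OF finJ neJ, of "\<lambda>i. i" B] by auto
  have "eventually (\<lambda>c. \<forall>i\<in>J. poly (hasse i f) c \<noteq> 0 \<and> v (poly (hasse i f) c) = B i) near"
    using st finJ by (intro eventually_ball_finite) (auto simp: stable_def B_def)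
  with h(2) near_mem
  have "eventually (\<lambda>c. (\<forall>i\<in>J. i \<noteq> h \<longrightarrow> B h + nmul h (v (b - c)) < B i + nmul i (v (b - c)))
      \<and> poly f b \<noteq> poly f c \<and> v (poly f b - poly f c) = B h + nmul h (v (b - c))) near"
  proof eventually_elim
    case (elim c)
    define t where "t i = poly (hasse i f) c * (b - c) ^ i" for i
    have t: "t i \<noteq> 0" "v (t i) = B i + nmul i (v (b - c))" if "i \<in> J" for i
      using elim that by (auto simp: t_def v_mult v_power)
    have "poly f b = (\<Sum>i\<le>degree f. t i)"
      using poly_taylor[of f c "b - c"] by (simp add: t_def)
    also have "{..degree f} = insert 0 {1..degree f}" by auto
    also have "sum t \<dots> = poly f c + (\<Sum>i\<in>{1..degree f}. t i)" by (simp add: t_def)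
    also have "(\<Sum>i\<in>{1..degree f}. t i) = sum t J"
      by (rule sum.mono_neutral_right) (auto simp: J_def t_def)
    finally have "poly f b - poly f c = sum t J" by simp
    moreover have "sum t J \<noteq> 0" "v (sum t J) = v (t h)"
      using v_sum_dominant[OF finJ h(1), of t] elim t h(1) by (auto simp: vgt_def)
    ultimately show ?case using elim t[OF h(1)] by auto
  qed
  note ev = this
  show ?thesis
  proof (rule that)
    show "1 \<le> h" "h \<le> degree f" "hasse h f \<noteq> 0" using h(1) by (auto simp: J_def)
  qed (rule eventually_mono[OF ev], auto simp: J_def B_def dominant_term_def)
qed

text \<open>The value of f(b) - f(c) is a linear function of v(b - c) with slope h. If it eventually
  exceeds v(f(b)), then \<open>f\<close> is stable; otherwise it always stays below v(f(b)) and
  determines v(f(c)).\<close>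

lemma nonstable_value:
  assumes f: "f \<in> polys F" "0 < degree f" "\<not> stable f"
    and stable: "\<And>q. q \<in> polys F \<Longrightarrow> q \<noteq> 0 \<Longrightarrow> degree q < degree f \<Longrightarrow> stable q"
  obtains h \<beta> where "1 \<le> h" "h \<le> degree f"
    "eventually (\<lambda>c. poly f c \<noteq> 0 \<and> v (poly f c) = \<beta> + nmul h (v (b - c))) near"
proof -
  obtain h where h: "1 \<le> h" "h \<le> degree f"
    and dom: "eventually (dominant_term f h) near"
    by (rule taylor_dominant[OF f(1,2) stable])
  define \<beta> where "\<beta> = v (poly (hasse h f) b)"
  have ev: "eventually (\<lambda>c. poly f b \<noteq> poly f c \<and> v (poly f b - poly f c) = \<beta> + nmul h (v (b - c))) near"
    using dom unfolding \<beta>_def dominant_term_def by (rule eventually_mono) blast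
  have "eventually (\<lambda>c. poly f c \<noteq> 0 \<and> v (poly f c) = \<beta> + nmul h (v (b - c))) near"
  proof (cases "poly f b = 0")
    case True
    then show ?thesis using ev by simp
  next
    case False
    define \<phi> where "\<phi> = v (poly f b)"
    from h(1) have "0 < h" by simp
    from eventually_nmul_cases[OF this, of "\<phi> - \<beta>"] show ?thesis
    proof
      assume "eventually (\<lambda>c. \<phi> - \<beta> < nmul h (v (b - c))) near"
      with ev have "eventually (\<lambda>c. poly f c \<noteq> 0 \<and> v (poly f c) = \<phi>) near"
      proof eventually_elim
        case (elim c)
        then have "vgt (v (poly f b)) (poly f c - poly f b)"
          unfolding vgt_def v_minus_commute[of "poly f c" "poly f b"] by (simp add: \<phi>_def diff_less_eq add.commute)
        then show ?case using v_eqI[OF False, of "poly f c"] by (simp add: \<phi>_def)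
      qed
      then have "stable f" using False by (simp add: stable_def \<phi>_def)
      with f(3) show ?thesis by simp
    next
      assume *: "\<forall>c\<in>F. nmul h (v (b - c)) < \<phi> - \<beta>"
      from ev near_mem show ?thesis
      proof eventually_elim
        case (elim c)
        define x where "x = poly f c - poly f b"
        have "nmul h (v (b - c)) < \<phi> - \<beta>" using * elim by blast
        then have "x \<noteq> 0" "v x = \<beta> + nmul h (v (b - c))" "v x < v (poly f b)"
          using elim by (auto simp: x_def \<phi>_def v_minus_commute[of "poly f c" "poly f b"] less_diff_eq add.commute)
        then show ?case using v_add_eq[of x "poly f b"] by (auto simp: x_def vgt_def)
      qed
    qed
  qed
  with h show ?thesis by (rule that)
qed

lemma stable_const: "a \<noteq> 0 \<Longrightarrow> stable [:a:]"
  by (simp add: stable_def)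

lemma stable_linear:
  assumes "a \<in> F" "a' \<in> F" "a' \<noteq> 0"
  shows "stable [:a, a':]"
proof -
  define r where "r = - a / a'"
  have r: "r \<in> F" using assms by (auto simp: r_def)
  have eq: "poly [:a, a':] x = a' * (x - r)" for x using assms by (simp add: r_def field_simps)
  have "eventually (\<lambda>c. c - r \<noteq> 0 \<and> v (c - r) = v (b - r)) near"
    using near_greater[OF r] near_mem
  proof eventually_elim
    case (elim c)
    then have "vgt (v (b - r)) ((c - r) - (b - r))" by (simp add: vgt_def v_minus_commute[of c b])
    then show ?case using v_eqI[of "b - r" "c - r"] r by simp
  qed
  then show ?thesis
    unfolding stable_def eq using assms r by (auto simp: v_mult elim: eventually_mono)
qed

end

text \<open>
  The polynomial \<open>g\<close> plays the role of the minimal polynomial of \<open>b\<close>, all of whose roots are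
  approximated by elements of \<open>F\<close> as well as \<open>b\<close> is.
\<close>

locale kaplansky = approximation v F b
  for v :: "'a::field \<Rightarrow> 'g::linordered_ab_group_add" and F :: "'a set" and b :: 'a +
  fixes p :: nat and g :: "'a poly"
  assumes prime_p: "prime p"
    and g_polys: "g \<in> polys F"
    and degree_g: "degree g = p"
    and value_g: "eventually (\<lambda>c. poly g c \<noteq> 0 \<and> v (poly g c) = nmul p (v (b - c))) near"
begin

lemma exponent_eq:
  assumes "eventually (\<lambda>c. \<rho> + nmul k (v (b - c)) = nmul p (v (b - c))) near"
  shows "k = p"
proof (rule ccontr)
  assume "k \<noteq> p"
  then consider d where "0 < d" "p = k + d" | d where "0 < d" "k = p + d"
    by (metis less_imp_add_positive linorder_neqE_nat)
  then show False
  proof cases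
    case 1
    have "eventually (\<lambda>c. nmul d (v (b - c)) = \<rho>) near"
      using assms by eventually_elim (simp add: 1 nmul_add_left)
    with eventually_not_constant 1 show False by blast
  next
    case 2
    have "eventually (\<lambda>c. nmul d (v (b - c)) = - \<rho>) near"
      using assms by eventually_elim (simp add: 2 nmul_add_left algebra_simps add_eq_0_iff)
    with eventually_not_constant 2 show False by blast
  qed
qed

text \<open>For an unstable \<open>f\<close> of least degree, v(f(c)) has some slope h with 1 \<le>
  h \<le> \<open>degree f\<close>. In the f-adic expansion of \<open>g\<close> the term of index j
  then has slope j h. These slopes are distinct, so one term gives the value of g(c) and j h = p. As
  h < p, primality yields h = 1 and j = p, and a nonzero digit of index p forces \<open>f\<close> to
  be linear. But linear polynomials are stable.\<close>

lemma stable_of_degree_less: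
  assumes "f \<in> polys F" "f \<noteq> 0" "degree f < p"
  shows "stable f"
  using assms
proof (induction "degree f" arbitrary: f rule: less_induct)
  case less
  show ?case
  proof (rule ccontr)
    assume unstable: "\<not> stable f"
    have IH: "stable q" if "q \<in> polys F" "q \<noteq> 0" "degree q < degree f" for q
      using that less by auto
    have n0: "0 < degree f"
    proof (rule ccontr)
      assume "\<not> 0 < degree f"
      then obtain a where "f = [:a:]" by (meson degree_eq_zeroE neq0_conv)
      then show False using unstable less.prems stable_const[of a] by auto
    qed
    obtain h \<beta> where h: "1 \<le> h" "h \<le> degree f"
      and fval: "eventually (\<lambda>c. poly f c \<noteq> 0 \<and> v (poly f c) = \<beta> + nmul h (v (b - c))) near"
      using nonstable_value[OF less.prems(1) n0 unstable IH] by blast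
    obtain s where s: "\<And>j. s j \<in> polys F" "\<And>j. degree (s j) < degree f"
        "\<And>j. degree g < j * degree f \<Longrightarrow> s j = 0" "g = (\<Sum>j\<le>degree g. s j * f ^ j)"
      using polys_adic_expansion[OF less.prems(1) n0 g_polys] by blast
    define J where "J = {j\<in>{..degree g}. s j \<noteq> 0}"
    have finJ: "finite J" by (simp add: J_def)
    have gJ: "g = (\<Sum>j\<in>J. s j * f ^ j)"
      by (subst s(4), rule sum.mono_neutral_right) (auto simp: J_def)
    have neJ: "J \<noteq> {}"
      using gJ degree_g prime_gt_0_nat[OF prime_p] by auto
    define \<rho> where "\<rho> j = v (poly (s j) b) + nmul j \<beta>" for j
    have inj: "inj_on (\<lambda>j. j * h) J" using h(1) by (auto simp: inj_on_def)
    obtain j where j: "j \<in> J"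
      "eventually (\<lambda>c. \<forall>i\<in>J. i \<noteq> j \<longrightarrow> \<rho> j + nmul (j * h) (v (b - c)) < \<rho> i + nmul (i * h) (v (b - c))) near"
      using eventually_dominant[OF finJ neJ inj, of \<rho>] by blast
    have "eventually (\<lambda>c. \<forall>i\<in>J. poly (s i) c \<noteq> 0 \<and> v (poly (s i) c) = v (poly (s i) b)) near"
      using finJ IH s(1,2) by (intro eventually_ball_finite) (auto simp: J_def stable_def)
    with j(2) fval value_g
    have "eventually (\<lambda>c. \<rho> j + nmul (j * h) (v (b - c)) = nmul p (v (b - c))) near"
    proof eventually_elim
      case (elim c)
      define t where "t i = poly (s i) c * poly f c ^ i" for i
      have t: "t i \<noteq> 0" "v (t i) = \<rho> i + nmul (i * h) (v (b - c))" if "i \<in> J" for i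
        using elim that by (auto simp: t_def \<rho>_def v_mult v_power nmul_add nmul_nmul add.assoc)
      have "poly g c = sum t J" by (subst gJ) (simp add: poly_sum t_def)
      then have "v (poly g c) = v (t j)"
        using v_sum_dominant[OF finJ j(1), of t] elim t j(1) by (auto simp: vgt_def)
      then show ?case using elim t[OF j(1)] by simp
    qed
    then have jh: "j * h = p" by (rule exponent_eq)
    then have "h dvd p" by auto
    then have "h = 1" using h less.prems(3) prime_p by (auto simp: prime_nat_iff)
    with jh have "j = p" by simp
    moreover have "\<not> degree g < j * degree f" using s(3)[of j] j(1) by (auto simp: J_def)
    ultimately have "degree f = 1"
      using degree_g n0 prime_gt_0_nat[OF prime_p] by simp
    then obtain a a' where "f = [:a, a':]" "a' \<noteq> 0"
      by (metis degree1_coeffs)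
    moreover from this have "a \<in> F" "a' \<in> F"
      using polysD[OF less.prems(1), of 0] polysD[OF less.prems(1), of 1] by auto
    ultimately show False using stable_linear unstable by blast
  qed
qed

text \<open>
  Stability of the derivative forces the linear term of the Taylor expansion of \<open>f\<close> to dominate.
\<close>

lemma distance_transfer:
  assumes f: "f \<in> polys F" "0 < degree f" "degree f < p"
    and unit: "\<And>i. 0 < i \<Longrightarrow> i < p \<Longrightarrow> of_nat i \<noteq> (0::'a) \<and> v (of_nat i) = 0"
  obtains \<beta> where "\<beta> \<in> value_group v F" "poly f b \<notin> F"
    "\<And>c. c \<in> F \<Longrightarrow> \<exists>c'\<in>F. \<beta> + v (b - c) \<le> v (poly f b - c')"
    "\<And>c'. c' \<in> F \<Longrightarrow> \<exists>c\<in>F. v (poly f b - c') \<le> \<beta> + v (b - c)"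
proof -
  have st: "stable q" if "q \<in> polys F" "q \<noteq> 0" "degree q < p" for q
    using stable_of_degree_less that by blast
  obtain h where h: "1 \<le> h" "h \<le> degree f" "hasse h f \<noteq> 0"
    and ev: "eventually (dominant_term f h) near"
    by (rule taylor_dominant[OF f(1,2)]) (use st f(3) in auto)
  have lead: "coeff (pderiv f) (degree f - 1) \<noteq> 0"
    using f unit[of "degree f"] by (auto simp: coeff_pderiv simp del: of_nat_Suc)
  then have pd0: "pderiv f \<noteq> 0" by auto
  have degpd: "degree (pderiv f) = degree f - 1"
    using le_degree[OF lead] degree_le[of "degree f - 1" "pderiv f"] by (auto simp: coeff_pderiv coeff_eq_0)
  have pdst: "stable (pderiv f)" using f pd0 degpd by (intro st) auto
  \<comment> \<open>Suppose that h = k + 1 with k \<ge> 1. The k-th Taylor coefficient of the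
    derivative f' is h times the h-th one of f, and h is a unit. Dominance of the h-th term over the
    linear one then makes v(f'(b) - f'(c)) smaller than v(f'(b)), although f'(b) and f'(c) have the
    same value by stability.\<close>
  have "h = 1"
  proof (rule ccontr)
    assume "h \<noteq> 1"
    with h(1) obtain k where k: "h = Suc k" "1 \<le> k" by (cases h) auto
    have deg: "0 < degree (pderiv f)" "k \<le> degree (pderiv f)" using k h(2) degpd by auto
    have hk: "hasse k (pderiv f) = smult (of_nat h) (hasse h f)"
      unfolding k(1) by (rule hasse_pderiv)
    have hu: "of_nat h \<noteq> (0::'a)" "v (of_nat h) = 0" using unit[of h] h f(3) by auto
    have sth: "poly (hasse h f) b \<noteq> 0"
      using st[of "hasse h f"] h f(3) degree_hasse[of h f] polys_hasse[OF f(1)] by (auto simp: stable_def)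
    have hk0: "hasse k (pderiv f) \<noteq> 0" using hk hu h(3) by simp
    have vk: "v (poly (hasse k (pderiv f)) b) = v (poly (hasse h f) b)"
      unfolding hk using hu sth by (simp add: v_mult)
    obtain l where l: "1 \<le> l" "l \<le> degree (pderiv f)"
      and ev': "eventually (dominant_term (pderiv f) l) near"
      by (rule taylor_dominant[of "pderiv f"]) (use st f(1,3) deg degpd in auto)
    have "eventually (\<lambda>c. poly (pderiv f) c \<noteq> 0 \<and> v (poly (pderiv f) c) = v (poly (pderiv f) b)) near"
      using pdst by (simp add: stable_def)
    with ev ev' have "eventually (\<lambda>c. False) near"
    proof eventually_elim
      case (elim c)
      let ?\<gamma> = "v (b - c)"
      have "v (poly (hasse h f) b) + nmul h ?\<gamma> < v (poly (hasse 1 f) b) + nmul 1 ?\<gamma>"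
        using bspec[OF elim(1)[unfolded dominant_term_def, THEN conjunct1], of 1] \<open>h \<noteq> 1\<close> pd0 f(2) unfolding hasse_1 by simp
      then have "v (poly (hasse h f) b) + nmul k ?\<gamma> < v (poly (pderiv f) b)"
        unfolding hasse_1 k(1) nmul_Suc by (simp add: add.assoc[symmetric])
      moreover have "v (poly (pderiv f) b - poly (pderiv f) c) \<le> v (poly (hasse h f) b) + nmul k ?\<gamma>"
        using elim(2)[unfolded dominant_term_def] hk0 k(2) deg(2) vk by (cases "k = l") (auto intro: less_imp_le)
      moreover have "vge (v (poly (pderiv f) b)) (poly (pderiv f) b - poly (pderiv f) c)"
        using elim(3) by (intro vge_diff) (auto simp: vge_def)
      ultimately show False using elim(2)[unfolded dominant_term_def] by (auto simp: vge_def)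
    qed
    with near_nontrivial show False by (simp add: trivial_limit_def)
  qed
  define \<beta> where "\<beta> = v (poly (pderiv f) b)"
  have val: "eventually (\<lambda>c. poly f b \<noteq> poly f c \<and> v (poly f b - poly f c) = \<beta> + v (b - c)) near"
    using ev unfolding dominant_term_def \<open>h = 1\<close> hasse_1 \<beta>_def by (auto elim: eventually_mono)
  have stq: "stable (f - [:c:])" if "c \<in> F" for c
  proof -
    have "degree (f - [:c:]) = degree f"
      unfolding diff_conv_add_uminus by (rule degree_add_eq_left) (use f(2) in simp)
    then show ?thesis using f that by (intro st) auto
  qed
  show ?thesis
  proof
    have "eventually (\<lambda>c. c \<in> F \<and> poly (pderiv f) c \<noteq> 0 \<and> v (poly (pderiv f) c) = \<beta>) near"
      using pdst near_mem by (auto simp: stable_def \<beta>_def elim: eventually_elim2)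
    then obtain c where "c \<in> F" "poly (pderiv f) c \<noteq> 0" "v (poly (pderiv f) c) = \<beta>"
      using near_ex by blast
    then show "\<beta> \<in> value_group v F" using f(1) by auto
  next
    show "poly f b \<notin> F"
    proof
      assume "poly f b \<in> F"
      from stq[OF this] show False by (simp add: stable_def)
    qed
  next
    fix c assume c: "c \<in> F"
    have "eventually (\<lambda>c'. c' \<in> F \<and> \<beta> + v (b - c) \<le> v (poly f b - poly f c')) near"
      using val near_greater[OF c] near_mem by eventually_elim auto
    then show "\<exists>c'\<in>F. \<beta> + v (b - c) \<le> v (poly f b - c')"
      using near_ex f(1) by blast
  next
    \<comment> \<open>If c' approximated f(b) better than f(c) for some c near \<open>b\<close>,
      then f(c) - c' would have the value of f(c) - f(b), contrary to the stability of f -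
      c'.\<close>
    fix c' assume c': "c' \<in> F"
    have "eventually (\<lambda>c. c \<in> F \<and> v (poly f b - c') \<le> \<beta> + v (b - c)) near"
      using val near_mem stq[OF c', unfolded stable_def, THEN conjunct2]
    proof eventually_elim
      case (elim c)
      show ?case
      proof (rule ccontr)
        assume "\<not> ?thesis"
        then have lt: "\<beta> + v (b - c) < v (poly f b - c')" using elim by auto
        define x where "x = poly f c - poly f b"
        have x: "x \<noteq> 0" "v x = \<beta> + v (b - c)"
          using elim by (auto simp: x_def v_minus_commute[of "poly f c" "poly f b"])
        have "v (x + (poly f b - c')) = v x"
          using x lt by (intro v_add_eq) (auto simp: vgt_def)
        then show False using elim x lt by (simp add: x_def)
      qed
    qed
    then show "\<exists>c\<in>F. v (poly f b - c') \<le> \<beta> + v (b - c)"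
      using near_ex by blast
  qed
qed

end

subsection \<open>Simple extensions\<close>

context ambient_subfield
begin

lemma simple_extension_eq: "adjoin F x = {poly f x | f. f \<in> polys F}"
proof (intro equalityI subsetI)
  fix y assume "y \<in> adjoin F x"
  then show "y \<in> {poly f x | f. f \<in> polys F}"
  proof induction
    case zero
    then show ?case by (auto intro!: exI[of _ 0])
  next
    case (lin k1 k2)
    then obtain f where "f \<in> polys F" "k1 = poly f x" by blast
    with lin show ?case by (auto intro!: exI[of _ "pCons k2 f"] simp: algebra_simps)
  qed
next
  fix y assume "y \<in> {poly f x | f. f \<in> polys F}"
  then obtain f where f: "f \<in> polys F" "y = poly f x" by blast
  have "poly f x \<in> adjoin F x" using f(1)
  proof (induction f)
    case 0
    then show ?case using amb.simple_extension.zero by simp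
  next
    case (pCons a f)
    have "f \<in> polys F" "a \<in> F"
      using pCons.prems by (auto simp: polys_def coeff_pCons split: nat.splits dest: spec[of _ 0] spec[of _ "Suc _"])
    with pCons show ?case
      using amb.simple_extension.lin[of "poly f x" F x a] by (simp add: algebra_simps)
  qed
  with f show "y \<in> adjoin F x" by simp
qed

lemma subset_simple_extension: "F \<subseteq> adjoin F x"
  by (rule amb.simple_extension_incl) auto

lemma mem_simple_extension: "x \<in> adjoin F x"
  by (rule amb.simple_extension_mem) (auto intro: subfieldE(1) subfield)

lemma exp_base_Suc: "amb.exp_base x (Suc n) = x ^ n # amb.exp_base x n"
  by (simp add: amb.exp_base_def)

text \<open>The bound is placed on the coefficients because \<open>degree f < n\<close> would
  exclude the zero polynomial for n = 0.\<close>

lemma Span_exp_base_iff: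
  "y \<in> amb.Span F (amb.exp_base x n) \<longleftrightarrow> (\<exists>f\<in>polys F. (\<forall>i\<ge>n. coeff f i = 0) \<and> y = poly f x)"
proof (induction n arbitrary: y)
  case 0
  have "(\<forall>i. coeff f i = 0) \<longleftrightarrow> f = 0" for f :: "'a poly" by (simp add: poly_eq_iff)
  then show ?case by (auto simp: amb.exp_base_def)
next
  case (Suc n)
  have "y \<in> amb.Span F (amb.exp_base x (Suc n)) \<longleftrightarrow>
    (\<exists>k\<in>F. \<exists>w\<in>amb.Span F (amb.exp_base x n). y = k * x ^ n + w)"
    unfolding exp_base_Suc using amb.line_extension_mem_iff by simp
  also have "\<dots> \<longleftrightarrow> (\<exists>f\<in>polys F. (\<forall>i\<ge>Suc n. coeff f i = 0) \<and> y = poly f x)"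
  proof (intro iffI; elim bexE conjE)
    fix k w assume k: "k \<in> F" and w: "w \<in> amb.Span F (amb.exp_base x n)" and y: "y = k * x ^ n + w"
    then obtain f where f: "f \<in> polys F" "\<forall>i\<ge>n. coeff f i = 0" "w = poly f x" using Suc by blast
    then show "\<exists>f\<in>polys F. (\<forall>i\<ge>Suc n. coeff f i = 0) \<and> y = poly f x"
      using k y by (intro bexI[of _ "monom k n + f"]) (auto simp: poly_monom)
  next
    fix f assume f: "f \<in> polys F" "\<forall>i\<ge>Suc n. coeff f i = 0" "y = poly f x"
    let ?k = "coeff f n" and ?r = "f - monom (coeff f n) n"
    have r: "?r \<in> polys F" using f(1) by (intro polys_diff polys_monom polysD)
    moreover have "coeff ?r i = 0" if "n \<le> i" for i
      using f(2) that by (cases "i = n") (auto simp: coeff_monom)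
    ultimately have "poly ?r x \<in> amb.Span F (amb.exp_base x n)" using Suc by blast
    then show "\<exists>k\<in>F. \<exists>w\<in>amb.Span F (amb.exp_base x n). y = k * x ^ n + w"
      using f polysD by (intro bexI[of _ ?k] bexI[of _ "poly ?r x"]) (auto simp: poly_monom)
  qed
  finally show ?case .
qed

lemma independent_exp_base:
  assumes "\<And>f. f \<in> polys F \<Longrightarrow> f \<noteq> 0 \<Longrightarrow> degree f < n \<Longrightarrow> poly f x \<noteq> 0"
  shows "amb.independent F (amb.exp_base x n)"
  using assms
proof (induction n)
  case 0
  then show ?case by (simp add: amb.exp_base_def)
next
  case (Suc n)
  have "x ^ n \<notin> amb.Span F (amb.exp_base x n)"
  proof
    assume "x ^ n \<in> amb.Span F (amb.exp_base x n)"
    then obtain f where f: "f \<in> polys F" "\<forall>i\<ge>n. coeff f i = 0" "x ^ n = poly f x"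
      unfolding Span_exp_base_iff by blast
    let ?g = "monom 1 n - f"
    have "coeff ?g n = 1" using f(2) by simp
    then have "?g \<noteq> 0" by auto
    moreover have "degree ?g < Suc n"
      using f(2) by (intro le_imp_less_Suc degree_le) (auto simp: coeff_monom)
    moreover have "?g \<in> polys F" "poly ?g x = 0" using f by (auto simp: poly_monom)
    ultimately show False using Suc.prems by blast
  qed
  then show ?case
    unfolding exp_base_Suc using Suc by (intro amb.li_Cons) auto
qed

lemma length_exp_base: "length (amb.exp_base x n) = n"
  by (simp add: amb.exp_base_def)

lemma Span_exp_base_simple_extension:
  assumes "g \<in> polys F" "0 < degree g" "poly g x = 0"
  shows "amb.Span F (amb.exp_base x (degree g)) = adjoin F x"
proof (intro equalityI subsetI)
  fix y assume "y \<in> adjoin F x"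
  then obtain f where f: "f \<in> polys F" "y = poly f x" unfolding simple_extension_eq by blast
  obtain q r where "q \<in> polys F" "r \<in> polys F" "f = q * g + r" "degree r < degree g"
    using polys_division[OF assms(1,2) f(1)] by metis
  then show "y \<in> amb.Span F (amb.exp_base x (degree g))"
    unfolding Span_exp_base_iff using assms(3) f(2)
    by (intro bexI[of _ r]) (auto intro: coeff_eq_0)
next
  fix y assume "y \<in> amb.Span F (amb.exp_base x (degree g))"
  then show "y \<in> adjoin F x"
    unfolding Span_exp_base_iff simple_extension_eq by blast
qed

lemma degree_pos_of_root: "f \<noteq> 0 \<Longrightarrow> poly f x = 0 \<Longrightarrow> 0 < degree f"
  by (cases "degree f = 0") (auto elim: degree_eq_zeroE)

lemma simple_extension_dimension_le:
  assumes "g \<in> polys F" "g \<noteq> 0" "poly g x = 0"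
  shows "\<exists>d. d \<le> degree g \<and> amb.dimension d F (adjoin F x)"
proof -
  define P where "P d \<longleftrightarrow> (\<exists>f\<in>polys F. f \<noteq> 0 \<and> poly f x = 0 \<and> degree f = d)" for d
  define d where "d = (LEAST d. P d)"
  have "P (degree g)" using assms by (auto simp: P_def)
  then have d: "P d" "d \<le> degree g" "\<And>e. P e \<Longrightarrow> d \<le> e"
    unfolding d_def by (auto intro: LeastI Least_le)
  then obtain f where f: "f \<in> polys F" "f \<noteq> 0" "poly f x = 0" "degree f = d" by (auto simp: P_def)
  have "amb.independent F (amb.exp_base x d)"
  proof (rule independent_exp_base)
    show "poly h x \<noteq> 0" if "h \<in> polys F" "h \<noteq> 0" "degree h < d" for h
      using d(3)[of "degree h"] that by (auto simp: P_def)
  qed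
  moreover have "amb.Span F (amb.exp_base x d) = adjoin F x"
    unfolding f(4)[symmetric]
    by (rule Span_exp_base_simple_extension[OF f(1) degree_pos_of_root[OF f(2,3)] f(3)])
  ultimately have "amb.dimension d F (adjoin F x)"
    using amb.dimensionI[OF subfield, of "amb.exp_base x d"] by (simp add: length_exp_base)
  with d(2) show ?thesis by blast
qed

text \<open>Connects the list polynomials behind \<open>amb.algebraic\<close> with the type
  \<open>'a poly\<close>. Both sides are compared with finite dimension of the simple extension,
  which avoids translating polynomials.\<close>

lemma algebraic_iff: "amb.algebraic F x \<longleftrightarrow> (\<exists>f\<in>polys F. f \<noteq> 0 \<and> poly f x = 0)"
proof
  assume "amb.algebraic F x"
  then have "amb.finite_dimension F (adjoin F x)"
    using amb.finite_dimension_simple_extension[OF subfield, of x] by (simp add: over_def)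
  then obtain n where n: "amb.dimension n F (adjoin F x)" by blast
  show "\<exists>f\<in>polys F. f \<noteq> 0 \<and> poly f x = 0"
  proof (rule ccontr)
    assume "\<not> ?thesis"
    then have ind: "amb.independent F (amb.exp_base x (Suc n))"
      by (intro independent_exp_base) auto
    have "set (amb.exp_base x (Suc n)) \<subseteq> adjoin F x"
      by (auto simp: amb.exp_base_def simple_extension_eq intro!: exI[of _ "monom 1 _"] simp: poly_monom)
    from amb.independent_length_le_dimension[OF subfield n ind this]
    show False by (simp add: length_exp_base)
  qed
next
  assume "\<exists>f\<in>polys F. f \<noteq> 0 \<and> poly f x = 0"
  then obtain f where f: "f \<in> polys F" "f \<noteq> 0" "poly f x = 0" by blast
  then have "amb.finite_dimension F (adjoin F x)"
    using simple_extension_dimension_le amb.finite_dimensionI by blast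
  then show "amb.algebraic F x"
    using amb.finite_dimension_simple_extension[OF subfield, of x] by (simp add: over_def)
qed

lemma simple_extension_subfield:
  "amb.algebraic F x \<Longrightarrow> subfield (adjoin F x) \<Omega>"
  using amb.simple_extension_is_subfield[OF subfield, of x] by (simp add: over_def)

end

subsection \<open>Characteristic \<open>p\<close>\<close>

lemma prime_CHAR_field: "CHAR('a::field) > 0 \<Longrightarrow> prime CHAR('a)"
  by (rule prime_CHAR_semidom)

lemma frobenius_diff:
  fixes x y :: "'a::field"
  assumes "CHAR('a) > 0"
  shows "(x - y) ^ CHAR('a) = x ^ CHAR('a) - y ^ CHAR('a)"
  using freshmans_dream[OF prime_CHAR_field[OF assms] refl, of "x - y" y] by (simp add: algebra_simps)

lemma frobenius_eq_iff:
  fixes x y :: "'a::field"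
  assumes "CHAR('a) > 0"
  shows "x ^ CHAR('a) = y ^ CHAR('a) \<longleftrightarrow> x = y"
  using frobenius_diff[OF assms, of x y] assms by (metis power_eq_0_iff right_minus_eq)

abbreviation root_poly :: "'a::field \<Rightarrow> 'a poly"
  where "root_poly x \<equiv> monom 1 CHAR('a) - [:x ^ CHAR('a):]"

lemma poly_root_poly: "poly (root_poly x) x = 0"
  by (simp add: poly_monom)

lemma degree_root_poly: "CHAR('a) > 0 \<Longrightarrow> degree (root_poly (x :: 'a::field)) = CHAR('a)"
  unfolding diff_conv_add_uminus by (subst degree_add_eq_left) (simp_all add: degree_monom_eq)

lemma root_poly_nz: "CHAR('a) > 0 \<Longrightarrow> root_poly (x :: 'a::field) \<noteq> 0"
  using degree_root_poly[of x] by auto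

text \<open>This set is F^(1/p) inside the ambient field.\<close>

lemma (in ambient_subfield) subfield_roots:
  assumes "CHAR('a) > 0"
  shows "subfield {x. x ^ CHAR('a) \<in> F} \<Omega>"
  using assms freshmans_dream[OF prime_CHAR_field[OF assms] refl]
    minus_power_prime_CHAR[OF refl prime_CHAR_field[OF assms]]
  by (intro subfield_ambientI) (auto simp: power_mult_distrib power_inverse)

text \<open>Elements of the prime field are fixed by Frobenius, so their value \<gamma> satisfies p
  \<gamma> = \<gamma>.\<close>

lemma (in valued) v_of_nat:
  assumes "0 < i" "i < CHAR('a)"
  shows "of_nat i \<noteq> (0::'a) \<and> v (of_nat i) = 0"
proof -
  have p: "prime CHAR('a)" using assms by (intro prime_CHAR_field) simp
  have nz: "of_nat i \<noteq> (0::'a)"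
    using assms by (auto simp: of_nat_eq_0_iff_char_dvd dest: dvd_imp_le)
  have frob: "of_nat n ^ CHAR('a) = (of_nat n :: 'a)" for n
    using assms by (induction n) (auto simp: freshmans_dream[OF p refl])
  have "nmul CHAR('a) (v (of_nat i)) = v (of_nat i)"
    using v_power[OF nz, of "CHAR('a)"] frob by simp
  moreover have "CHAR('a) = Suc (CHAR('a) - 1)" "0 < CHAR('a) - 1" using prime_gt_1_nat[OF p] by auto
  ultimately have "nmul (CHAR('a) - 1) (v (of_nat i)) = 0"
    by (metis add_cancel_left_left nmul_Suc)
  then show ?thesis using nz \<open>0 < CHAR('a) - 1\<close> by simp
qed

lemma (in valued) v_artin_schreier:
  assumes "n > 1" "v x < 0" "x \<noteq> 0"
  shows "x ^ n - x \<noteq> 0" "v (x ^ n - x) = nmul n (v x)"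
proof -
  have "nmul n (v x) < v x"
    using nmul_neg_iff[of "n - 1" "v x"] nmul_add_left[of "n - 1" 1 "v x"] assms by simp
  then have "vgt (v (x ^ n)) (- x)" using assms by (simp add: vgt_def v_power)
  with v_add_eq[of "x ^ n" "- x"] show "x ^ n - x \<noteq> 0" "v (x ^ n - x) = nmul n (v x)"
    using assms by (simp_all add: v_power)
qed

section \<open>Simple extensions of degree p\<close>

context kaplansky
begin

text \<open>Nonzero polynomials of degree less than p are stable and hence do not vanish at
  \<open>b\<close>, so the powers of \<open>b\<close> below p are independent.\<close>

lemma dimension_simple_extension:
  assumes "poly g b = 0"
  shows "amb.dimension p F (adjoin F b)"
proof -
  have "amb.independent F (amb.exp_base b p)"
    using stable_of_degree_less by (intro independent_exp_base) (auto simp: stable_def)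
  moreover have "0 < degree g" using degree_g prime_gt_0_nat[OF prime_p] by simp
  from Span_exp_base_simple_extension[OF g_polys this assms]
  have "amb.Span F (amb.exp_base b p) = adjoin F b"
    by (simp add: degree_g)
  ultimately show ?thesis
    using amb.dimensionI[OF subfield, of "amb.exp_base b p"] by (simp add: length_exp_base)
qed

text \<open>Reduction modulo \<open>g\<close> writes x as f(b) with \<open>f\<close> of degree less
  than p, where the transfer of distances applies; \<open>f\<close> is not constant because x lies
  outside \<open>F\<close>.\<close>

lemma simple_extension_distance:
  assumes "poly g b = 0" "p = CHAR('a)" "x \<in> adjoin F b" "x \<notin> F"
  obtains \<beta> where "\<beta> \<in> value_group v F"
    "\<And>c. c \<in> F \<Longrightarrow> \<exists>c'\<in>F. \<beta> + v (b - c) \<le> v (x - c')"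
    "\<And>c'. c' \<in> F \<Longrightarrow> \<exists>c\<in>F. v (x - c') \<le> \<beta> + v (b - c)"
proof -
  have dg: "0 < degree g" using degree_g prime_gt_0_nat[OF prime_p] by simp
  obtain h where h: "h \<in> polys F" "x = poly h b"
    using assms(3) unfolding simple_extension_eq by blast
  obtain q f where f: "q \<in> polys F" "f \<in> polys F" "h = q * g + f" "degree f < degree g"
    using polys_division[OF g_polys dg h(1)] by metis
  have x: "x = poly f b" using h f assms(1) by simp
  have "0 < degree f"
  proof (rule ccontr)
    assume "\<not> 0 < degree f"
    then obtain a where "f = [:a:]" by (meson degree_eq_zeroE neq0_conv)
    then show False using x assms(4) polysD[OF f(2), of 0] by simp
  qed
  moreover have "degree f < p" using f(4) degree_g by simp
  moreover have "of_nat i \<noteq> (0::'a) \<and> v (of_nat i) = 0" if "0 < i" "i < p" for i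
    using v_of_nat that assms(2) by blast
  ultimately show ?thesis
    using distance_transfer[OF f(2)] that unfolding x by metis
qed

end

context approximation
begin

text \<open>The polynomial takes the value -(b - c)^p at c, because \<open>b\<close> is its only
  root.\<close>

lemma kaplansky_root:
  assumes "CHAR('a) > 0" "b ^ CHAR('a) \<in> F"
  shows "kaplansky v F b CHAR('a) (root_poly b)"
proof
  let ?p = "CHAR('a)" and ?g = "root_poly b"
  show "prime ?p" using assms(1) by (rule prime_CHAR_field)
  show "?g \<in> polys F" using assms by auto
  show "degree ?g = ?p" by (rule degree_root_poly[OF assms(1)])
  have eq: "poly ?g c = - ((b - c) ^ ?p)" for c
    using frobenius_diff[OF assms(1), of b c] by (simp add: poly_monom)
  show "eventually (\<lambda>c. poly ?g c \<noteq> 0 \<and> v (poly ?g c) = nmul ?p (v (b - c))) near"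
    using near_mem unfolding eq by eventually_elim (auto simp: v_power)
qed

text \<open>At c the polynomial equals -((b - c)^p - (b - c)), where the p-th power dominates as v(b
  - c) is negative.\<close>

lemma kaplansky_artin_schreier:
  assumes "CHAR('a) > 0" "b ^ CHAR('a) - b \<in> F" "\<And>c. c \<in> F \<Longrightarrow> v (b - c) < 0"
  shows "kaplansky v F b CHAR('a) (monom 1 CHAR('a) - [:b ^ CHAR('a) - b, 1:])"
proof
  let ?p = "CHAR('a)" and ?g = "monom 1 CHAR('a) - [:b ^ CHAR('a) - b, 1:]"
  show p: "prime ?p" using assms by (intro prime_CHAR_field)
  show "?g \<in> polys F" using assms by auto
  show "degree ?g = ?p"
    unfolding diff_conv_add_uminus[of "monom 1 ?p"] using prime_gt_1_nat[OF p]
    by (subst degree_add_eq_left) (simp_all add: degree_monom_eq)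
  have eq: "poly ?g c = - ((b - c) ^ ?p - (b - c))" for c
    unfolding frobenius_diff[OF assms(1)] by (simp add: poly_monom)
  show "eventually (\<lambda>c. poly ?g c \<noteq> 0 \<and> v (poly ?g c) = nmul ?p (v (b - c))) near"
    using near_mem
  proof eventually_elim
    case (elim c)
    then show ?case
      unfolding eq v_uminus using v_artin_schreier[OF prime_gt_1_nat[OF p] assms(3)[OF elim]] by simp
  qed
qed

end

subsection \<open>Distances\<close>

context approximation
begin

lemma approximant_same_value:
  assumes "c \<in> F" "c' \<in> F" "v (b - c) < v (b - c')"
  shows "c' \<noteq> c" "v (c' - c) = v (b - c)"
proof -
  have "vgt (v (b - c)) ((c' - c) - (b - c))"
    using assms by (simp add: vgt_def v_minus_commute[of c' b])
  then show "c' \<noteq> c" "v (c' - c) = v (b - c)"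
    using v_eqI[of "b - c" "c' - c"] assms(1) by auto
qed

text \<open>A better approximation c' satisfies v(c' - c) = v(b - c), and c' - c lies in
  \<open>F\<close>.\<close>

lemma v_diff_mem: "c \<in> F \<Longrightarrow> v (b - c) \<in> value_group v F"
  using no_max[of c] approximant_same_value[of c] by (metis diff_mem right_minus_eq value_groupI)

lemma v_mem: "v b \<in> value_group v F"
  using v_diff_mem[of 0] by simp

lemma dist_cut_eq:
  "dist_cut v F b = {\<gamma>\<in>divisible_hull (value_group v F). \<exists>c\<in>F. \<gamma> \<le> v (b - c)}"
proof -
  have "{v (b - c) | c. c \<in> F \<and> c \<noteq> b} = {v (b - c) | c. c \<in> F}"
    using b_notin by blast
  moreover have "{v (b - c) | c. c \<in> F} \<inter> divisible_hull (value_group v F) = {v (b - c) | c. c \<in> F}"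
    using divisible_hull_incl[OF v_diff_mem] by auto
  ultimately show ?thesis unfolding dist_cut_def by auto
qed

end

section \<open>Comparison of distances over one field\<close>

context valued_subfield
begin

text \<open>The last two assumptions say that v(x - F) and \<beta> + v(b - F) are cofinal in each
  other, the form in which \<open>distance_transfer\<close> delivers its result. Absence of a
  maximum passes between such sets.\<close>

lemma approximation_transfer:
  assumes "approximation v F b" "x \<notin> F"
    and 1: "\<And>c. c \<in> F \<Longrightarrow> \<exists>c'\<in>F. \<beta> + v (b - c) \<le> v (x - c')"
    and 2: "\<And>c'. c' \<in> F \<Longrightarrow> \<exists>c\<in>F. v (x - c') \<le> \<beta> + v (b - c)"
  shows "approximation v F x"
proof
  interpret b: approximation v F b by fact
  show "x \<notin> F" by fact
  fix c assume "c \<in> F"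
  then obtain c1 where c1: "c1 \<in> F" "v (x - c) \<le> \<beta> + v (b - c1)" using 2 by blast
  obtain c2 where c2: "c2 \<in> F" "v (b - c1) < v (b - c2)" using b.no_max[OF c1(1)] by blast
  obtain c3 where c3: "c3 \<in> F" "\<beta> + v (b - c2) \<le> v (x - c3)" using 1 c2 by blast
  have "v (x - c) < v (x - c3)" using c1 c2 c3
    by (meson add_less_cancel_left order.strict_trans1 order.strict_trans2)
  with c3(1) show "\<exists>c'\<in>F. v (x - c) < v (x - c')" by blast
qed

lemma dist_cut_shift:
  assumes "approximation v F b" "x \<notin> F" "\<beta> \<in> value_group v F"
    and 1: "\<And>c. c \<in> F \<Longrightarrow> \<exists>c'\<in>F. \<beta> + v (b - c) \<le> v (x - c')"
    and 2: "\<And>c'. c' \<in> F \<Longrightarrow> \<exists>c\<in>F. v (x - c') \<le> \<beta> + v (b - c)"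
  shows "(dist_cut v F b, dist_cut v F x) \<in> equal_modulo (value_group v F)"
proof -
  interpret b: approximation v F b by fact
  interpret x: approximation v F x using approximation_transfer[OF assms(1,2) 1 2] by blast
  interpret V: ordered_subgroup "divisible_hull (value_group v F)"
    by (rule value_group.divisible_hull_subgroup)
  have \<beta>: "\<beta> \<in> divisible_hull (value_group v F)" using assms(3) by (rule divisible_hull_incl)
  have "dist_cut v F x = (+) \<beta> ` dist_cut v F b"
  proof (intro equalityI subsetI)
    fix \<gamma> assume "\<gamma> \<in> dist_cut v F x"
    then obtain c' where g: "\<gamma> \<in> divisible_hull (value_group v F)" "c' \<in> F" "\<gamma> \<le> v (x - c')"
      unfolding x.dist_cut_eq by blast
    obtain c where c: "c \<in> F" "v (x - c') \<le> \<beta> + v (b - c)" using 2 g by blast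
    have "\<gamma> \<le> \<beta> + v (b - c)" using g(3) c(2) by (rule order_trans)
    then have "\<gamma> - \<beta> \<in> dist_cut v F b"
      unfolding b.dist_cut_eq using g \<beta> c by (auto simp: diff_le_eq add.commute intro!: bexI[of _ c])
    then show "\<gamma> \<in> (+) \<beta> ` dist_cut v F b" by (rule rev_image_eqI) simp
  next
    fix \<gamma> assume "\<gamma> \<in> (+) \<beta> ` dist_cut v F b"
    then obtain \<delta> c where d: "\<gamma> = \<beta> + \<delta>" "\<delta> \<in> divisible_hull (value_group v F)" "c \<in> F" "\<delta> \<le> v (b - c)"
      unfolding b.dist_cut_eq by blast
    obtain c' where c: "c' \<in> F" "\<beta> + v (b - c) \<le> v (x - c')" using 1 d by blast
    have "\<gamma> \<le> v (x - c')" using d(1,4) c(2) by (meson add_left_mono order_trans)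
    then show "\<gamma> \<in> dist_cut v F x"
      unfolding x.dist_cut_eq using d \<beta> c(1) by auto
  qed
  then show ?thesis using assms(3) by (auto simp: equal_modulo_def)
qed

lemma closer_element_same_values:
  assumes "\<And>c. c \<in> F \<Longrightarrow> x \<noteq> c" "\<And>c. c \<in> F \<Longrightarrow> v (x - c) < v (x - y)"
  shows "y \<notin> F" "c \<in> F \<Longrightarrow> v (y - c) = v (x - c)"
proof -
  show "y \<notin> F" using assms(2) by blast
  show "v (y - c) = v (x - c)" if c: "c \<in> F"
  proof -
    have "vgt (v (x - c)) ((y - c) - (x - c))"
      using assms(2)[OF c] by (simp add: vgt_def v_minus_commute[of y x])
    then show ?thesis using v_eqI[of "x - c" "y - c"] assms(1)[OF c] by auto
  qed
qed

text \<open>Since y is closer to x than every element of \<open>F\<close>, the ultrametric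
  inequality gives v(y - c) = v(x - c) for all c in \<open>F\<close>.\<close>

lemma closer_element_dist_cut:
  assumes "approximation v F x" "\<And>c. c \<in> F \<Longrightarrow> v (x - c) < v (x - y)"
  shows "approximation v F y" "dist_cut v F y = dist_cut v F x"
proof -
  interpret x: approximation v F x by fact
  have x: "x \<noteq> c" if "c \<in> F" for c using that by simp
  note * = closer_element_same_values[OF x assms(2)]
  show "approximation v F y"
  proof
    show "\<exists>c'\<in>F. v (y - c) < v (y - c')" if "c \<in> F" for c
      using x.no_max[OF that] *(2) that by metis
  qed (rule *(1))
  then interpret y: approximation v F y .
  show "dist_cut v F y = dist_cut v F x"
    unfolding x.dist_cut_eq y.dist_cut_eq using *(2) by auto
qed

section \<open>Towers of extensions by p-th roots\<close>

lemma value_group_immediate: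
  assumes "F \<subseteq> E" "\<And>x. x \<in> E - F \<Longrightarrow> approximation v F x"
  shows "value_group v E = value_group v F"
proof
  show "value_group v E \<subseteq> value_group v F"
    using approximation.v_mem[OF assms(2)] by (auto simp: value_group_def)
qed (rule value_group_mono[OF assms(1)])

text \<open>The new distance of \<eta> keeps \<open>F\<close> as good as \<open>E\<close> for
  approximating \<eta>. Hence \<eta> has no best approximation in \<open>E\<close>, and Kaplansky's
  lemma applies over \<open>E\<close>. It gives both the degree p and the distances of the new
  elements.\<close>

lemma root_extension_step:
  assumes "CHAR('a) > 0" "subfield E \<Omega>" "F \<subseteq> E"
    and E: "\<And>x. x \<in> E - F \<Longrightarrow> approximation v F x"
    and \<eta>: "approximation v F \<eta>" "\<eta> ^ CHAR('a) \<in> F"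
    and new: "\<And>y. y \<in> E - F \<Longrightarrow> dist_cut v F y \<noteq> dist_cut v F \<eta>"
  shows "amb.dimension CHAR('a) E (adjoin E \<eta>)"
    and "x \<in> adjoin E \<eta> - F \<Longrightarrow> approximation v F x \<and>
       ((dist_cut v F \<eta>, dist_cut v F x) \<in> equal_modulo (value_group v F) \<or>
        (\<exists>y\<in>E - F. dist_cut v F x = dist_cut v F y))"
proof -
  interpret \<eta>: approximation v F \<eta> by fact
  interpret E: valued_subfield v E by (rule valued_subfieldI[OF assms(2)])
  \<comment> \<open>An element of \<open>E\<close> closer to \<eta> than all of \<open>F\<close>
    would have the distance of \<eta>, which \<open>new\<close> excludes.\<close>
  have cof: "\<exists>c\<in>F. v (\<eta> - y) \<le> v (\<eta> - c)" if y: "y \<in> E" for y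
  proof (rule ccontr)
    assume "\<not> ?thesis"
    then have lt: "v (\<eta> - c) < v (\<eta> - y)" if "c \<in> F" for c using that by (auto simp: not_le)
    then have "y \<notin> F" by blast
    moreover have "dist_cut v F y = dist_cut v F \<eta>" by (rule closer_element_dist_cut(2)[OF \<eta>(1) lt])
    ultimately show False using new y by blast
  qed
  have E_approx: "approximation v E \<eta>"
  proof
    show "\<eta> \<notin> E" using new \<eta>.b_notin by blast
    fix y assume "y \<in> E"
    then obtain c where "c \<in> F" "v (\<eta> - y) \<le> v (\<eta> - c)" using cof by blast
    with \<eta>.no_max show "\<exists>c'\<in>E. v (\<eta> - y) < v (\<eta> - c')" using assms(3) by (meson order.strict_trans1 subsetD)
  qed
  then interpret K: kaplansky v E \<eta> "CHAR('a)" "root_poly \<eta>"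
    using approximation.kaplansky_root[OF E_approx assms(1)] \<eta>(2) assms(3) by blast
  note root = poly_root_poly[of \<eta>]
  show "amb.dimension CHAR('a) E (adjoin E \<eta>)"
    by (rule K.dimension_simple_extension[OF root])
  assume x: "x \<in> adjoin E \<eta> - F"
  show "approximation v F x \<and>
       ((dist_cut v F \<eta>, dist_cut v F x) \<in> equal_modulo (value_group v F) \<or>
        (\<exists>y\<in>E - F. dist_cut v F x = dist_cut v F y))"
  proof (cases "x \<in> E")
    case True
    then show ?thesis using E x by blast
  next
    case False
    obtain \<beta> where \<beta>: "\<beta> \<in> value_group v E"
      "\<And>c. c \<in> E \<Longrightarrow> \<exists>c'\<in>E. \<beta> + v (\<eta> - c) \<le> v (x - c')"
      "\<And>c'. c' \<in> E \<Longrightarrow> \<exists>c\<in>E. v (x - c') \<le> \<beta> + v (\<eta> - c)"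
      using K.simple_extension_distance[OF root refl, of x] x False by blast
    have \<beta>F: "\<beta> \<in> value_group v F" using \<beta>(1) value_group_immediate[OF assms(3) E] by simp
    \<comment> \<open>So far x is compared with \<eta> only over \<open>E\<close>. If
      \<open>F\<close> approximates x as well as \<open>E\<close> does, the comparison descends to
      \<open>F\<close>; otherwise some y in \<open>E\<close> is closer to x than all of
      \<open>F\<close> and has the distance of x.\<close>
    show ?thesis
    proof (cases "\<forall>y\<in>E. \<exists>c\<in>F. v (x - y) \<le> v (x - c)")
      case True
      have 1: "\<exists>c'\<in>F. \<beta> + v (\<eta> - c) \<le> v (x - c')" if "c \<in> F" for c
        using \<beta>(2)[of c] True that assms(3) by (meson order_trans subsetD)
      have 2: "\<exists>c\<in>F. v (x - c') \<le> \<beta> + v (\<eta> - c)" if "c' \<in> F" for c'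
        using \<beta>(3)[of c'] cof that assms(3) by (meson add_left_mono order_trans subsetD)
      show ?thesis
        using approximation_transfer[OF \<eta>(1) _ 1 2] dist_cut_shift[OF \<eta>(1) _ \<beta>F 1 2] x by blast
    next
      case False
      then obtain y where y: "y \<in> E" "\<And>c. c \<in> F \<Longrightarrow> v (x - c) < v (x - y)" by (auto simp: not_le)
      have xF: "x \<noteq> c" if "c \<in> F" for c using x that by blast
      have yF: "y \<notin> F" "v (y - c) = v (x - c)" if "c \<in> F" for c
        using closer_element_same_values[OF xF y(2)] that by auto
      then have ya: "approximation v F y" using E y(1) by blast
      have lt: "v (y - c) < v (y - x)" if "c \<in> F" for c
        using yF(2)[OF that] y(2)[OF that] by (simp add: v_minus_commute[of y x])
      show ?thesis using closer_element_dist_cut[OF ya lt] y(1) yF(1) zero_mem by blast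
    qed
  qed
qed

text \<open>The clause on distances is the invariant of the induction. Every distance found so far
  is equivalent to that of a root already adjoined, so the next root, being inequivalent to all of
  them, brings a new distance and a factor p in the degree.\<close>

lemma root_extension_tower:
  assumes p: "CHAR('a) > 0" and "finite H"
    and "\<And>\<eta>. \<eta> \<in> H \<Longrightarrow> approximation v F \<eta> \<and> \<eta> ^ CHAR('a) \<in> F"
    and "\<And>\<eta> \<theta>. \<eta> \<in> H \<Longrightarrow> \<theta> \<in> H \<Longrightarrow>
      (dist_cut v F \<eta>, dist_cut v F \<theta>) \<in> equal_modulo (value_group v F) \<Longrightarrow> \<eta> = \<theta>"
  shows "\<exists>E. subfield E \<Omega> \<and> F \<subseteq> E \<and> E \<subseteq> {x. x ^ CHAR('a) \<in> F} \<and>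
    amb.dimension (CHAR('a) ^ card H) F E \<and>
    (\<forall>x\<in>E - F. approximation v F x \<and>
      (\<exists>\<eta>\<in>H. (dist_cut v F \<eta>, dist_cut v F x) \<in> equal_modulo (value_group v F)))"
  using assms(2-)
proof (induction H rule: finite_induct)
  case empty
  have "amb.dimension 1 F F" using amb.dimension_one[OF subfield] .
  then show ?case using subfield by (intro exI[of _ F]) auto
next
  case (insert \<eta> H)
  let ?R = "equal_modulo (value_group v F)"
  have eq: "equiv UNIV ?R" by (rule value_group.equiv_equal_modulo)
  obtain E where E: "subfield E \<Omega>" "F \<subseteq> E" "E \<subseteq> {x. x ^ CHAR('a) \<in> F}"
    "amb.dimension (CHAR('a) ^ card H) F E"
    and dist: "\<And>x. x \<in> E - F \<Longrightarrow> approximation v F x \<and> (\<exists>\<eta>\<in>H. (dist_cut v F \<eta>, dist_cut v F x) \<in> ?R)"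
    using insert.IH insert.prems by (metis (no_types, lifting) insertI2)
  have \<eta>: "approximation v F \<eta>" "\<eta> ^ CHAR('a) \<in> F" using insert.prems(1) by auto
  have new: "dist_cut v F y \<noteq> dist_cut v F \<eta>" if y: "y \<in> E - F" for y
  proof
    assume "dist_cut v F y = dist_cut v F \<eta>"
    then obtain \<theta> where "\<theta> \<in> H" "(dist_cut v F \<theta>, dist_cut v F \<eta>) \<in> ?R"
      using dist[OF y] by auto
    with insert.prems(2)[of \<theta> \<eta>] insert.hyps(2) show False by blast
  qed
  have approxE: "approximation v F x" if "x \<in> E - F" for x using dist[OF that] by blast
  let ?E = "adjoin E \<eta>"
  have dimE: "amb.dimension CHAR('a) E ?E"
    by (rule root_extension_step(1)[OF p E(1,2) approxE \<eta> new])
  have distE: "approximation v F x \<and> ((dist_cut v F \<eta>, dist_cut v F x) \<in> ?R \<or>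
      (\<exists>y\<in>E - F. dist_cut v F x = dist_cut v F y))" if "x \<in> ?E - F" for x
    by (rule root_extension_step(2)[OF p E(1,2) approxE \<eta> new that])
  interpret E: ambient_subfield E by (rule ambient_subfield.intro) (rule E(1))
  have "root_poly \<eta> \<in> polys E" using \<eta>(2) E(2) by auto
  then have "amb.algebraic E \<eta>"
    unfolding E.algebraic_iff using root_poly_nz[OF p] poly_root_poly by blast
  then have "subfield ?E \<Omega>" by (rule E.simple_extension_subfield)
  moreover have "F \<subseteq> ?E" using E(2) E.subset_simple_extension by blast
  moreover have "?E \<subseteq> {x. x ^ CHAR('a) \<in> F}"
    using E(3) \<eta>(2) by (intro amb.simple_extension_subring_incl subfieldE(1)[OF subfield_roots[OF p]]) auto
  moreover have "amb.dimension (CHAR('a) ^ card (insert \<eta> H)) F ?E"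
    using amb.telescopic_base[OF subfield E(1,4) dimE] insert.hyps by (simp add: mult.commute)
  moreover have "approximation v F x \<and> (\<exists>\<eta>\<in>insert \<eta> H. (dist_cut v F \<eta>, dist_cut v F x) \<in> ?R)"
    if "x \<in> ?E - F" for x
    using distE[OF that] dist by (metis insert_iff)
  ultimately show ?case by blast
qed

end

subsection \<open>Dependent and independent cuts\<close>

text \<open>
  A cut closed under division by \<open>p\<close> in this sense is the set of elements below a convex subgroup.
\<close>

definition division_closed_cut :: "nat \<Rightarrow> 'g::linordered_ab_group_add set \<Rightarrow> 'g set \<Rightarrow> bool"
  where "division_closed_cut p V C \<longleftrightarrow> C \<subseteq> V \<and> C \<noteq> {} \<and> (\<forall>\<gamma>\<in>C. \<gamma> < 0) \<and>
    (\<forall>\<gamma>\<in>C. \<forall>\<delta>\<in>V. \<delta> \<le> \<gamma> \<longrightarrow> \<delta> \<in> C) \<and> (\<forall>\<gamma>\<in>V. nmul p \<gamma> \<in> C \<longrightarrow> \<gamma> \<in> C)"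

lemma (in valued_subfield) artin_schreier_dichotomy:
  assumes p: "CHAR('a) > 0" and roots: "\<And>a::'a. \<exists>x. x ^ CHAR('a) = a"
    and \<theta>: "approximation v F \<theta>" "\<theta> ^ CHAR('a) - \<theta> \<in> F" "\<And>c. c \<in> F \<Longrightarrow> v (\<theta> - c) < 0"
  shows "(\<exists>\<eta>. \<eta> ^ CHAR('a) \<in> F \<and> approximation v F \<eta> \<and> dist_cut v F \<eta> = dist_cut v F \<theta>) \<or>
    division_closed_cut CHAR('a) (divisible_hull (value_group v F)) (dist_cut v F \<theta>)"
proof (cases "\<exists>c\<in>F. \<forall>c'\<in>F. nmul CHAR('a) (v (\<theta> - c')) < v (\<theta> - c)")
  case True
  then obtain c where c: "c \<in> F" "\<And>c'. c' \<in> F \<Longrightarrow> nmul CHAR('a) (v (\<theta> - c')) < v (\<theta> - c)" by blast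
  interpret \<theta>: approximation v F \<theta> by fact
  obtain \<eta> where \<eta>: "\<eta> ^ CHAR('a) = \<theta> ^ CHAR('a) - \<theta> + c" using roots by blast
  then have eq: "(\<theta> - \<eta>) ^ CHAR('a) = \<theta> - c" unfolding frobenius_diff[OF p] by simp
  then have "\<theta> - \<eta> \<noteq> 0" using \<theta>.neq_mem(1)[OF c(1)] p by (metis power_eq_0_iff right_minus_eq)
  then have "nmul CHAR('a) (v (\<theta> - \<eta>)) = v (\<theta> - c)" using v_power eq by metis
  then have lt: "v (\<theta> - c') < v (\<theta> - \<eta>)" if "c' \<in> F" for c'
    using c(2)[OF that] nmul_less_iff[OF p] by metis
  have "\<eta> ^ CHAR('a) \<in> F" using \<eta> \<theta>(2) c(1) by simp
  with closer_element_dist_cut[OF \<theta>(1) lt] show ?thesis by blast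
next
  case False
  interpret \<theta>: approximation v F \<theta> by fact
  let ?V = "divisible_hull (value_group v F)"
  have "v (\<theta> - 0) \<in> dist_cut v F \<theta>"
    unfolding \<theta>.dist_cut_eq using divisible_hull_incl[OF \<theta>.v_diff_mem] zero_mem by blast
  moreover have "\<gamma> < 0" if "\<gamma> \<in> dist_cut v F \<theta>" for \<gamma>
    using that \<theta>(3) unfolding \<theta>.dist_cut_eq by (auto intro: le_less_trans)
  moreover have "\<delta> \<in> dist_cut v F \<theta>" if "\<gamma> \<in> dist_cut v F \<theta>" "\<delta> \<in> ?V" "\<delta> \<le> \<gamma>" for \<gamma> \<delta>
    using that unfolding \<theta>.dist_cut_eq by (auto intro: order_trans)
  \<comment> \<open>In this case each v(\<theta> - c) is at most p v(\<theta> - c') for a suitable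
    c'. Hence p \<gamma> \<le> v(\<theta> - c) implies \<gamma> \<le> v(\<theta> - c').\<close>
  moreover have "\<gamma> \<in> dist_cut v F \<theta>" if \<gamma>: "\<gamma> \<in> ?V" "nmul CHAR('a) \<gamma> \<in> dist_cut v F \<theta>" for \<gamma>
  proof -
    obtain c where "c \<in> F" "nmul CHAR('a) \<gamma> \<le> v (\<theta> - c)" using \<gamma>(2) unfolding \<theta>.dist_cut_eq by blast
    moreover from False \<open>c \<in> F\<close> obtain c' where "c' \<in> F" "v (\<theta> - c) \<le> nmul CHAR('a) (v (\<theta> - c'))"
      by (meson not_le)
    ultimately have "nmul CHAR('a) \<gamma> \<le> nmul CHAR('a) (v (\<theta> - c'))" by (blast intro: order_trans)
    then show ?thesis unfolding \<theta>.dist_cut_eq using \<gamma>(1) \<open>c' \<in> F\<close> nmul_le_iff[OF p] by blast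
  qed
  moreover have "dist_cut v F \<theta> \<subseteq> ?V" unfolding \<theta>.dist_cut_eq by blast
  ultimately show ?thesis unfolding division_closed_cut_def by blast
qed

text \<open>Positive elements from pairwise distinct Archimedean classes. The size of such sets
  measures the rank of an ordered group without mentioning convex subgroups.\<close>

definition arch_chain :: "'g::linordered_ab_group_add set \<Rightarrow> bool"
  where "arch_chain S \<longleftrightarrow> (\<forall>x\<in>S. 0 < x) \<and> (\<forall>x\<in>S. \<forall>y\<in>S. x < y \<longrightarrow> (\<forall>k. nmul k x < y))"

text \<open>Downward closed sets form a chain under inclusion. From each cut C an element x(C) is
  taken outside all smaller cuts of the family. If D is properly contained in C, then no multiple of
  x(C) by a power of p lies in D, as division by p would bring x(C) itself into D. So -x(C) is
  infinitely smaller than -x(D).\<close>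

lemma division_closed_cuts_arch_chain:
  fixes V :: "'g::linordered_ab_group_add set"
  assumes V: "ordered_subgroup V" and p: "p > 1" and fin: "finite \<C>"
    and cuts: "\<And>C. C \<in> \<C> \<Longrightarrow> division_closed_cut p V C"
  shows "\<exists>S. finite S \<and> S \<subseteq> V \<and> arch_chain S \<and> card S = card \<C>"
proof -
  interpret V: ordered_subgroup V by fact
  note cutD = cuts[unfolded division_closed_cut_def]
  have sub: "C \<subseteq> V" if "C \<in> \<C>" for C by (rule cutD[OF that, THEN conjunct1])
  have ne: "C \<noteq> {}" if "C \<in> \<C>" for C
    by (rule cutD[OF that, THEN conjunct2, THEN conjunct1])
  have neg: "\<gamma> < 0" if "C \<in> \<C>" "\<gamma> \<in> C" for C \<gamma> using cutD[OF that(1)] that(2) by metis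
  have down: "\<delta> \<in> C" if "C \<in> \<C>" "\<gamma> \<in> C" "\<delta> \<in> V" "\<delta> \<le> \<gamma>" for C \<gamma> \<delta>
    using cutD[OF that(1)] that(2-) by metis
  have root: "\<gamma> \<in> C" if "C \<in> \<C>" "\<gamma> \<in> V" "nmul p \<gamma> \<in> C" for C \<gamma>
    using cutD[OF that(1)] that(2-) by metis
  have chain: "C \<subseteq> D \<or> D \<subseteq> C" if "C \<in> \<C>" "D \<in> \<C>" for C D
  proof (rule ccontr)
    assume "\<not> ?thesis"
    then obtain x y where "x \<in> C" "x \<notin> D" "y \<in> D" "y \<notin> C" by blast
    then show False
      using down[OF that(1), of x y] down[OF that(2), of y x] sub[OF that(1)] sub[OF that(2)]
      by (meson linear subsetD)
  qed
  have "\<exists>x\<in>C. \<forall>D\<in>\<C>. \<not> C \<subseteq> D \<longrightarrow> x \<notin> D" if C: "C \<in> \<C>" for C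
  proof -
    define \<D> where "\<D> = {D\<in>\<C>. \<not> C \<subseteq> D}"
    have "\<forall>D\<in>\<D>. \<exists>x. x \<in> C - D" unfolding \<D>_def by blast
    then obtain f where f: "\<And>D. D \<in> \<D> \<Longrightarrow> f D \<in> C - D" by metis
    obtain x0 where x0: "x0 \<in> C" using ne[OF C] by blast
    have fin': "finite (insert x0 (f ` \<D>))" using fin by (simp add: \<D>_def)
    \<comment> \<open>Each smaller cut misses some element of C, and being downward closed it also
      misses the largest of these finitely many elements.\<close>
    define x where "x = Max (insert x0 (f ` \<D>))"
    have "x \<in> insert x0 (f ` \<D>)" unfolding x_def using fin' by (intro Max_in) auto
    then have xC: "x \<in> C" using x0 f by blast
    have "x \<notin> D" if D: "D \<in> \<C>" "\<not> C \<subseteq> D" for D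
    proof
      assume "x \<in> D"
      moreover have "D \<in> \<D>" using D by (simp add: \<D>_def)
      then have "f D \<le> x" "f D \<in> C - D" unfolding x_def using fin' f by (auto intro: Max_ge)
      ultimately show False using down[OF D(1), of x "f D"] sub[OF C] by blast
    qed
    with xC show ?thesis by blast
  qed
  then obtain x where x: "\<And>C. C \<in> \<C> \<Longrightarrow> x C \<in> C" "\<And>C D. C \<in> \<C> \<Longrightarrow> D \<in> \<C> \<Longrightarrow> \<not> C \<subseteq> D \<Longrightarrow> x C \<notin> D"
    by metis
  define S where "S = (\<lambda>C. - x C) ` \<C>"
  have "inj_on (\<lambda>C. - x C) \<C>"
  proof (rule inj_onI)
    fix C D assume "C \<in> \<C>" "D \<in> \<C>" "- x C = - x D"
    then show "C = D" using x(1)[of C] x(1)[of D] x(2)[of C D] x(2)[of D C] by auto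
  qed
  then have "card S = card \<C>" unfolding S_def by (rule card_image)
  moreover have "S \<subseteq> V" unfolding S_def using x(1) sub by blast
  moreover have "arch_chain S"
    unfolding arch_chain_def
  proof (intro conjI ballI impI allI)
    show "0 < y" if "y \<in> S" for y using that neg x(1) unfolding S_def by auto
    fix y z k assume "y \<in> S" "z \<in> S" "y < z"
    then obtain C D where CD: "C \<in> \<C>" "D \<in> \<C>" "y = - x C" "z = - x D" "x D < x C"
      unfolding S_def by auto
    have xV: "x C \<in> V" "x D \<in> V" using CD x(1) sub by blast+
    have "x D \<in> C" using down[OF CD(1) x(1)[OF CD(1)] xV(2)] CD(5) by simp
    then have "D \<subseteq> C" using x(2)[of D C] CD by blast
    moreover have "C \<noteq> D" using CD(5) by auto
    ultimately have notin: "x C \<notin> D" using x(2)[of C D] CD by blast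
    have pow: "x C \<in> D" if "nmul (p ^ e) (x C) \<in> D" for e
      using that
    proof (induction e)
      case (Suc e)
      then have "nmul p (nmul (p ^ e) (x C)) \<in> D" by (simp add: nmul_nmul)
      with root[OF CD(2)] xV(1) Suc.IH show ?case by blast
    qed simp
    show "nmul k y < z"
    proof (rule ccontr)
      assume "\<not> ?thesis"
      then have le: "nmul k (x C) \<le> x D" using CD by simp
      \<comment> \<open>An arbitrary multiple is replaced by one with a power of p, where the
        closure of D under division by p can be iterated.\<close>
      have "k \<le> p ^ k" using p by (simp add: less_imp_le)
      then have "nmul k (- x C) \<le> nmul (p ^ k) (- x C)"
        using neg[OF CD(1) x(1)[OF CD(1)]] by (intro nmul_mono_left) auto
      then have "nmul (p ^ k) (x C) \<le> x D" using le by simp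
      then have "nmul (p ^ k) (x C) \<in> D" using down[OF CD(2) x(1)[OF CD(2)]] xV(1) by blast
      then show False using pow notin by blast
    qed
  qed
  moreover have "finite S" using fin by (simp add: S_def)
  ultimately show ?thesis by blast
qed

subsection \<open>Archimedean classes and the transcendence degree\<close>

definition rank_le :: "'g::linordered_ab_group_add set \<Rightarrow> nat \<Rightarrow> bool"
  where "rank_le V n \<longleftrightarrow> (\<forall>S. finite S \<longrightarrow> S \<subseteq> V \<longrightarrow> arch_chain S \<longrightarrow> card S \<le> n)"

lemma rank_le_mono: "V \<subseteq> W \<Longrightarrow> rank_le W n \<Longrightarrow> rank_le V n"
  unfolding rank_le_def by blast

lemma arch_chain_subset: "arch_chain S \<Longrightarrow> T \<subseteq> S \<Longrightarrow> arch_chain T"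
  unfolding arch_chain_def by blast

text \<open>Each element of \<open>S\<close> is replaced by one of \<open>V\<close> in its
  Archimedean class. Bounded multiples do not affect being infinitely smaller, so the image is again
  a chain and the replacement is injective.\<close>

lemma rank_le_comparable:
  assumes rank: "rank_le V n" and S: "finite S" "arch_chain S"
    and "\<And>x. x \<in> S \<Longrightarrow> \<exists>y\<in>V. \<exists>A B. 0 < A \<and> x \<le> nmul A y \<and> y \<le> nmul B x"
  shows "card S \<le> n"
proof -
  obtain y A B where y: "y x \<in> V" "0 < A x" "x \<le> nmul (A x) (y x)" "y x \<le> nmul (B x) x"
    if "x \<in> S" for x
    using assms(4) by metis
  have lt: "nmul k (y x) < y x'" if "x \<in> S" "x' \<in> S" "x < x'" for k x x'
  proof -
    have "nmul (A x' * k) (y x) \<le> nmul (A x' * k) (nmul (B x) x)"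
      using y(4)[OF that(1)] by (rule nmul_mono)
    also have "\<dots> = nmul (A x' * k * B x) x" by (simp add: nmul_nmul)
    also have "\<dots> < x'" using S(2) that by (auto simp: arch_chain_def)
    also have "\<dots> \<le> nmul (A x') (y x')" using y(3)[OF that(2)] .
    finally have "nmul (A x') (nmul k (y x)) < nmul (A x') (y x')" by (simp add: nmul_nmul)
    then show ?thesis using y(2)[OF that(2)] by simp
  qed
  have mono: "y x < y x'" if "x \<in> S" "x' \<in> S" "x < x'" for x x' using lt[OF that, of 1] by simp
  have inj: "inj_on y S"
    by (rule inj_onI) (metis linorder_neqE mono less_irrefl)
  have "arch_chain (y ` S)"
    unfolding arch_chain_def
  proof (intro conjI ballI impI allI)
    fix z assume "z \<in> y ` S"
    then obtain x where x: "x \<in> S" "z = y x" by blast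
    have "0 < x" using S(2) x by (auto simp: arch_chain_def)
    then have "0 < nmul (A x) (y x)" using y(3)[OF x(1)] by (rule less_le_trans)
    then show "0 < z" using y(2)[OF x(1)] x(2) by simp
  next
    fix z z' k assume "z \<in> y ` S" "z' \<in> y ` S" "z < z'"
    then obtain x x' where x: "x \<in> S" "x' \<in> S" "z = y x" "z' = y x'" by blast
    then have "x < x'" using \<open>z < z'\<close> mono[of x' x] by (metis linorder_neqE less_asym less_irrefl)
    then show "nmul k z < z'" using lt x by blast
  qed
  moreover have "y ` S \<subseteq> V" "finite (y ` S)" using y(1) S(1) by auto
  ultimately have "card (y ` S) \<le> n" using rank by (auto simp: rank_le_def)
  then show ?thesis using card_image[OF inj] by simp
qed

section \<open>Rank after adjoining one generator\<close>

definition zmul :: "int \<Rightarrow> 'g::linordered_ab_group_add \<Rightarrow> 'g"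
  where "zmul i \<gamma> = nmul (nat i) \<gamma> - nmul (nat (- i)) \<gamma>"

lemma zmul_diff_of_nat: "zmul (int a - int b) \<gamma> = nmul a \<gamma> - nmul b \<gamma>"
proof (cases "a \<le> b")
  case True
  then show ?thesis using nmul_add_left[of a "b - a" \<gamma>]
    by (simp add: zmul_def nat_diff_distrib' of_nat_diff[symmetric] del: of_nat_diff)
next
  case False
  then show ?thesis using nmul_add_left[of b "a - b" \<gamma>]
    by (simp add: zmul_def nat_diff_distrib' of_nat_diff[symmetric] del: of_nat_diff)
qed

lemma zmul_of_nat [simp]: "zmul (int n) \<gamma> = nmul n \<gamma>"
  by (simp add: zmul_def)

lemma zmul_0 [simp]: "zmul 0 \<gamma> = 0"
  by (simp add: zmul_def)

lemma zmul_uminus: "zmul (- i) \<gamma> = - zmul i \<gamma>"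
  by (simp add: zmul_def)

lemma zmul_add: "zmul (i + j) \<gamma> = zmul i \<gamma> + zmul j \<gamma>"
proof -
  obtain a b c d where ij: "i = int a - int b" "j = int c - int d" by (metis int_diff_cases)
  have "i + j = int (a + c) - int (b + d)" by (simp add: ij)
  then have "zmul (i + j) \<gamma> = nmul (a + c) \<gamma> - nmul (b + d) \<gamma>" by (simp only: zmul_diff_of_nat)
  then show ?thesis unfolding ij zmul_diff_of_nat by (simp add: nmul_add_left)
qed

lemma zmul_add_right: "zmul i (x + y) = zmul i x + zmul i y"
  by (simp add: zmul_def nmul_add)

lemma zmul_zmul: "zmul i (zmul j \<gamma>) = zmul (i * j) \<gamma>"
proof -
  obtain a b c d where ij: "i = int a - int b" "j = int c - int d" by (metis int_diff_cases)
  have "i * j = int (a * c + b * d) - int (a * d + b * c)" unfolding ij by (simp add: algebra_simps)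
  then have "zmul (i * j) \<gamma> = nmul (a * c + b * d) \<gamma> - nmul (a * d + b * c) \<gamma>"
    by (simp only: zmul_diff_of_nat)
  then show ?thesis
    unfolding ij zmul_diff_of_nat by (simp add: nmul_diff nmul_add_left nmul_nmul)
qed

lemma zmul_le: "0 \<le> x \<Longrightarrow> zmul i x \<le> nmul (nat \<bar>i\<bar>) x" "0 \<le> x \<Longrightarrow> - nmul (nat \<bar>i\<bar>) x \<le> zmul i x"
  using nmul_nonneg[of x "nat i"] nmul_nonneg[of x "nat (- i)"]
  by (cases "0 \<le> i"; simp add: zmul_def)+

lemma (in ordered_subgroup) zmul_mem [simp, intro]: "x \<in> G \<Longrightarrow> zmul i x \<in> G"
  by (auto simp: zmul_def)

text \<open>For a subgroup \<open>V\<close>, this is the divisible hull of the subgroup generated by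
  \<open>V\<close> and \<gamma>.\<close>

definition adjoin_multiples :: "'g::linordered_ab_group_add set \<Rightarrow> 'g \<Rightarrow> 'g set"
  where "adjoin_multiples V \<gamma> = {\<delta>. \<exists>n c. 0 < n \<and> nmul n \<delta> + zmul c \<gamma> \<in> V}"

text \<open>At most one member of a chain has to be given up: the smallest j without nonzero
  multiples in \<open>V\<close>. Smaller members have a multiple in \<open>V\<close>. For a larger
  x, a combination of x and j lies in \<open>V\<close> and stays in the Archimedean class of x,
  because j is infinitely smaller than x.\<close>

lemma rank_le_adjoin:
  fixes V :: "'g::linordered_ab_group_add set"
  assumes V: "ordered_subgroup V" and rank: "rank_le V n"
  shows "rank_le (adjoin_multiples V \<gamma>) (Suc n)"
  unfolding rank_le_def
proof (intro allI impI)
  fix S assume S: "finite S" "S \<subseteq> adjoin_multiples V \<gamma>" "arch_chain S"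
  interpret V: ordered_subgroup V by fact
  have pos: "0 < x" if "x \<in> S" for x using S(3) that by (auto simp: arch_chain_def)
  have torsion: "\<exists>y\<in>V. \<exists>A B. 0 < A \<and> x \<le> nmul A y \<and> y \<le> nmul B x"
    if "x \<in> S" "0 < m" "nmul m x \<in> V" for x m
    using that pos[OF that(1)] nmul_mono_left[of 1 m x]
    by (intro bexI[of _ "nmul m x"] exI[of _ 1] exI[of _ m]) auto
  define B where "B = {x\<in>S. \<forall>m>0. nmul m x \<notin> V}"
  show "card S \<le> Suc n"
  proof (cases "B = {}")
    case True
    then have "card S \<le> n"
      using torsion by (intro rank_le_comparable[OF rank S(1,3)]) (auto simp: B_def)
    then show ?thesis by simp
  next
    case False
    text \<open>The smallest element involving \<open>\<gamma>\<close> is used to eliminate \<open>\<gamma>\<close> from the others.\<close>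
    define j where "j = Min B"
    have finB: "finite B" using S(1) by (simp add: B_def)
    have j: "j \<in> S" "\<And>m. 0 < m \<Longrightarrow> nmul m j \<notin> V" using Min_in[OF finB False] by (auto simp: B_def j_def)
    obtain N c where jj: "0 < N" "nmul N j + zmul c \<gamma> \<in> V"
      using j(1) S(2) by (auto simp: adjoin_multiples_def)
    then have c0: "c \<noteq> 0" using j(2)[of N] by auto
    have "card (S - {j}) \<le> n"
    proof (rule rank_le_comparable[OF rank])
      show "finite (S - {j})" "arch_chain (S - {j})"
        using S arch_chain_subset by blast+
      fix x assume x: "x \<in> S - {j}"
      show "\<exists>y\<in>V. \<exists>A B. 0 < A \<and> x \<le> nmul A y \<and> y \<le> nmul B x"
      proof (cases "x < j")
        case True
        have "x \<notin> B" using Min_le[OF finB, of x] True by (auto simp: j_def)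
        then show ?thesis using x torsion by (auto simp: B_def)
      next
        case False
        then have jx: "j < x" using x by auto
        obtain N' c' where xx: "0 < N'" "nmul N' x + zmul c' \<gamma> \<in> V"
          using x S(2) by (auto simp: adjoin_multiples_def)
        \<comment> \<open>The relation for x times \<bar>c\<bar> minus the relation for j times
          \<open>sgn c * c'\<close> cancels \<gamma>; the absolute value keeps the coefficient of x
          positive.\<close>
        define a where "a = nat \<bar>c\<bar> * N'"
        define z where "z = sgn c * c' * int N"
        define y where "y = nmul a x - zmul z j"
        have a0: "0 < a" using c0 xx by (simp add: a_def)
        have "y = zmul \<bar>c\<bar> (nmul N' x + zmul c' \<gamma>) + zmul (- (sgn c * c')) (nmul N j + zmul c \<gamma>)"
        proof -
          have 1: "zmul \<bar>c\<bar> (nmul N' x) = nmul a x"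
            unfolding a_def using zmul_of_nat[of "nat \<bar>c\<bar>" "nmul N' x"] by (simp add: nmul_nmul)
          have 2: "zmul (- (sgn c * c')) (nmul N j) = - zmul z j"
            unfolding z_def using zmul_zmul[of "- (sgn c * c')" "int N" j] by (simp add: zmul_uminus)
          have "- (sgn c * c') * c = - (\<bar>c\<bar> * c')" by (simp add: abs_sgn)
          then have 3: "zmul \<bar>c\<bar> (zmul c' \<gamma>) + zmul (- (sgn c * c')) (zmul c \<gamma>) = 0"
            by (simp only: zmul_zmul zmul_uminus) simp
          show ?thesis unfolding zmul_add_right 1 2 y_def using 3 by (simp add: algebra_simps)
        qed
        then have yV: "y \<in> V" using xx jj by auto
        define m where "m = nat \<bar>z\<bar>"
        have j0: "0 \<le> j" and x0: "0 \<le> x" using pos j(1) x by (auto intro: less_imp_le)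
        have small: "nmul k j < x" for k
          using S(3) j(1) x jx by (auto simp: arch_chain_def)
        \<comment> \<open>Every multiple of j is below x, in particular 2 z j, whereas 2 a x is at
          least 2 x.\<close>
        have "x \<le> nmul 2 y"
        proof -
          have "nmul 2 (zmul z j) \<le> nmul 2 (nmul m j)"
            unfolding m_def by (rule nmul_mono) (rule zmul_le(1)[OF j0])
          also have "\<dots> < x" using small by (simp add: nmul_nmul)
          finally have "nmul 2 (zmul z j) \<le> x" by simp
          moreover have "x + x \<le> nmul 2 (nmul a x)"
            using nmul_mono_left[of 2 "2 * a" x] a0 x0 by (simp add: nmul_nmul nmul_Suc numeral_2_eq_2)
          ultimately have "x + x - x \<le> nmul 2 (nmul a x) - nmul 2 (zmul z j)" by (rule diff_mono[rotated])
          then show ?thesis by (simp add: y_def nmul_diff)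
        qed
        moreover have "y \<le> nmul (Suc a) x"
        proof -
          have "- zmul z j \<le> nmul m j" using zmul_le(2)[OF j0, of z] unfolding m_def by (simp add: minus_le_iff)
          also have "\<dots> \<le> x" using small by (simp add: less_imp_le)
          finally show ?thesis by (simp add: y_def nmul_Suc)
        qed
        ultimately show ?thesis using yV by (intro bexI[of _ y] exI[of _ 2] exI[of _ "Suc a"]) auto
      qed
    qed
    then show ?thesis using j(1) S(1) by (simp add: card_Diff_singleton)
  qed
qed

section \<open>Value groups of generated fields\<close>

lemma subset_gen: "S \<subseteq> gen S"
  by (auto intro: generate_field.incl)

lemma gen_subfield: "subfield (gen S) \<Omega>"
  by (rule field.generate_field_is_subfield[OF ambient_field]) simp

lemma gen_subset: "subfield E \<Omega> \<Longrightarrow> S \<subseteq> E \<Longrightarrow> gen S \<subseteq> E"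
  by (rule field.generate_field_min_subfield1[OF ambient_field]) simp_all

lemma generate_field_insert:
  "gen (insert b S) = gen (insert b (gen S))"
proof
  show "gen (insert b S) \<subseteq> gen (insert b (gen S))"
    by (intro gen_subset gen_subfield) (auto intro: generate_field.incl)
  have "gen S \<subseteq> gen (insert b S)"
    by (intro gen_subset gen_subfield) (auto intro: generate_field.incl)
  then show "gen (insert b (gen S)) \<subseteq> gen (insert b S)"
    by (intro gen_subset gen_subfield) (auto intro: generate_field.incl)
qed

lemma (in ambient_subfield) generate_field_self: "gen F = F"
  using gen_subset[OF subfield, of F] subset_gen[of F] by blast

lemma (in ambient_subfield) gen_insert_quotients:
  "gen (insert b F) \<subseteq> {poly f b / poly g b | f g. f \<in> polys F \<and> g \<in> polys F \<and> poly g b \<noteq> 0}"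
    (is "_ \<subseteq> ?Q")
proof (rule gen_subset)
  show "subfield ?Q \<Omega>"
  proof (rule subfield_ambientI)
    show "1 \<in> ?Q" by (auto intro!: exI[of _ 1])
    fix x assume "x \<in> ?Q"
    then obtain f g where x: "x = poly f b / poly g b" "f \<in> polys F" "g \<in> polys F" "poly g b \<noteq> 0" by blast
    have "- x = poly (0 - f) b / poly g b" using x by simp
    then show "- x \<in> ?Q" using x by blast
    show "inverse x \<in> ?Q" if "x \<noteq> 0"
    proof -
      have "inverse x = poly g b / poly f b" "poly f b \<noteq> 0" using x that by auto
      then show ?thesis using x by blast
    qed
    fix y assume "y \<in> ?Q"
    then obtain f' g' where y: "y = poly f' b / poly g' b" "f' \<in> polys F" "g' \<in> polys F" "poly g' b \<noteq> 0" by blast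
    have "x + y = poly (f * g' + f' * g) b / poly (g * g') b"
      using x y by (simp add: add_frac_eq)
    moreover have "f * g' + f' * g \<in> polys F" "g * g' \<in> polys F" "poly (g * g') b \<noteq> 0" using x y by auto
    ultimately show "x + y \<in> ?Q" by blast
    have "x * y = poly (f * f') b / poly (g * g') b" using x y by simp
    moreover have "f * f' \<in> polys F" "g * g' \<in> polys F" "poly (g * g') b \<noteq> 0" using x y by auto
    ultimately show "x * y \<in> ?Q" by blast
  qed
  show "insert b F \<subseteq> ?Q"
  proof
    fix x assume "x \<in> insert b F"
    then consider "x = b" | "x \<in> F" by blast
    then show "x \<in> ?Q"
    proof cases
      case 1
      then have "x = poly (monom 1 1) b / poly 1 b" by (simp add: poly_monom)
      moreover have "monom 1 1 \<in> polys F" by auto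
      moreover have "poly 1 b \<noteq> 0" by simp
      ultimately show ?thesis using polys_1 by blast
    next
      case 2
      then have "x = poly [:x:] b / poly 1 b" by simp
      moreover have "[:x:] \<in> polys F" using 2 by auto
      moreover have "poly 1 b \<noteq> 0" by simp
      ultimately show ?thesis using polys_1 by blast
    qed
  qed
qed

lemma (in valued) v_sum_distinct:
  assumes "finite J" "J \<noteq> {}" "\<And>j. j \<in> J \<Longrightarrow> t j \<noteq> 0" "inj_on (\<lambda>j. v (t j)) J"
  shows "\<exists>j\<in>J. sum t J \<noteq> 0 \<and> v (sum t J) = v (t j)"
proof -
  have "Min ((\<lambda>j. v (t j)) ` J) \<in> (\<lambda>j. v (t j)) ` J" using assms(1,2) by (intro Min_in) auto
  then obtain j where j: "j \<in> J" "v (t j) = Min ((\<lambda>j. v (t j)) ` J)" by auto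
  have "vgt (v (t j)) (t i)" if "i \<in> J" "i \<noteq> j" for i
  proof -
    have "v (t j) \<le> v (t i)" unfolding j(2) using assms(1) that(1) by (intro Min_le) auto
    moreover have "v (t j) \<noteq> v (t i)" using assms(4) j(1) that by (auto simp: inj_on_def)
    ultimately show ?thesis by (simp add: vgt_def less_le)
  qed
  then show ?thesis using v_sum_dominant[OF assms(1) j(1), of t] assms(3) j(1) by blast
qed

context valued_subfield
begin

text \<open>Choose h of least degree with \<gamma> = v(h(b)) outside \<open>V\<close>. The digits of
  an h-adic expansion have values in \<open>V\<close> by minimality. No nonzero multiple of \<gamma>
  lies in \<open>V\<close>, so the terms have distinct values and v(f(b)) lies in \<open>V\<close>
  up to a multiple of \<gamma>. If no such h exists, \<gamma> = 0 suffices.\<close>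

lemma generate_field_value_group:
  defines "V \<equiv> divisible_hull (value_group v F)"
  shows "\<exists>\<gamma>. value_group v (gen (insert b F)) \<subseteq> adjoin_multiples V \<gamma>"
proof -
  interpret V: ordered_subgroup V unfolding V_def by (rule value_group.divisible_hull_subgroup)
  have root: "\<gamma> \<in> V" if "0 < n" "nmul n \<gamma> \<in> V" for n \<gamma>
    using divisible_hull_root that unfolding V_def by blast
  have const: "v a \<in> V" if "a \<in> F" "a \<noteq> 0" for a
    unfolding V_def using that by (intro divisible_hull_incl value_groupI)
  have "\<exists>\<gamma>. \<forall>f\<in>polys F. poly f b \<noteq> 0 \<longrightarrow> (\<exists>c. v (poly f b) + zmul c \<gamma> \<in> V)"
  proof (cases "\<exists>h\<in>polys F. poly h b \<noteq> 0 \<and> v (poly h b) \<notin> V")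
    case True
    define P where "P d \<longleftrightarrow> (\<exists>h\<in>polys F. poly h b \<noteq> 0 \<and> v (poly h b) \<notin> V \<and> degree h = d)" for d
    have "\<exists>d. P d" using True by (auto simp: P_def)
    then have "P (LEAST d. P d)" by (rule LeastI_ex)
    then obtain h where h: "h \<in> polys F" "poly h b \<noteq> 0" "v (poly h b) \<notin> V" "degree h = (LEAST d. P d)"
      by (auto simp: P_def)
    have small: "v (poly q b) \<in> V" if "q \<in> polys F" "poly q b \<noteq> 0" "degree q < degree h" for q
      using not_less_Least[of "degree q" P] that h(4) by (auto simp: P_def)
    have dh: "0 < degree h"
    proof (rule ccontr)
      assume "\<not> 0 < degree h"
      then obtain a where "h = [:a:]" by (meson degree_eq_zeroE neq0_conv)
      then show False using h const[of a] polysD[OF h(1), of 0] by simp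
    qed
    define \<gamma> where "\<gamma> = v (poly h b)"
    have "\<exists>c. v (poly f b) + zmul c \<gamma> \<in> V" if f: "f \<in> polys F" "poly f b \<noteq> 0" for f
    proof -
      obtain s where s: "\<And>j. s j \<in> polys F" "\<And>j. degree (s j) < degree h" "f = (\<Sum>j\<le>degree f. s j * h ^ j)"
        using polys_adic_expansion[OF h(1) dh f(1)] by blast
      define J where "J = {j\<in>{..degree f}. poly (s j) b \<noteq> 0}"
      define t where "t j = poly (s j) b * poly h b ^ j" for j
      have sum: "poly f b = sum t J"
      proof -
        have "poly f b = (\<Sum>j\<le>degree f. t j)" by (subst s(3)) (simp add: poly_sum t_def)
        also have "\<dots> = sum t J" by (rule sum.mono_neutral_right) (auto simp: J_def t_def)
        finally show ?thesis .
      qed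
      have t: "t j \<noteq> 0" "v (t j) = v (poly (s j) b) + nmul j \<gamma>" "v (poly (s j) b) \<in> V" if "j \<in> J" for j
        using that h(2) small s(1,2) by (auto simp: J_def t_def v_mult v_power \<gamma>_def)
      have neq: "v (t i) \<noteq> v (t j)" if "i \<in> J" "j \<in> J" "i < j" for i j
      proof
        assume "v (t i) = v (t j)"
        moreover have "nmul j \<gamma> = nmul i \<gamma> + nmul (j - i) \<gamma>"
          using nmul_add_left[of i "j - i" \<gamma>] that by simp
        ultimately have "nmul (j - i) \<gamma> = v (poly (s i) b) - v (poly (s j) b)"
          using t that by (simp add: algebra_simps)
        then have "nmul (j - i) \<gamma> \<in> V" using t that by simp
        then show False using root[of "j - i" \<gamma>] that h(3) by (simp add: \<gamma>_def)
      qed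
      have "inj_on (\<lambda>j. v (t j)) J"
        by (rule inj_onI) (metis linorder_neqE_nat neq)
      moreover have "finite J" by (simp add: J_def)
      moreover have "J \<noteq> {}" using sum f(2) by (metis sum.empty)
      ultimately obtain j where j: "j \<in> J" "v (poly f b) = v (t j)"
        using v_sum_distinct[of J t] t(1) unfolding sum by blast
      then have "v (poly f b) + zmul (- int j) \<gamma> \<in> V"
        using t[OF j(1)] by (simp add: zmul_uminus)
      then show ?thesis by blast
    qed
    then show ?thesis by blast
  next
    case False
    then show ?thesis by (intro exI[of _ 0]) (auto intro!: exI[of _ 0])
  qed
  then obtain \<gamma> where \<gamma>: "\<And>f. f \<in> polys F \<Longrightarrow> poly f b \<noteq> 0 \<Longrightarrow> \<exists>c. v (poly f b) + zmul c \<gamma> \<in> V" by blast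
  have "\<delta> \<in> adjoin_multiples V \<gamma>" if \<delta>: "\<delta> \<in> value_group v (gen (insert b F))" for \<delta>
  proof -
    obtain x where x: "x \<in> gen (insert b F)" "x \<noteq> 0" "\<delta> = v x"
      using \<delta> by (auto simp: value_group_def)
    from x(1) gen_insert_quotients obtain f g where
      "f \<in> polys F" "g \<in> polys F" "poly g b \<noteq> 0" "x = poly f b / poly g b" by blast
    note fg = this
    then have nz: "poly f b \<noteq> 0" using x(2) by auto
    obtain c d where cd: "v (poly f b) + zmul c \<gamma> \<in> V" "v (poly g b) + zmul d \<gamma> \<in> V"
      using \<gamma> fg nz by metis
    have "nmul 1 \<delta> + zmul (c - d) \<gamma> = (v (poly f b) + zmul c \<gamma>) - (v (poly g b) + zmul d \<gamma>)"
      using zmul_add[of c "- d" \<gamma>] by (simp add: x(3) fg nz v_divide zmul_uminus algebra_simps)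
    also have "\<dots> \<in> V" using cd by (rule V.diff_mem)
    finally show ?thesis unfolding adjoin_multiples_def by (metis (mono_tags, lifting) mem_Collect_eq zero_less_one)
  qed
  then show ?thesis by blast
qed

text \<open>In an algebraic relation two nonzero terms must have the same value, since a sum of
  terms with distinct values cannot vanish. Their comparison puts a positive multiple of v(x) into
  the value group of \<open>F\<close>.\<close>

lemma algebraic_value_group:
  assumes "F \<subseteq> E" "\<And>x. x \<in> E \<Longrightarrow> amb.algebraic F x"
  shows "value_group v E \<subseteq> divisible_hull (value_group v F)"
proof
  fix \<delta> assume "\<delta> \<in> value_group v E"
  then obtain x where x: "x \<in> E" "x \<noteq> 0" "\<delta> = v x" by (auto simp: value_group_def)
  obtain f where f: "f \<in> polys F" "f \<noteq> 0" "poly f x = 0"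
    using assms(2)[OF x(1)] unfolding algebraic_iff by blast
  define J where "J = {j\<in>{..degree f}. coeff f j \<noteq> 0}"
  define t where "t j = coeff f j * x ^ j" for j
  have "poly f x = sum t {..degree f}" by (simp add: poly_altdef t_def)
  also have "\<dots> = sum t J" by (rule sum.mono_neutral_right) (auto simp: J_def t_def)
  finally have sum: "sum t J = 0" using f(3) by simp
  have J: "finite J" "J \<noteq> {}" using f(2) by (auto simp: J_def intro!: exI[of _ "degree f"])
  have t: "t j \<noteq> 0" "v (t j) = v (coeff f j) + nmul j \<delta>" "v (coeff f j) \<in> value_group v F" if "j \<in> J" for j
    using that x polysD[OF f(1)] by (auto simp: J_def t_def v_mult v_power)
  have "\<not> inj_on (\<lambda>j. v (t j)) J"
    using v_sum_distinct[OF J, of t] t(1) sum by blast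
  then obtain i j where ij: "i \<in> J" "j \<in> J" "i < j" "v (t i) = v (t j)"
    unfolding inj_on_def by (metis linorder_neqE_nat)
  have "nmul j \<delta> = nmul i \<delta> + nmul (j - i) \<delta>"
    using nmul_add_left[of i "j - i" \<delta>] ij by simp
  then have "nmul (j - i) \<delta> = v (coeff f i) - v (coeff f j)"
    using ij t by (simp add: algebra_simps)
  then have "nmul (j - i) \<delta> \<in> value_group v F" using ij t by simp
  then show "\<delta> \<in> divisible_hull (value_group v F)"
    unfolding divisible_hull_def' using ij(3) by (auto intro!: exI[of _ "j - i"])
qed

end

lemma adjoin_multiples_root:
  "0 < n \<Longrightarrow> nmul n \<delta> \<in> adjoin_multiples V \<gamma> \<Longrightarrow> \<delta> \<in> adjoin_multiples V \<gamma>"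
  unfolding adjoin_multiples_def by (auto simp: nmul_nmul) (metis nat_0_less_mult_iff)

text \<open>The form of Abhyankar's inequality used here: the trivially valued base field has rank
  0, and each generator raises the rank by at most one.\<close>

lemma (in valued) rank_le_generate_field:
  assumes "subfield K0 \<Omega>" "\<And>x. x \<in> K0 \<Longrightarrow> x \<noteq> 0 \<Longrightarrow> v x = 0" "finite B"
  shows "rank_le (divisible_hull (value_group v (gen (K0 \<union> B)))) (card B)"
  using assms(3)
proof (induction B rule: finite_induct)
  case empty
  interpret K0: ambient_subfield K0 by (rule ambient_subfield.intro) fact
  have "value_group v (gen K0) \<subseteq> {0}"
    using assms(2) unfolding K0.generate_field_self by (auto simp: value_group_def)
  then have sub: "divisible_hull (value_group v (gen K0)) \<subseteq> {0}"
    unfolding divisible_hull_def' by auto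
  have "rank_le {0} 0"
    unfolding rank_le_def arch_chain_def by auto
  with sub show ?case by (auto intro: rank_le_mono)
next
  case (insert b B)
  let ?F = "gen (K0 \<union> B)"
  interpret F: valued_subfield v ?F by (rule valued_subfieldI[OF gen_subfield])
  have eq: "gen (K0 \<union> insert b B) = gen (insert b ?F)"
    using generate_field_insert[of b "K0 \<union> B"] by simp
  obtain \<gamma> where \<gamma>: "value_group v (gen (insert b ?F)) \<subseteq>
      adjoin_multiples (divisible_hull (value_group v ?F)) \<gamma>"
    using F.generate_field_value_group by blast
  have "divisible_hull (value_group v (gen (insert b ?F))) \<subseteq>
      adjoin_multiples (divisible_hull (value_group v ?F)) \<gamma>"
  proof
    fix \<delta> assume "\<delta> \<in> divisible_hull (value_group v (gen (insert b ?F)))"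
    then obtain n where n: "0 < n" "nmul n \<delta> \<in> value_group v (gen (insert b ?F))"
      unfolding divisible_hull_def' by blast
    show "\<delta> \<in> adjoin_multiples (divisible_hull (value_group v ?F)) \<gamma>"
      using adjoin_multiples_root[OF n(1)] n(2) \<gamma> by blast
  qed
  moreover have "rank_le (adjoin_multiples (divisible_hull (value_group v ?F)) \<gamma>) (Suc (card B))"
    by (rule rank_le_adjoin[OF F.value_group.divisible_hull_subgroup insert.IH])
  ultimately show ?case
    unfolding eq using insert.hyps by (auto intro: rank_le_mono)
qed

subsection \<open>Transcendence bases\<close>

abbreviation lookup where "lookup \<equiv> Poly_Mapping.lookup"
abbreviation keys where "keys \<equiv> Poly_Mapping.keys"

lemma self_eval_superset:
  assumes "finite M" "keys P \<subseteq> M"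
    "finite B" "\<And>m. m \<in> M \<Longrightarrow> keys m \<subseteq> B"
  shows "self_eval P = (\<Sum>m\<in>M. lookup P m * (\<Prod>x\<in>B. x ^ lookup m x))"
proof -
  have "self_eval P = (\<Sum>m\<in>keys P. lookup P m * (\<Prod>x\<in>B. x ^ lookup m x))"
    unfolding self_eval_def
  proof (intro sum.cong refl arg_cong2[where f = "(*)"])
    fix m assume "m \<in> keys P"
    then have "keys m \<subseteq> B" using assms(2,4) by blast
    then show "(\<Prod>x\<in>keys m. x ^ lookup m x) = (\<Prod>x\<in>B. x ^ lookup m x)"
      using assms(3) by (intro prod.mono_neutral_left) (auto simp: in_keys_iff)
  qed
  also have "\<dots> = (\<Sum>m\<in>M. lookup P m * (\<Prod>x\<in>B. x ^ lookup m x))"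
    using assms by (intro sum.mono_neutral_left) (auto simp: in_keys_iff)
  finally show ?thesis .
qed

text \<open>A dependence relation is read as a polynomial in s over the field generated by
  \<open>B\<close>. The work lies in showing that collecting powers of s does not make it
  zero.\<close>

lemma algebraic_if_dependent:
  assumes "subfield K0 \<Omega>" "finite B" "algebraically_independent K0 B"
    and dep: "\<not> algebraically_independent K0 (insert s B)" and s: "s \<notin> B"
  shows "amb.algebraic (gen (K0 \<union> B)) s"
proof -
  let ?F = "gen (K0 \<union> B)"
  interpret F: ambient_subfield ?F by (rule ambient_subfield.intro) (rule gen_subfield)
  interpret K0: ambient_subfield K0 by (rule ambient_subfield.intro) fact
  obtain P where P: "range (lookup P) \<subseteq> K0"
    "\<And>m. m \<in> keys P \<Longrightarrow> keys m \<subseteq> insert s B" "self_eval P = 0" "P \<noteq> 0"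
    using dep unfolding algebraically_independent_def by blast
  define M where "M = keys P"
  define c where "c m = lookup P m * (\<Prod>x\<in>B. x ^ lookup m x)" for m
  have finM: "finite M" by (simp add: M_def)
  have cF: "c m \<in> ?F" for m
  proof -
    have "lookup P m \<in> ?F" using P(1) subset_gen[of "K0 \<union> B"] by blast
    moreover have "x ^ n \<in> ?F" if "x \<in> B" for x n
      using that subset_gen[of "K0 \<union> B"] F.power_mem by blast
    ultimately show ?thesis unfolding c_def by (intro F.mult_mem F.prod_mem)
  qed
  define f where "f = (\<Sum>m\<in>M. monom (c m) (lookup m s))"
  have "f \<in> polys ?F" unfolding f_def using cF by (intro F.polys_sum F.polys_monom)
  moreover have "poly f s = self_eval P"
  proof -
    have "poly f s = (\<Sum>m\<in>M. c m * s ^ lookup m s)"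
      by (simp add: f_def poly_sum poly_monom)
    also have "\<dots> = self_eval P"
      using self_eval_superset[OF finM _ _ P(2), of P] assms(2) s
      by (simp add: M_def c_def mult_ac)
    finally show ?thesis .
  qed
  \<comment> \<open>The monomials with one fixed exponent k of s, stripped of s, form a nonzero
    relation candidate Q over \<open>B\<close>. By independence of \<open>B\<close> its value, the
    k-th coefficient of f, is nonzero.\<close>
  moreover have "f \<noteq> 0"
  proof -
    obtain m0 where m0: "m0 \<in> M" using P(4) unfolding M_def by (metis equals0I keys_eq_empty)
    define k where "k = lookup m0 s"
    define N where "N = {m\<in>M. lookup m s = k}"
    \<comment> \<open>\<open>r\<close> erases the variable s; it is injective on \<open>N\<close>
      because all monomials there have the same exponent of s.\<close>
    define r where "r m = Poly_Mapping.update s 0 m" for m :: "'a \<Rightarrow>\<^sub>0 nat"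
    have lr: "lookup (r m) x = (if x = s then 0 else lookup m x)" for m x
      by (simp add: r_def lookup_update)
    have inj: "inj_on r N"
    proof (rule inj_onI)
      fix m m' assume m: "m \<in> N" "m' \<in> N" "r m = r m'"
      show "m = m'"
      proof (rule poly_mapping_eqI)
        fix x
        show "lookup m x = lookup m' x"
          using m lr[of m x] lr[of m' x] by (cases "x = s") (auto simp: N_def)
      qed
    qed
    define Q where "Q = (\<Sum>m\<in>N. Poly_Mapping.single (r m) (lookup P m))"
    have finN: "finite N" using finM by (simp add: N_def)
    have lQ: "lookup Q n = (\<Sum>m\<in>N. if r m = n then lookup P m else 0)" for n
      by (simp add: Q_def lookup_sum lookup_single when_def)
    have lQr: "lookup Q (r m) = lookup P m" if "m \<in> N" for m
    proof -
      have "lookup Q (r m) = (\<Sum>m'\<in>N. if m' = m then lookup P m' else 0)"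
        unfolding lQ using inj that by (intro sum.cong) (auto simp: inj_on_def)
      then show ?thesis using finN that by simp
    qed
    have keysQ: "keys Q \<subseteq> r ` N"
    proof
      fix n assume "n \<in> keys Q"
      then have "lookup Q n \<noteq> 0" by (simp add: in_keys_iff)
      moreover have "lookup Q n = 0" if "n \<notin> r ` N"
        unfolding lQ using that by (intro sum.neutral) auto
      ultimately show "n \<in> r ` N" by blast
    qed
    have keysr: "keys (r m) \<subseteq> B" if "m \<in> N" for m
    proof
      fix x assume "x \<in> keys (r m)"
      then have "lookup (r m) x \<noteq> 0" by (simp add: in_keys_iff)
      then have "x \<noteq> s" "x \<in> keys m" unfolding lr by (auto simp: in_keys_iff split: if_splits)
      moreover have "keys m \<subseteq> insert s B" using P(2)[of m] that by (simp add: N_def M_def)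
      ultimately show "x \<in> B" by blast
    qed
    have "lookup Q (r m0) \<noteq> 0"
      using lQr[of m0] m0 by (auto simp: N_def k_def M_def in_keys_iff)
    then have "Q \<noteq> 0" by auto
    moreover have "range (lookup Q) \<subseteq> K0"
    proof (intro image_subsetI)
      fix n
      have "lookup P m \<in> K0" for m using P(1) by blast
      then show "lookup Q n \<in> K0" unfolding lQ by (intro K0.sum_mem) simp
    qed
    moreover have "\<forall>m\<in>keys Q. keys m \<subseteq> B"
      using keysQ keysr by blast
    ultimately have "self_eval Q \<noteq> 0"
      using assms(3) unfolding algebraically_independent_def by blast
    also have "self_eval Q = (\<Sum>n\<in>r ` N. lookup Q n * (\<Prod>x\<in>B. x ^ lookup n x))"
      using finN keysr by (intro self_eval_superset[OF _ keysQ assms(2)]) auto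
    also have "\<dots> = (\<Sum>m\<in>N. lookup Q (r m) * (\<Prod>x\<in>B. x ^ lookup (r m) x))"
      by (subst sum.reindex[OF inj]) simp
    also have "\<dots> = (\<Sum>m\<in>N. c m)"
      unfolding c_def using s by (intro sum.cong refl arg_cong2[where f = "(*)"] prod.cong lQr) (auto simp: lr)
    also have "\<dots> = coeff f k"
    proof -
      have "coeff f k = (\<Sum>m\<in>M. if lookup m s = k then c m else 0)"
        by (simp add: f_def coeff_sum)
      also have "\<dots> = (\<Sum>m\<in>N. c m)"
        unfolding N_def using finM by (simp add: sum.inter_filter)
      finally show ?thesis by simp
    qed
    finally show ?thesis by auto
  qed
  ultimately show ?thesis unfolding F.algebraic_iff using P(3) by auto
qed

lemma algebraically_independent_empty: "algebraically_independent K0 {}"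
  unfolding algebraically_independent_def
proof (intro allI impI)
  fix P :: "('a \<Rightarrow>\<^sub>0 nat) \<Rightarrow>\<^sub>0 'a"
  assume P: "range (lookup P) \<subseteq> K0 \<and>
    (\<forall>m\<in>keys P. keys m \<subseteq> {}) \<and> self_eval P = 0"
  then have sub: "keys P \<subseteq> {0}" by auto
  have "self_eval P = lookup P 0"
    using self_eval_superset[OF _ sub, of "{}"] by simp
  then have "lookup P 0 = 0" using P by simp
  show "P = 0"
  proof (rule poly_mapping_eqI)
    fix m
    show "lookup P m = lookup 0 m"
      using \<open>lookup P 0 = 0\<close> sub by (cases "m = 0") (auto simp: in_keys_iff)
  qed
qed

lemma (in ambient_subfield) algebraic_mem: "x \<in> F \<Longrightarrow> amb.algebraic F x"
  unfolding algebraic_iff by (rule bexI[of _ "[:- x, 1:]"]) auto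

lemma subfield_algebraic: "subfield F \<Omega> \<Longrightarrow> subfield {x. amb.algebraic F x} \<Omega>"
  using field.subfield_of_algebraics[OF ambient_field, of F] by (simp add: over_def)

text \<open>\<open>trdeg\<close> takes a finite basis from \<open>SOME\<close>, so existence gives
  it its meaning. A maximal independent subset of the finite generating set serves as basis.\<close>

lemma finite_transcendence_basis_exists:
  assumes "finitely_generated_over K0 K"
  shows "\<exists>B. finite B \<and> transcendence_basis K0 K B"
proof -
  obtain S where S: "subfield K0 \<Omega>" "finite S" "K = gen (K0 \<union> S)"
    using assms by (auto simp: finitely_generated_over_def)
  define \<B> where "\<B> = {B. B \<subseteq> S \<and> algebraically_independent K0 B}"
  have "finite \<B>" using S(2) by (simp add: \<B>_def)
  moreover have "{} \<in> \<B>" by (simp add: \<B>_def algebraically_independent_empty)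
  ultimately obtain B where B: "B \<in> \<B>" "\<And>A. A \<in> \<B> \<Longrightarrow> B \<subseteq> A \<Longrightarrow> B = A"
    using finite_has_maximal[of \<B>] by blast
  have finB: "finite B" using B(1) S(2) finite_subset by (auto simp: \<B>_def)
  let ?F = "gen (K0 \<union> B)"
  interpret F: ambient_subfield ?F by (rule ambient_subfield.intro) (rule gen_subfield)
  have "amb.algebraic ?F s" if s: "s \<in> S" for s
  proof (cases "s \<in> B")
    case True
    then show ?thesis using subset_gen[of "K0 \<union> B"] by (intro F.algebraic_mem) auto
  next
    case False
    then have "insert s B \<notin> \<B>" using B(2)[of "insert s B"] by blast
    then have "\<not> algebraically_independent K0 (insert s B)" using s B(1) by (auto simp: \<B>_def)
    then show ?thesis
      using algebraic_if_dependent[OF S(1) finB] B(1) False by (auto simp: \<B>_def)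
  qed
  moreover have "amb.algebraic ?F x" if "x \<in> K0" for x
    using that subset_gen[of "K0 \<union> B"] by (intro F.algebraic_mem) auto
  ultimately have "gen (K0 \<union> S) \<subseteq> {x. amb.algebraic ?F x}"
    by (intro gen_subset subfield_algebraic F.subfield) auto
  moreover have "B \<subseteq> K" using B(1) S(3) subset_gen[of "K0 \<union> S"] by (auto simp: \<B>_def)
  ultimately have "transcendence_basis K0 K B"
    using B(1) S(3) by (auto simp: transcendence_basis_def \<B>_def)
  with finB show ?thesis by blast
qed

text \<open>The basis obtained is the very one selected in \<open>trdeg\<close>, whence its
  cardinality.\<close>

lemma trdeg_basis:
  assumes "finitely_generated_over K0 K"
  obtains B where "finite B" "card B = trdeg K0 K" "B \<subseteq> K"
    "\<And>x. x \<in> K \<Longrightarrow> amb.algebraic (gen (K0 \<union> B)) x"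
proof -
  define B where "B = (SOME B. finite B \<and> transcendence_basis K0 K B)"
  have "finite B \<and> transcendence_basis K0 K B"
    unfolding B_def by (rule someI_ex) (rule finite_transcendence_basis_exists[OF assms])
  then show ?thesis
    using that[of B] by (auto simp: transcendence_basis_def trdeg_def B_def)
qed

lemma finite_dimension_over_transcendental:
  assumes "finitely_generated_over K0 K" "B \<subseteq> K"
    and alg: "\<And>x. x \<in> K \<Longrightarrow> amb.algebraic (gen (K0 \<union> B)) x"
  obtains N where "0 < N" "amb.dimension N (gen (K0 \<union> B)) K"
proof -
  let ?F = "gen (K0 \<union> B)"
  interpret F: ambient_subfield ?F by (rule ambient_subfield.intro) (rule gen_subfield)
  obtain S where S: "finite S" "K = gen (K0 \<union> S)" and K: "subfield K \<Omega>" and K0: "subfield K0 \<Omega>"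
    using assms(1) by (auto simp: finitely_generated_over_def)
  obtain xs where xs: "set xs = S" using finite_list[OF S(1)] by blast
  have KS: "K0 \<union> S \<subseteq> K" using S(2) subset_gen[of "K0 \<union> S"] by simp
  have FK: "?F \<subseteq> K" using gen_subset[OF K, of "K0 \<union> B"] KS assms(2) by blast
  let ?E = "amb.finite_extension ?F xs"
  have xsalg: "(amb.algebraic over ?F) x" if "x \<in> set xs" for x
    using alg[of x] that xs KS by (auto simp: over_def)
  have E: "subfield ?E \<Omega>"
    by (rule amb.finite_extension_is_subfield[OF F.subfield _ xsalg]) simp_all
  have "?F \<subseteq> ?E" "set xs \<subseteq> ?E"
    using amb.finite_extension_incl[of ?F xs] amb.finite_extension_mem[OF subfieldE(1)[OF F.subfield], of xs]
    by simp_all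
  then have "K0 \<union> S \<subseteq> ?E" using xs subset_gen[of "K0 \<union> B"] by blast
  then have "K \<subseteq> ?E" unfolding S(2) by (rule gen_subset[OF E])
  moreover have "?E \<subseteq> K"
    using amb.finite_extension_subring_incl[OF subfieldE(1)[OF K] FK, of xs] xs KS by blast
  ultimately have eq: "?E = K" by blast
  have "amb.finite_dimension ?F ?E"
    by (rule amb.finite_extension_finite_dimension(1)[OF F.subfield _ xsalg]) simp_all
  then obtain N where N: "amb.dimension N ?F K" unfolding eq by blast
  have "N \<noteq> 0"
  proof
    assume "N = 0"
    then have "K = {0}" using amb.dimension_zero[OF F.subfield] N by simp
    then show False using ambient_subfield.one_mem[OF ambient_subfield.intro[OF K]] by simp
  qed
  then show ?thesis using that N by blast
qed

subsection \<open>The degree of imperfection\<close>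

lemma (in ambient_subfield) roots_dimension_le:
  assumes p: "CHAR('a) > 0" and "finite C" "\<And>c. c \<in> C \<Longrightarrow> c ^ CHAR('a) \<in> F"
  shows "\<exists>q. q \<le> CHAR('a) ^ card C \<and> amb.dimension q F (gen (F \<union> C))"
  using assms(2,3)
proof (induction C rule: finite_induct)
  case empty
  have "amb.dimension 1 F F" using amb.dimension_one[OF subfield] .
  then show ?case by (auto simp: generate_field_self intro!: exI[of _ 1])
next
  case (insert c C)
  let ?E = "gen (F \<union> C)" and ?g = "root_poly c"
  interpret E: ambient_subfield ?E by (rule ambient_subfield.intro) (rule gen_subfield)
  obtain q where q: "q \<le> CHAR('a) ^ card C" "amb.dimension q F ?E"
    using insert.IH insert.prems by blast
  have FE: "F \<subseteq> ?E" using subset_gen[of "F \<union> C"] by blast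
  have g: "?g \<in> polys ?E" using insert.prems[of c] FE by auto
  note degg = degree_root_poly[OF p, of c] and g0 = root_poly_nz[OF p, of c]
  have root: "poly ?g c = 0" by (rule poly_root_poly)
  obtain d where d: "d \<le> CHAR('a)" "amb.dimension d ?E (adjoin ?E c)"
    using E.simple_extension_dimension_le[OF g g0 root] degg by auto
  have alg: "amb.algebraic ?E c" unfolding E.algebraic_iff using g g0 root by blast
  have "adjoin ?E c = gen (F \<union> insert c C)"
  proof
    have "F \<union> insert c C \<subseteq> adjoin ?E c"
      using E.mem_simple_extension[of c] E.subset_simple_extension[of c] subset_gen[of "F \<union> C"] by blast
    then show "gen (F \<union> insert c C) \<subseteq> adjoin ?E c"
      by (rule gen_subset[OF E.simple_extension_subfield[OF alg]])
    have "?E \<subseteq> gen (F \<union> insert c C)"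
      using subset_gen[of "F \<union> insert c C"] by (intro gen_subset gen_subfield) blast
    then show "adjoin ?E c \<subseteq> gen (F \<union> insert c C)"
      using subset_gen[of "F \<union> insert c C"]
      by (intro amb.simple_extension_subring_incl subfieldE(1)[OF gen_subfield]) auto
  qed
  then have "amb.dimension (q * d) F (gen (F \<union> insert c C))"
    using amb.telescopic_base[OF subfield E.subfield q(2) d(2)] by simp
  moreover have "q * d \<le> CHAR('a) ^ card (insert c C)"
    using mult_le_mono[OF q(1) d(1)] insert.hyps by (simp add: mult.commute)
  ultimately show ?case by blast
qed

lemma combine_frobenius:
  fixes Ks Us :: "'a::field list"
  assumes "CHAR('a) > 0"
  shows "amb.combine (map (\<lambda>x. x ^ CHAR('a)) Ks) (map (\<lambda>x. x ^ CHAR('a)) Us) = amb.combine Ks Us ^ CHAR('a)"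
  using assms
  by (induction Ks Us rule: amb.combine.induct)
     (auto simp: freshmans_dream[OF prime_CHAR_field[OF assms] refl] power_mult_distrib)

text \<open>[K^(1/p) : F^(1/p)] = [K : F]: Frobenius is an automorphism of the ambient field, and
  p-th roots of a basis form a basis.\<close>

lemma frobenius_dimension:
  fixes F K :: "'a::field set"
  assumes p: "CHAR('a) > 0" and roots: "\<And>a::'a. \<exists>x. x ^ CHAR('a) = a"
    and F: "subfield F \<Omega>" and dim: "amb.dimension N F K"
  shows "amb.dimension N {x. x ^ CHAR('a) \<in> F} {x. x ^ CHAR('a) \<in> K}"
proof -
  let ?p = "CHAR('a)"
  let ?RF = "{x. x ^ ?p \<in> F}"
  interpret F: ambient_subfield F by (rule ambient_subfield.intro) fact
  have RF: "subfield ?RF \<Omega>" by (rule F.subfield_roots[OF p])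
  obtain r where r: "r a ^ ?p = a" for a :: 'a using roots by metis
  have mapr: "map (\<lambda>x. x ^ ?p) (map r xs) = xs" for xs :: "'a list" by (induction xs) (auto simp: r)
  obtain Us where Us: "amb.independent F Us" "length Us = N" "amb.Span F Us = K"
    using amb.exists_base[OF F dim] by blast
  have "amb.independent ?RF (map r Us)"
  proof (rule amb.trivial_combine_imp_independent[OF RF])
    fix Ks assume Ks: "set Ks \<subseteq> ?RF" "amb.combine Ks (map r Us) = \<zero>\<^bsub>\<Omega>\<^esub>"
    have "amb.combine (map (\<lambda>x. x ^ ?p) Ks) Us = 0"
      using combine_frobenius[OF p, of Ks "map r Us"] Ks(2) p unfolding mapr by simp
    moreover have "set (map (\<lambda>x. x ^ ?p) Ks) \<subseteq> F" using Ks(1) by auto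
    ultimately have "set (take (length Us) (map (\<lambda>x. x ^ ?p) Ks)) \<subseteq> {0}"
      using amb.independent_imp_trivial_combine[OF F Us(1)] by simp
    then show "set (take (length (map r Us)) Ks) \<subseteq> {\<zero>\<^bsub>\<Omega>\<^esub>}"
      using p by (auto simp: take_map)
  qed simp
  moreover have spF: "K = {amb.combine Ks Us | Ks. set Ks \<subseteq> F}"
    unfolding Us(3)[symmetric] by (rule amb.Span_eq_combine_set[OF F]) simp
  have sp: "amb.Span ?RF (map r Us) = {amb.combine Ks (map r Us) | Ks. set Ks \<subseteq> ?RF}"
    by (rule amb.Span_eq_combine_set[OF RF]) simp
  have "amb.Span ?RF (map r Us) = {x. x ^ ?p \<in> K}"
  proof (intro equalityI subsetI)
    fix x assume "x \<in> amb.Span ?RF (map r Us)"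
    then obtain Ks where Ks: "set Ks \<subseteq> ?RF" "x = amb.combine Ks (map r Us)"
      unfolding sp by blast
    have "x ^ ?p = amb.combine (map (\<lambda>x. x ^ ?p) Ks) Us"
      using combine_frobenius[OF p, of Ks "map r Us"] Ks(2) unfolding mapr by simp
    moreover have "set (map (\<lambda>x. x ^ ?p) Ks) \<subseteq> F" using Ks(1) by auto
    ultimately show "x \<in> {x. x ^ ?p \<in> K}"
      unfolding spF by blast
  next
    fix x assume "x \<in> {x. x ^ ?p \<in> K}"
    then obtain Cs where Cs: "set Cs \<subseteq> F" "x ^ ?p = amb.combine Cs Us"
      unfolding spF by blast
    then have "x ^ ?p = amb.combine (map r Cs) (map r Us) ^ ?p"
      using combine_frobenius[OF p, of "map r Cs" "map r Us"] unfolding mapr by simp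
    then have "x = amb.combine (map r Cs) (map r Us)"
      using frobenius_eq_iff[OF p] by blast
    moreover have "set (map r Cs) \<subseteq> ?RF" using Cs(1) r by auto
    ultimately show "x \<in> amb.Span ?RF (map r Us)"
      unfolding sp by blast
  qed
  ultimately show ?thesis
    using amb.dimensionI[OF RF, of "map r Us"] Us(2) by simp
qed

text \<open>F^(1/p) is generated over \<open>F\<close> by p-th roots of the elements of
  \<open>B\<close> alone, because those of elements of a perfect \<open>K0\<close> lie in
  \<open>K0\<close> already.\<close>

lemma perfect_base_roots:
  fixes K0 B :: "'a::field set"
  assumes p: "CHAR('a) > 0" and "perfect_field K0"
    and r: "\<And>a::'a. r a ^ CHAR('a) = a"
  defines "F \<equiv> gen (K0 \<union> B)"
  shows "{x. x ^ CHAR('a) \<in> F} = gen (F \<union> r ` B)"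
proof
  let ?p = "CHAR('a)"
  interpret F: ambient_subfield F unfolding F_def by (rule ambient_subfield.intro) (rule gen_subfield)
  note fr = freshmans_dream[OF prime_CHAR_field[OF p] refl]
    minus_power_prime_CHAR[OF refl prime_CHAR_field[OF p]]
  have "subfield {x. x ^ ?p \<in> F} \<Omega>" by (rule F.subfield_roots[OF p])
  moreover have "F \<union> r ` B \<subseteq> {x. x ^ ?p \<in> F}"
    using r subset_gen[of "K0 \<union> B"] by (auto simp: F_def[symmetric])
  ultimately show "gen (F \<union> r ` B) \<subseteq> {x. x ^ ?p \<in> F}" by (rule gen_subset)
  let ?G = "gen (F \<union> r ` B)"
  interpret G: ambient_subfield ?G by (rule ambient_subfield.intro) (rule gen_subfield)
  \<comment> \<open>The p-th powers of \<open>?G\<close> form a subfield containing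
    \<open>K0\<close> and \<open>B\<close>, hence all of \<open>F\<close>.\<close>
  have "subfield ((\<lambda>x. x ^ ?p) ` ?G) \<Omega>"
  proof (rule subfield_ambientI)
    show "1 \<in> (\<lambda>x. x ^ ?p) ` ?G" by (rule image_eqI[of _ _ 1]) auto
    fix x assume "x \<in> (\<lambda>x. x ^ ?p) ` ?G"
    then obtain a where a: "x = a ^ ?p" "a \<in> ?G" by blast
    show "- x \<in> (\<lambda>x. x ^ ?p) ` ?G" using a fr by (intro image_eqI[of _ _ "- a"]) auto
    show "inverse x \<in> (\<lambda>x. x ^ ?p) ` ?G"
      using a by (intro image_eqI[of _ _ "inverse a"]) (auto simp: power_inverse)
    fix y assume "y \<in> (\<lambda>x. x ^ ?p) ` ?G"
    then obtain b where b: "y = b ^ ?p" "b \<in> ?G" by blast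
    show "x + y \<in> (\<lambda>x. x ^ ?p) ` ?G" using a b fr by (intro image_eqI[of _ _ "a + b"]) auto
    show "x * y \<in> (\<lambda>x. x ^ ?p) ` ?G"
      using a b by (intro image_eqI[of _ _ "a * b"]) (auto simp: power_mult_distrib)
  qed
  moreover have "K0 \<union> B \<subseteq> (\<lambda>x. x ^ ?p) ` ?G"
  proof
    fix x assume "x \<in> K0 \<union> B"
    then show "x \<in> (\<lambda>x. x ^ ?p) ` ?G"
    proof
      assume "x \<in> K0"
      then obtain y where "y \<in> K0" "x = y ^ ?p"
        using assms(2) p by (auto simp: perfect_field_def)
      moreover have "K0 \<subseteq> ?G"
        using subset_gen[of "K0 \<union> B"] subset_gen[of "F \<union> r ` B"] by (auto simp: F_def)
      ultimately show ?thesis by blast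
    next
      assume "x \<in> B"
      then have "r x \<in> ?G" using subset_gen[of "F \<union> r ` B"] by blast
      then show ?thesis using r[of x] by (metis image_eqI)
    qed
  qed
  ultimately have "F \<subseteq> (\<lambda>x. x ^ ?p) ` ?G" unfolding F_def by (rule gen_subset)
  note sub = this
  show "{x. x ^ ?p \<in> F} \<subseteq> ?G"
  proof
    fix x assume "x \<in> {x. x ^ ?p \<in> F}"
    then obtain y where "y \<in> ?G" "x ^ ?p = y ^ ?p" using sub by blast
    then show "x \<in> ?G" using frobenius_eq_iff[OF p, of x y] by simp
  qed
qed

text \<open>Degrees are compared over F = K0(B). With N = [K : F], the field K^(1/p) has degree
  [F^(1/p) : F] N \<le> p^\<open>card B\<close> N and contains \<open>E\<close> of degree N p^m.
  Cancelling N gives the bound.\<close>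

lemma root_extension_degree_bound:
  fixes K0 K B E :: "'a::field set"
  assumes p: "CHAR('a) > 0" and roots: "\<And>a::'a. \<exists>x. x ^ CHAR('a) = a"
    and perfect: "perfect_field K0" and fg: "finitely_generated_over K0 K"
    and B: "finite B" "B \<subseteq> K" "\<And>x. x \<in> K \<Longrightarrow> amb.algebraic (gen (K0 \<union> B)) x"
    and E: "E \<subseteq> {x. x ^ CHAR('a) \<in> K}" "amb.dimension (CHAR('a) ^ m) K E"
  shows "m \<le> card B"
proof -
  let ?p = "CHAR('a)"
  define F where "F = gen (K0 \<union> B)"
  have subF: "subfield F \<Omega>" unfolding F_def by (rule gen_subfield)
  interpret F: ambient_subfield F by (rule ambient_subfield.intro) (rule subF)
  have subK: "subfield K \<Omega>" using fg by (simp add: finitely_generated_over_def)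
  obtain N where N: "0 < N" "amb.dimension N F K"
    using finite_dimension_over_transcendental[OF fg B(2,3)] unfolding F_def by blast
  obtain r where r: "r a ^ ?p = a" for a :: 'a using roots by metis
  have RF: "{x. x ^ ?p \<in> F} = gen (F \<union> r ` B)"
    unfolding F_def by (rule perfect_base_roots[OF p perfect r])
  have rB: "c ^ ?p \<in> F" if "c \<in> r ` B" for c
    using that r subset_gen[of "K0 \<union> B"] by (auto simp: F_def)
  obtain q where q: "q \<le> ?p ^ card (r ` B)" "amb.dimension q F {x. x ^ ?p \<in> F}"
    using F.roots_dimension_le[OF p finite_imageI[OF B(1)] rB] unfolding RF by blast
  have "q \<le> ?p ^ card B"
    using q(1) power_increasing[OF card_image_le[OF B(1), of r], of ?p] p by simp
  have "amb.dimension (q * N) F {x. x ^ ?p \<in> K}"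
    using amb.telescopic_base[OF subF _ q(2) frobenius_dimension[OF p roots subF N(2)]]
      gen_subfield[of "F \<union> r ` B"] RF by simp
  moreover have dimE: "amb.dimension (N * ?p ^ m) F E"
    by (rule amb.telescopic_base[OF subF subK N(2) E(2)])
  obtain Us where Us: "amb.independent F Us" "length Us = N * ?p ^ m" "amb.Span F Us = E"
    using amb.exists_base[OF subF dimE] by blast
  have "set Us \<subseteq> E" using amb.Span_base_incl[OF subF, of Us] Us(3) by simp
  ultimately have "N * ?p ^ m \<le> q * N"
    using amb.independent_length_le_dimension[OF subF _ Us(1)] Us(2) E(1) by (metis order_trans)
  then have "?p ^ m \<le> q" using N(1) by (simp add: mult.commute)
  also note \<open>q \<le> ?p ^ card B\<close>
  finally show ?thesis
    using power_le_imp_le_exp[of ?p m "card B"] prime_gt_1_nat[OF prime_CHAR_field[OF p]] by simp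
qed

subsection \<open>Residue fields\<close>

context valued_subfield
begin

abbreviation VR where "VR \<equiv> valuation_ring v F"
abbreviation VI where "VI \<equiv> valuation_ideal v F"

lemma valuation_ring_subring: "subring (VR) \<Omega>"
proof (rule amb.subringI)
  fix x y assume x: "x \<in> VR" and y: "y \<in> VR"
  then have "vge 0 (x + y)" "vge 0 (x * y)"
    using vge_add[of 0 x y] vge_mult[of 0 x 0 y] by (auto simp: valuation_ring_def vge_def)
  with x y show "x \<oplus>\<^bsub>\<Omega>\<^esub> y \<in> VR" "x \<otimes>\<^bsub>\<Omega>\<^esub> y \<in> VR"
    by (auto simp: valuation_ring_def vge_def)
qed (auto simp: valuation_ring_def)

definition val_ring :: "'a ring"
  where "val_ring = \<Omega>\<lparr>carrier := VR\<rparr>"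

lemma val_ring_simps [simp]:
  "carrier val_ring = VR"
  "x \<oplus>\<^bsub>val_ring\<^esub> y = x + y" "x \<otimes>\<^bsub>val_ring\<^esub> y = x * y"
  "\<zero>\<^bsub>val_ring\<^esub> = 0" "\<one>\<^bsub>val_ring\<^esub> = 1"
  by (simp_all add: val_ring_def)

sublocale O: domain val_ring
  unfolding val_ring_def by (rule amb.subring_is_domain[OF valuation_ring_subring])

lemma valuation_ring_closed:
  "x \<in> VR \<Longrightarrow> y \<in> VR \<Longrightarrow> x + y \<in> VR"
  "x \<in> VR \<Longrightarrow> y \<in> VR \<Longrightarrow> x * y \<in> VR"
  "x \<in> VR \<Longrightarrow> - x \<in> VR"
  "0 \<in> VR" "1 \<in> VR"
  using subringE[OF valuation_ring_subring] by auto

lemma valuation_ring_a_inv: "x \<in> VR \<Longrightarrow> \<ominus>\<^bsub>val_ring\<^esub> x = - x"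
  by (rule O.minus_equality) (auto simp: valuation_ring_closed)

lemma valuation_ideal_ideal: "ideal (VI) val_ring"
proof (rule idealI)
  show "ring val_ring" by (rule O.ring_axioms)
  have sub: "VI \<subseteq> VR"
    by (auto simp: valuation_ideal_def valuation_ring_def)
  have add: "x + y \<in> VI" if "x \<in> VI" "y \<in> VI" for x y
    using vgt_add[of 0 x y] that by (auto simp: valuation_ideal_def vgt_def)
  have neg: "- x \<in> VI" if "x \<in> VI" for x
    using that by (auto simp: valuation_ideal_def)
  show "subgroup (VI) (add_monoid val_ring)"
  proof
    show "inv\<^bsub>add_monoid val_ring\<^esub> x \<in> VI" if "x \<in> VI" for x
      using valuation_ring_a_inv[of x] neg[OF that] sub that by (auto simp: a_inv_def)
  qed (use sub add in \<open>auto simp: valuation_ideal_def\<close>)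
  fix a x assume "a \<in> VI" "x \<in> carrier val_ring"
  then have "x * a \<in> VI"
    by (cases "x = 0"; cases "a = 0") (auto simp: valuation_ideal_def valuation_ring_def v_mult intro: add_nonneg_pos)
  then show "x \<otimes>\<^bsub>val_ring\<^esub> a \<in> VI" "a \<otimes>\<^bsub>val_ring\<^esub> x \<in> VI"
    by (simp_all add: mult.commute)
qed

abbreviation Res where "Res \<equiv> residue_field v F"

definition res :: "'a \<Rightarrow> 'a set"
  where "res x = VI +>\<^bsub>\<Omega>\<^esub> x"

lemma residue_field_eq: "residue_field v F = val_ring Quot VI"
  by (simp add: residue_field_def val_ring_def)

lemma res_eq: "res x = VI +>\<^bsub>val_ring\<^esub> x"
  by (simp add: res_def a_r_coset_def r_coset_def)

lemma res_hom: "res \<in> ring_hom val_ring (residue_field v F)"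
  using ideal.rcos_ring_hom[OF valuation_ideal_ideal] unfolding residue_field_eq res_eq[abs_def] .

lemma carrier_residue_field: "carrier Res = res ` VR"
  by (auto simp: residue_field_eq FactRing_def A_RCOSETS_def' res_eq)

lemma res_add: "x \<in> VR \<Longrightarrow> y \<in> VR \<Longrightarrow> res (x + y) = res x \<oplus>\<^bsub>Res\<^esub> res y"
  and res_mult: "x \<in> VR \<Longrightarrow> y \<in> VR \<Longrightarrow> res (x * y) = res x \<otimes>\<^bsub>Res\<^esub> res y"
  and res_1: "res 1 = \<one>\<^bsub>Res\<^esub>"
  using ring_hom_memE[OF res_hom] by auto

lemma res_eq_iff:
  "x \<in> VR \<Longrightarrow> y \<in> VR \<Longrightarrow> res x = res y \<longleftrightarrow> x - y \<in> VI"
  using O.quotient_eq_iff_same_a_r_cos[OF valuation_ideal_ideal, of x y]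
  by (simp add: res_eq a_minus_def valuation_ring_a_inv)

sublocale res: cring "residue_field v F"
  unfolding residue_field_eq by (rule ideal.quotient_is_cring[OF valuation_ideal_ideal O.is_cring])

lemma res_0: "res 0 = \<zero>\<^bsub>Res\<^esub>"
  using res_add[of 0 0] carrier_residue_field valuation_ring_closed(4)
  by (metis add.left_neutral imageI res.add.l_cancel_one)

lemma res_eq_0_iff: "x \<in> VR \<Longrightarrow> res x = \<zero>\<^bsub>Res\<^esub> \<longleftrightarrow> x \<in> VI"
  using res_eq_iff[of x 0] valuation_ring_closed(4) by (simp add: res_0)

lemma res_uminus: "x \<in> VR \<Longrightarrow> res (- x) = \<ominus>\<^bsub>Res\<^esub> res x"
  by (rule res.minus_equality[symmetric])
     (auto simp: carrier_residue_field valuation_ring_closed res_0 simp flip: res_add)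

lemma unit_inverse:
  assumes "x \<in> VR" "x \<notin> VI"
  shows "x \<noteq> 0" "v x = 0" "inverse x \<in> VR" "res x \<otimes>\<^bsub>Res\<^esub> res (inverse x) = \<one>\<^bsub>Res\<^esub>"
proof -
  show x: "x \<noteq> 0" "v x = 0" using assms by (auto simp: valuation_ring_def valuation_ideal_def)
  then show i: "inverse x \<in> VR"
    using assms(1) by (auto simp: valuation_ring_def v_inverse)
  show "res x \<otimes>\<^bsub>Res\<^esub> res (inverse x) = \<one>\<^bsub>Res\<^esub>"
    using res_mult[OF assms(1) i] x(1) by (simp add: res_1)
qed

lemma residue_field_field: "field (residue_field v F)"
proof (rule res.cring_fieldI2)
  show "\<zero>\<^bsub>Res\<^esub> \<noteq> \<one>\<^bsub>Res\<^esub>"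
    using res_eq_0_iff[of 1] valuation_ring_closed(5) by (simp add: res_1 valuation_ideal_def eq_commute)
  fix a assume "a \<in> carrier Res" "a \<noteq> \<zero>\<^bsub>Res\<^esub>"
  then obtain x where x: "x \<in> VR" "a = res x" "res x \<noteq> \<zero>\<^bsub>Res\<^esub>"
    unfolding carrier_residue_field by blast
  then have "x \<notin> VI" using res_eq_0_iff by blast
  with x(1,2) unit_inverse[of x] show "\<exists>b\<in>carrier Res. a \<otimes>\<^bsub>Res\<^esub> b = \<one>\<^bsub>Res\<^esub>"
    by (auto simp: carrier_residue_field)
qed

lemma residue_subfield_eq: "residue_subfield v K F = res ` valuation_ring v K"
  by (simp add: residue_subfield_def res_def)

lemma residue_subfield_subfield:
  assumes "subfield K \<Omega>" "K \<subseteq> F"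
  shows "subfield (residue_subfield v K F) (residue_field v F)"
proof -
  interpret K: valued_subfield v K by (rule valued_subfieldI[OF assms(1)])
  have sub: "valuation_ring v K \<subseteq> VR" using assms(2) by (auto simp: valuation_ring_def)
  have subring: "subring (residue_subfield v K F) (residue_field v F)"
    unfolding residue_subfield_eq
  proof (rule res.subringI)
    show "res ` valuation_ring v K \<subseteq> carrier Res"
      using sub by (auto simp: carrier_residue_field)
    show "\<one>\<^bsub>Res\<^esub> \<in> res ` valuation_ring v K"
      using K.valuation_ring_closed(5) res_1 by (metis imageI)
    fix a assume "a \<in> res ` valuation_ring v K"
    then obtain x where x: "x \<in> valuation_ring v K" "a = res x" by blast
    show "\<ominus>\<^bsub>Res\<^esub> a \<in> res ` valuation_ring v K"
      using x sub K.valuation_ring_closed(3) res_uminus by (metis imageI subsetD)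
    fix b assume "b \<in> res ` valuation_ring v K"
    then obtain y where y: "y \<in> valuation_ring v K" "b = res y" by blast
    show "a \<oplus>\<^bsub>Res\<^esub> b \<in> res ` valuation_ring v K"
      using x y sub K.valuation_ring_closed(1) res_add by (metis imageI subsetD)
    show "a \<otimes>\<^bsub>Res\<^esub> b \<in> res ` valuation_ring v K"
      using x y sub K.valuation_ring_closed(2) res_mult by (metis imageI subsetD)
  qed
  show ?thesis
  proof (rule field.subfieldI'[OF residue_field_field subring])
    fix k assume k: "k \<in> residue_subfield v K F - {\<zero>\<^bsub>Res\<^esub>}"
    then obtain x where x: "x \<in> valuation_ring v K" "k = res x" unfolding residue_subfield_eq by blast
    have xF: "x \<in> VR" "x \<notin> VI" using k x sub res_eq_0_iff by auto
    note u = unit_inverse[OF xF]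
    have iK: "inverse x \<in> valuation_ring v K"
      using x(1) u(1,2) by (auto simp: valuation_ring_def v_inverse)
    have "inv\<^bsub>Res\<^esub> k = res (inverse x)"
      using u xF x(2) by (intro res.comm_inv_char) (auto simp: carrier_residue_field)
    then show "inv\<^bsub>Res\<^esub> k \<in> residue_subfield v K F"
      using iK unfolding residue_subfield_eq by simp
  qed
qed

lemma res_combine:
  assumes "set Ks \<subseteq> VR" "set us \<subseteq> VR"
  shows "amb.combine Ks us \<in> VR \<and>
    res (amb.combine Ks us) = res.combine (map res Ks) (map res us)"
  using assms
  by (induction Ks us rule: amb.combine.induct)
     (auto simp: res_0 res_add res_mult valuation_ring_closed)

lemma combine_map_mult:
  "amb.combine (map (\<lambda>k. c * k) Ks) us = c * amb.combine Ks us"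
  by (induction Ks us rule: amb.combine.induct) (auto simp: algebra_simps)

text \<open>A nontrivial relation over \<open>K\<close> is divided by a coefficient of least value.
  Its coefficients then lie in the valuation ring and one of them is 1, so its reduction is still
  nontrivial.\<close>

lemma independent_lift:
  assumes K: "subfield K \<Omega>" "K \<subseteq> F"
    and us: "set us \<subseteq> VR" "res.independent (residue_subfield v K F) (map res us)"
  shows "amb.independent K us"
proof (rule ccontr)
  interpret K: valued_subfield v K by (rule valued_subfieldI[OF K(1)])
  assume dep: "\<not> ?thesis"
  then obtain Ks where Ks: "length Ks = length us" "amb.combine Ks us = 0" "set Ks \<subseteq> K" "set Ks \<noteq> {0}"
    using amb.dependent_imp_non_trivial_combine[OF K(1), of us] by auto
  have "us \<noteq> []" using dep by auto
  then have "Ks \<noteq> []" using Ks(1) by auto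
  then have "\<exists>k\<in>set Ks. k \<noteq> 0" using Ks(4) by (metis insert_iff set_empty subsetI subset_singletonD singletonD)
  then have ne: "set Ks - {0} \<noteq> {}" by blast
  have "Min (v ` (set Ks - {0})) \<in> v ` (set Ks - {0})" using ne by (intro Min_in) auto
  then obtain k where "k \<in> set Ks - {0}" "v k = Min (v ` (set Ks - {0}))" by (metis imageE)
  then have k: "k \<in> set Ks" "k \<noteq> 0" "v k = Min (v ` (set Ks - {0}))" by blast+
  have kmin: "v k \<le> v x" if "x \<in> set Ks" "x \<noteq> 0" for x
    unfolding k(3) using that by (intro Min_le) auto
  define Cs where "Cs = map (\<lambda>x. inverse k * x) Ks"
  have kK: "k \<in> K" using k(1) Ks(3) by blast
  have CsK: "set Cs \<subseteq> valuation_ring v K"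
  proof
    fix y assume "y \<in> set Cs"
    then obtain x where x: "x \<in> set Ks" "y = inverse k * x" by (auto simp: Cs_def)
    have "x \<in> K" using x(1) Ks(3) by blast
    with x kK kmin[OF x(1)] k(2) show "y \<in> valuation_ring v K"
      by (cases "x = 0") (auto simp: valuation_ring_def v_mult v_inverse)
  qed
  have CsF: "set Cs \<subseteq> VR" using CsK K(2) by (auto simp: valuation_ring_def)
  have 1: "1 \<in> set Cs" using k by (force simp: Cs_def)
  have "amb.combine Cs us = 0" unfolding Cs_def combine_map_mult using Ks(2) by simp
  then have "res.combine (map res Cs) (map res us) = \<zero>\<^bsub>Res\<^esub>"
    using res_combine[OF CsF us(1)] res_0 by simp
  moreover have "set (map res Cs) \<subseteq> residue_subfield v K F" using CsK by (auto simp: residue_subfield_eq)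
  ultimately have "set (take (length (map res us)) (map res Cs)) \<subseteq> {\<zero>\<^bsub>Res\<^esub>}"
    using res.independent_imp_trivial_combine[OF residue_subfield_subfield[OF K] us(2)] by blast
  then have "res 1 = \<zero>\<^bsub>Res\<^esub>" using 1 Ks(1) by (auto simp: Cs_def)
  then show False
    using field.field_Units[OF residue_field_field] domain.one_not_zero[OF field.axioms(1)[OF residue_field_field]]
    by (simp add: res_1)
qed

text \<open>\<open>inertia_degree\<close> is defined through \<open>ring.dim\<close>, which says
  something only for finite dimension. Lifting independent lists bounds their length by n.\<close>

lemma residue_finite_dimension:
  assumes K: "subfield K \<Omega>" "K \<subseteq> F" and dim: "amb.dimension n K F"
  shows "res.finite_dimension (residue_subfield v K F) (carrier Res)"
proof -
  let ?k = "residue_subfield v K F" and ?R = "residue_field v F"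
  note k = residue_subfield_subfield[OF K]
  have bound: "length Us \<le> n" if Us: "res.independent ?k Us" for Us
  proof -
    have "set Us \<subseteq> res ` VR"
      using res.independent_in_carrier[OF Us] by (simp add: carrier_residue_field)
    then have "Us \<in> map res ` lists (VR)"
      unfolding lists_image[symmetric] by (simp add: in_lists_conv_set subset_iff)
    then obtain us where us: "set us \<subseteq> VR" "Us = map res us"
      by (auto simp: in_lists_conv_set)
    have "amb.independent K us" using independent_lift[OF K us(1)] Us us(2) by simp
    moreover have "set us \<subseteq> F" using us(1) by (auto simp: valuation_ring_def)
    ultimately show ?thesis
      using amb.independent_length_le_dimension[OF K(1) dim] us(2) by simp
  qed
  \<comment> \<open>An independent list of maximal length spans, since otherwise it could be
    extended.\<close>
  define S where "S = {length Us | Us. res.independent ?k Us}"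
  have "S \<subseteq> {..n}" using bound by (auto simp: S_def)
  then have finS: "finite S" by (rule finite_subset) simp
  have "0 \<in> S"
    unfolding S_def by (rule CollectI, rule exI[of _ "[]"]) (simp add: res.li_Nil)
  then have "Max S \<in> S" using finS by (intro Max_in) auto
  then obtain Us where Us: "res.independent ?k Us" "length Us = Max S" by (auto simp: S_def)
  have "carrier ?R \<subseteq> res.Span ?k Us"
  proof
    fix u assume u: "u \<in> carrier ?R"
    show "u \<in> res.Span ?k Us"
    proof (rule ccontr)
      assume "u \<notin> res.Span ?k Us"
      then have "res.independent ?k (u # Us)" using u Us(1) by (intro res.li_Cons)
      then have "length (u # Us) \<in> S" unfolding S_def by blast
      then have "length (u # Us) \<le> length Us" unfolding Us(2) using finS by (intro Max_ge)
      then show False by simp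
    qed
  qed
  moreover have "res.Span ?k Us \<subseteq> carrier ?R"
    by (rule res.Span_in_carrier[OF subfieldE(3)[OF k] res.independent_in_carrier[OF Us(1)]])
  ultimately have "res.Span ?k Us = carrier ?R" by blast
  with res.dimensionI[OF k Us(1)] show ?thesis
    by (intro res.finite_dimensionI)
qed

text \<open>The residue subfield has dimension one over itself, so its one-element basis already
  spans the whole residue field.\<close>

lemma residue_degree_one:
  assumes K: "subfield K \<Omega>" "K \<subseteq> F" and dim: "amb.dimension n K F"
    and f: "inertia_degree v K F = 1" and x: "x \<in> VR"
  shows "\<exists>k\<in>valuation_ring v K. x - k \<in> VI"
proof -
  let ?k = "residue_subfield v K F" and ?R = "residue_field v F"
  note k = residue_subfield_subfield[OF K]
  have "res.dimension 1 ?k (carrier ?R)"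
    using res.finite_dimensionE[OF k residue_finite_dimension[OF K dim]] f
    by (simp add: inertia_degree_def over_def)
  moreover obtain Us where Us: "res.independent ?k Us" "length Us = 1" "res.Span ?k Us = ?k"
    using res.exists_base[OF k res.dimension_one[OF k]] by blast
  moreover have "set Us \<subseteq> carrier ?R" using res.independent_in_carrier[OF Us(1)] .
  ultimately have "res.Span ?k Us = carrier ?R"
    using res.independent_length_eq_dimension[OF k] by blast
  then have "res x \<in> ?k" using x Us(3) carrier_residue_field by auto
  then obtain y where y: "y \<in> valuation_ring v K" "res x = res y" unfolding residue_subfield_eq by blast
  have "y \<in> VR" using y(1) K(2) by (auto simp: valuation_ring_def)
  with res_eq_iff[OF x this] y show ?thesis by blast
qed

end

subsection \<open>Artin--Schreier defect extensions\<close>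

lemma dimension_intermediate:
  assumes K: "subfield K \<Omega>" and F: "subfield F \<Omega>" and "K \<subseteq> F" "F \<subseteq> L"
    and L: "subfield L \<Omega>" and dim: "amb.dimension n K L"
  obtains m k where "amb.dimension m K F" "amb.dimension k F L" "m * k = n"
proof -
  interpret L: ambient_subfield L by (rule ambient_subfield.intro) (rule L)
  interpret F: ambient_subfield F by (rule ambient_subfield.intro) (rule F)
  have "subalgebra K F \<Omega>"
  proof (intro subalgebra.intro)
    show "subgroup F (add_monoid \<Omega>)" using subring.axioms(1)[OF subfieldE(1)[OF F]] .
    show "subalgebra_axioms K F \<Omega>" using \<open>K \<subseteq> F\<close> by unfold_locales auto
  qed
  then have "amb.finite_dimension K F"
    using amb.subalbegra_incl_imp_finite_dimension[OF K amb.finite_dimensionI[OF dim]] \<open>F \<subseteq> L\<close> by blast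
  then obtain m where m: "amb.dimension m K F" by blast
  obtain Us where Us: "amb.independent K Us" "amb.Span K Us = L"
    using amb.exists_base[OF K dim] by blast
  have UsL: "set Us \<subseteq> L" using amb.Span_base_incl[OF K, of Us] Us(2) by simp
  have "amb.Span F Us = L"
  proof
    have "subalgebra F L \<Omega>"
    proof (intro subalgebra.intro)
      show "subgroup L (add_monoid \<Omega>)" using subring.axioms(1)[OF subfieldE(1)[OF L]] .
      show "subalgebra_axioms F L \<Omega>" using \<open>F \<subseteq> L\<close> by unfold_locales auto
    qed
    then show "amb.Span F Us \<subseteq> L" by (rule amb.subalgebra_Span_incl[OF F _ UsL])
    have "amb.Span K Us \<subseteq> amb.Span F Us"
      using amb.Span_eq_combine_set[OF K, of Us] amb.Span_eq_combine_set[OF F, of Us] \<open>K \<subseteq> F\<close>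
      by (simp del: amb.Span.simps) blast
    then show "L \<subseteq> amb.Span F Us" using Us(2) by simp
  qed
  then have "amb.finite_dimension F L" using amb.Span_finite_dimension[OF F, of Us] by simp
  then obtain k where k: "amb.dimension k F L" by blast
  have "m * k = n"
    by (rule amb.dimension_is_inj[OF K amb.telescopic_base[OF K F m k] dim])
  with m k show ?thesis by (rule that)
qed

lemma dimension_eq_subset:
  assumes K: "subfield K \<Omega>" and "amb.dimension n K E" "amb.dimension n K F" "E \<subseteq> F"
  shows "E = F"
proof -
  obtain Us where Us: "amb.independent K Us" "length Us = n" "amb.Span K Us = E"
    using amb.exists_base[OF K assms(2)] by blast
  have "set Us \<subseteq> F" using amb.Span_base_incl[OF K, of Us] Us(3) assms(4) by simp
  then show ?thesis
    using amb.independent_length_eq_dimension[OF K assms(3) Us(1)] Us(2,3) by simp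
qed

lemma intermediate_prime_dimension:
  assumes "subfield K \<Omega>" "subfield F \<Omega>" "K \<subseteq> F" "F \<subseteq> L" "subfield L \<Omega>"
    "amb.dimension p K L" "prime p" "F \<noteq> L"
  shows "F = K"
proof -
  obtain m k where mk: "amb.dimension m K F" "amb.dimension k F L" "m * k = p"
    using dimension_intermediate[OF assms(1-6)] by blast
  have "m = 1 \<or> m = p" using mk(3) assms(7) by (metis dvd_triv_left prime_nat_iff)
  then show ?thesis
  proof
    assume "m = 1"
    then show ?thesis
      using dimension_eq_subset[OF assms(1) amb.dimension_one[OF assms(1)] _ assms(3)] mk(1) by simp
  next
    assume "m = p"
    then show ?thesis using dimension_eq_subset[OF assms(1) _ assms(6,4)] mk(1) assms(8) by blast
  qed
qed

text \<open>For s(i) = \<sigma>^i b this is (\<sigma> - 1)^n applied to \<sigma>^i b.\<close>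

fun differences :: "(nat \<Rightarrow> 'a::ab_group_add) \<Rightarrow> nat \<Rightarrow> nat \<Rightarrow> 'a" where
  "differences s 0 i = s i"
| "differences s (Suc n) i = differences s n (Suc i) - differences s n i"

lemma differences_eq:
  fixes s :: "nat \<Rightarrow> 'a::comm_ring_1"
  shows "differences s n i = (\<Sum>k\<le>n. coeff ([:-1, 1:] ^ n) k * s (k + i))"
proof (induction n arbitrary: i)
  case (Suc n)
  let ?q = "[:-1, 1:] ^ n :: 'a poly"
  have deg: "coeff ?q (Suc n) = 0"
    by (rule coeff_eq_0) (simp add: le_less_trans[OF degree_power_le])
  have c: "coeff ([:-1, 1:] ^ Suc n) k = (case k of 0 \<Rightarrow> 0 | Suc j \<Rightarrow> coeff ?q j) - coeff ?q k" for k
    by (simp add: coeff_pCons split: nat.splits)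
  have "(\<Sum>k\<le>Suc n. coeff ([:-1, 1:] ^ Suc n) k * s (k + i)) =
      (\<Sum>k\<le>Suc n. (case k of 0 \<Rightarrow> 0 | Suc j \<Rightarrow> coeff ?q j) * s (k + i)) - (\<Sum>k\<le>Suc n. coeff ?q k * s (k + i))"
    unfolding c by (simp add: left_diff_distrib sum_subtractf)
  also have "(\<Sum>k\<le>Suc n. (case k of 0 \<Rightarrow> 0 | Suc j \<Rightarrow> coeff ?q j) * s (k + i)) = (\<Sum>j\<le>n. coeff ?q j * s (j + Suc i))"
    by (subst sum.atMost_Suc_shift) simp
  also have "(\<Sum>k\<le>Suc n. coeff ?q k * s (k + i)) = (\<Sum>k\<le>n. coeff ?q k * s (k + i))"
    using deg by simp
  finally show ?case using Suc.IH by simp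
qed simp

text \<open>The coefficients of iterated differences are those of (X - 1)^n, and (X - 1)^p = X^p - 1
  in characteristic p.\<close>

lemma differences_CHAR:
  fixes s :: "nat \<Rightarrow> 'a::field"
  assumes "CHAR('a) > 0"
  shows "differences s CHAR('a) i = s (i + CHAR('a)) - s i"
proof -
  let ?p = "CHAR('a)"
  have prime: "prime CHAR('a poly)" using prime_CHAR_field[OF assms] by simp
  have "([:-1, 1:] + 1 :: 'a poly) ^ ?p = [:-1, 1:] ^ ?p + 1 ^ ?p"
    by (rule freshmans_dream[OF prime]) simp
  also have "[:-1, 1:] + 1 = (monom 1 1 :: 'a poly)" by (simp add: one_pCons monom_altdef)
  finally have eq: "[:-1, 1:] ^ ?p = (monom 1 ?p - 1 :: 'a poly)"
    by (simp add: monom_power algebra_simps)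
  have "differences s ?p i = (\<Sum>k\<le>?p. (if k = ?p then s (k + i) else 0) - (if k = 0 then s (k + i) else 0))"
    unfolding differences_eq eq by (intro sum.cong) (auto simp: coeff_1)
  then show ?thesis by (simp add: sum_subtractf add.commute)
qed

section \<open>Automorphisms and Artin--Schreier generators\<close>

lemma aut_props:
  assumes "\<sigma> \<in> aut K L"
  shows "x \<in> L \<Longrightarrow> \<sigma> x \<in> L" "x \<in> L \<Longrightarrow> y \<in> L \<Longrightarrow> \<sigma> (x * y) = \<sigma> x * \<sigma> y"
    "x \<in> L \<Longrightarrow> y \<in> L \<Longrightarrow> \<sigma> (x + y) = \<sigma> x + \<sigma> y" "\<sigma> 1 = 1" "inj_on \<sigma> L" "c \<in> K \<Longrightarrow> \<sigma> c = c"
  using assms ring_iso_memE[of \<sigma> "\<Omega>\<lparr>carrier := L\<rparr>" "\<Omega>\<lparr>carrier := L\<rparr>"]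
  by (auto simp: aut_def bij_betw_def)

locale field_automorphism = ambient_subfield L for L :: "'a::field set" +
  fixes \<sigma> :: "'a \<Rightarrow> 'a"
  assumes closed: "x \<in> L \<Longrightarrow> \<sigma> x \<in> L"
    and hom_mult: "x \<in> L \<Longrightarrow> y \<in> L \<Longrightarrow> \<sigma> (x * y) = \<sigma> x * \<sigma> y"
    and hom_add: "x \<in> L \<Longrightarrow> y \<in> L \<Longrightarrow> \<sigma> (x + y) = \<sigma> x + \<sigma> y"
    and hom_1: "\<sigma> 1 = 1"
    and inj: "inj_on \<sigma> L"
begin

lemma hom_0: "\<sigma> 0 = 0"
  using hom_add[of 0 0] by (metis add_0_right add_left_cancel zero_mem)

lemma hom_uminus: "x \<in> L \<Longrightarrow> \<sigma> (- x) = - \<sigma> x"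
  using hom_add[of x "- x"] by (simp add: hom_0 eq_neg_iff_add_eq_0 add.commute)

lemma hom_diff: "x \<in> L \<Longrightarrow> y \<in> L \<Longrightarrow> \<sigma> (x - y) = \<sigma> x - \<sigma> y"
  using hom_add[of x "- y"] hom_uminus[of y] by simp

lemma hom_eq_0_iff: "x \<in> L \<Longrightarrow> \<sigma> x = 0 \<longleftrightarrow> x = 0"
  using inj hom_0 zero_mem by (metis inj_on_def)

lemma hom_inverse: "x \<in> L \<Longrightarrow> \<sigma> (inverse x) = inverse (\<sigma> x)"
  by (cases "x = 0") (auto simp: hom_0 hom_eq_0_iff hom_1 intro!: inverse_unique[symmetric] simp flip: hom_mult)

lemma hom_divide: "x \<in> L \<Longrightarrow> y \<in> L \<Longrightarrow> \<sigma> (x / y) = \<sigma> x / \<sigma> y"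
  by (simp add: divide_inverse hom_mult hom_inverse)

lemma hom_power: "x \<in> L \<Longrightarrow> \<sigma> (x ^ n) = \<sigma> x ^ n"
  by (induction n) (auto simp: hom_1 hom_mult)

lemma hom_sum: "(\<And>i. i \<in> I \<Longrightarrow> f i \<in> L) \<Longrightarrow> \<sigma> (sum f I) = (\<Sum>i\<in>I. \<sigma> (f i))"
  by (induction I rule: infinite_finite_induct) (auto simp: hom_0 hom_add sum_mem)

definition fixed_field :: "'a set"
  where "fixed_field = {x\<in>L. \<sigma> x = x}"

lemma fixed_field_subfield: "subfield fixed_field \<Omega>"
  by (rule subfield_ambientI) (auto simp: fixed_field_def hom_1 hom_add hom_mult hom_uminus hom_inverse)

lemma funpow_closed: "x \<in> L \<Longrightarrow> (\<sigma> ^^ n) x \<in> L"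
  by (induction n) (auto intro: closed)

lemma map_poly_hom_mult:
  assumes "f \<in> polys L" "g \<in> polys L"
  shows "map_poly \<sigma> (f * g) = map_poly \<sigma> f * map_poly \<sigma> g"
  using polysD[OF assms(1)] polysD[OF assms(2)]
  by (intro poly_eqI) (auto simp: coeff_map_poly hom_0 coeff_mult hom_sum hom_mult)

lemma map_poly_hom_linear: "x \<in> L \<Longrightarrow> map_poly \<sigma> [:- x, 1:] = [:- \<sigma> x, 1:]"
  by (intro poly_eqI) (auto simp: coeff_map_poly hom_0 hom_1 hom_uminus coeff_pCons split: nat.splits)

lemma map_poly_hom_prod:
  "(\<And>i. i \<in> I \<Longrightarrow> f i \<in> polys L) \<Longrightarrow> map_poly \<sigma> (prod f I) = (\<Prod>i\<in>I. map_poly \<sigma> (f i))"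
  by (induction I rule: infinite_finite_induct) (auto simp: hom_1 map_poly_hom_mult polys_prod map_poly_1')

text \<open>Applying \<sigma> to the coefficients permutes the linear factors cyclically.\<close>

lemma orbit_polynomial:
  assumes "b \<in> L" "0 < n" "(\<sigma> ^^ n) b = b"
  shows "(\<Prod>i<n. [:- (\<sigma> ^^ i) b, 1:]) \<in> polys fixed_field"
proof -
  let ?f = "\<lambda>i. [:- (\<sigma> ^^ i) b, 1:]"
  have L: "?f i \<in> polys L" for i using funpow_closed[OF assms(1)] by auto
  have "map_poly \<sigma> (prod ?f {..<n}) = (\<Prod>i<n. map_poly \<sigma> (?f i))"
    using L by (rule map_poly_hom_prod)
  also have "\<dots> = (\<Prod>i<n. ?f (Suc i))"
    by (simp add: map_poly_hom_linear funpow_closed[OF assms(1)])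
  also have "\<dots> = prod ?f {..<n}"
  proof -
    obtain m where m: "n = Suc m" using assms(2) by (cases n) auto
    have "prod ?f {..<Suc m} = ?f 0 * (\<Prod>i<m. ?f (Suc i))" by (rule prod.lessThan_Suc_shift)
    moreover have "(\<Prod>i<Suc m. ?f (Suc i)) = (\<Prod>i<m. ?f (Suc i)) * ?f (Suc m)" by (rule prod.lessThan_Suc)
    moreover have "?f (Suc m) = ?f 0" using assms(3) unfolding m by simp
    ultimately show ?thesis unfolding m by (simp only: mult.commute)
  qed
  finally have "map_poly \<sigma> (prod ?f {..<n}) = prod ?f {..<n}" .
  then have "\<sigma> (coeff (prod ?f {..<n}) k) = coeff (prod ?f {..<n}) k" for k
    using coeff_map_poly[of \<sigma> "prod ?f {..<n}" k, OF hom_0] by simp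
  moreover have "prod ?f {..<n} \<in> polys L" using L by (rule polys_prod)
  ultimately show ?thesis by (auto simp: polys_def fixed_field_def)
qed

text \<open>The orbit of b consists of roots of a polynomial over \<open>K\<close> of degree at most
  p, which gives a period n \<le> p. The orbit polynomial has degree n, coefficients in
  \<open>K\<close> and root b; since b generates an extension of degree p, n = p.\<close>

lemma orbit_period:
  assumes fix_eq: "fixed_field = K" and K: "subfield K \<Omega>" and dim: "amb.dimension p K L" and p: "prime p"
    and b: "b \<in> L" "b \<notin> K"
  shows "(\<sigma> ^^ p) b = b"
proof -
  interpret K: ambient_subfield K by (rule ambient_subfield.intro) (rule K)
  have KL: "K \<subseteq> L" using fix_eq by (auto simp: fixed_field_def)
  \<comment> \<open>By primality of the degree b generates all of \<open>L\<close>, so no nonzero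
    polynomial of degree below p can annihilate it.\<close>
  have deg_ge: "p \<le> degree f" if f: "f \<in> polys K" "f \<noteq> 0" "poly f b = 0" for f
  proof -
    have alg: "amb.algebraic K b" unfolding K.algebraic_iff using f by blast
    note sub = K.simple_extension_subfield[OF alg]
    have incl: "K \<subseteq> adjoin K b" "b \<in> adjoin K b"
      by (rule K.subset_simple_extension K.mem_simple_extension)+
    have "adjoin K b \<subseteq> L"
      by (rule amb.simple_extension_subring_incl[OF subfieldE(1)[OF subfield] KL b(1)])
    then have eq: "adjoin K b = L"
      using intermediate_prime_dimension[OF K sub incl(1) _ subfield dim p] incl(2) b(2) by blast
    obtain d where d: "d \<le> degree f" "amb.dimension d K L"
      using K.simple_extension_dimension_le[OF f] eq by auto
    then show ?thesis using amb.dimension_is_inj[OF K d(2) dim] by simp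
  qed
  have "\<exists>f\<in>polys K. f \<noteq> 0 \<and> degree f < Suc p \<and> poly f b = 0"
  proof (rule ccontr)
    assume "\<not> ?thesis"
    then have ind: "amb.independent K (amb.exp_base b (Suc p))"
      by (intro K.independent_exp_base) blast
    have "set (amb.exp_base b (Suc p)) \<subseteq> L" using b(1) by (auto simp: amb.exp_base_def)
    from amb.independent_length_le_dimension[OF K dim ind this]
    show False by (simp add: K.length_exp_base)
  qed
  then obtain f where f: "f \<in> polys K" "f \<noteq> 0" "degree f \<le> p" "poly f b = 0" by auto
  have hom_poly: "\<sigma> (poly f x) = poly f (\<sigma> x)" if x: "x \<in> L" for x
  proof -
    have c: "coeff f i \<in> L" "\<sigma> (coeff f i) = coeff f i" for i
      using K.polysD[OF f(1), of i] fix_eq by (auto simp: fixed_field_def)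
    show ?thesis
      unfolding poly_altdef using c x by (subst hom_sum) (auto simp: hom_mult hom_power)
  qed
  have roots: "poly f ((\<sigma> ^^ i) b) = 0" for i
    by (induction i) (simp_all add: f(4) hom_0 flip: hom_poly[OF funpow_closed[OF b(1)]])
  have "finite {x. poly f x = 0}" "card {x. poly f x = 0} \<le> p"
    using poly_roots_finite[OF f(2)] card_poly_roots_bound[OF f(2)] f(3) by auto
  note fin = this
  \<comment> \<open>Pigeonhole: the p + 1 listed orbit elements are roots of a polynomial with at
    most p roots.\<close>
  have "\<not> inj_on (\<lambda>i. (\<sigma> ^^ i) b) {..p}"
  proof
    assume inj: "inj_on (\<lambda>i. (\<sigma> ^^ i) b) {..p}"
    have "card ((\<lambda>i. (\<sigma> ^^ i) b) ` {..p}) \<le> card {x. poly f x = 0}"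
      using roots fin(1) by (intro card_mono) auto
    then show False using card_image[OF inj] fin(2) by simp
  qed
  then obtain i j where ij: "i < j" "j \<le> p" "(\<sigma> ^^ i) b = (\<sigma> ^^ j) b"
    unfolding inj_on_def by (metis atMost_iff linorder_neqE_nat)
  define n where "n = j - i"
  have n: "0 < n" "n \<le> p" using ij by (auto simp: n_def)
  have cancel: "x = y" if "(\<sigma> ^^ i) x = (\<sigma> ^^ i) y" "x \<in> L" "y \<in> L" for x y i
    using that(1)
  proof (induction i)
    case (Suc i)
    then have "\<sigma> ((\<sigma> ^^ i) x) = \<sigma> ((\<sigma> ^^ i) y)" by simp
    then have "(\<sigma> ^^ i) x = (\<sigma> ^^ i) y"
      using inj funpow_closed that(2,3) by (metis inj_on_def)
    then show ?case by (rule Suc.IH)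
  qed simp
  have "(\<sigma> ^^ i) b = (\<sigma> ^^ i) ((\<sigma> ^^ n) b)"
    using ij by (simp add: n_def flip: funpow_add[unfolded comp_def, THEN fun_cong])
  then have per: "(\<sigma> ^^ n) b = b" using cancel b(1) funpow_closed by metis
  let ?P = "\<Prod>i<n. [:- (\<sigma> ^^ i) b, 1:]"
  have "?P \<in> polys K" using orbit_polynomial[OF b(1) n(1) per] fix_eq by simp
  moreover have "?P \<noteq> 0" by simp
  moreover have "poly ?P b = 0"
  proof -
    have "poly [:- (\<sigma> ^^ 0) b, 1:] b = 0" by simp
    then show ?thesis unfolding poly_prod using n(1) by (intro prod_zero) (auto intro!: bexI[of _ 0])
  qed
  ultimately have "p \<le> degree ?P" by (rule deg_ge)
  also have "degree ?P \<le> (\<Sum>i<n. degree [:- (\<sigma> ^^ i) b, 1:])"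
    using degree_prod_sum_le[of "{..<n}" "\<lambda>i. [:- (\<sigma> ^^ i) b, 1:]"] by (simp add: comp_def)
  also have "\<dots> = n" by simp
  finally have "n = p" using n(2) by simp
  with per show ?thesis by simp
qed

text \<open>In characteristic p the operator \<sigma> - 1 is nilpotent on b, as (\<sigma> - 1)^p b =
  \<sigma>^p b - b = 0. The last nonzero iterate e is fixed by \<sigma>, and the quotient of the
  preceding iterate by e is shifted by 1.\<close>

lemma artin_schreier_generator:
  assumes p: "CHAR('a) > 0" and fix_eq: "fixed_field = K" and K: "subfield K \<Omega>"
    and dim: "amb.dimension CHAR('a) K L" and b: "b \<in> L" "b \<notin> K"
  obtains \<theta> where "\<theta> \<in> L" "\<sigma> \<theta> = \<theta> + 1" "\<theta> ^ CHAR('a) - \<theta> \<in> K"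
proof -
  let ?s = "\<lambda>i. (\<sigma> ^^ i) b"
  define u where "u n i = differences ?s n i" for n i
  have uL: "u n i \<in> L" for n i
    unfolding u_def by (induction n arbitrary: i) (auto intro: funpow_closed[OF b(1)] diff_mem closed)
  have \<sigma>u: "\<sigma> (u n i) = u n (Suc i)" for n i
    using uL by (induction n arbitrary: i) (auto simp: u_def hom_diff)
  have "u CHAR('a) 0 = 0"
    unfolding u_def differences_CHAR[OF p] using orbit_period[OF fix_eq K dim prime_CHAR_field[OF p] b] by simp
  define k where "k = (LEAST k. u k 0 = 0)"
  have k0: "u k 0 = 0" unfolding k_def by (rule LeastI) fact
  have kmin: "u j 0 \<noteq> 0" if "j < k" for j using not_less_Least that unfolding k_def by blast
  have inK: "u j 0 \<in> K" if "u (Suc j) 0 = 0" for j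
    using that uL[of j 0] \<sigma>u[of j 0] fix_eq by (auto simp: u_def fixed_field_def)
  have "u 0 0 = b" by (simp add: u_def)
  \<comment> \<open>k \<ge> 2 because b is neither 0 nor fixed by \<sigma>; this leaves room for an
    iterate before the last nonzero one.\<close>
  then have "k \<noteq> 0" using k0 b(2) fix_eq hom_0 by (auto simp: fixed_field_def)
  moreover have "k \<noteq> 1" using k0 inK[of 0] b(2) \<open>u 0 0 = b\<close> by auto
  ultimately obtain j where j: "k = Suc (Suc j)" by (metis One_nat_def not0_implies_Suc)
  define e where "e = u (Suc j) 0"
  have e: "e \<in> K" "e \<noteq> 0" "e \<in> L" "\<sigma> e = e"
    using inK[of "Suc j"] k0 kmin[of "Suc j"] uL[of "Suc j" 0] fix_eq unfolding j e_def by (auto simp: fixed_field_def)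
  define \<theta> where "\<theta> = u j 0 / e"
  have \<theta>L: "\<theta> \<in> L" using uL e by (simp add: \<theta>_def)
  have "u j (Suc 0) = u j 0 + e" by (simp add: e_def u_def)
  then have "\<sigma> \<theta> = \<theta> + 1"
    using e uL[of j 0] by (simp add: \<theta>_def hom_divide \<sigma>u add_divide_distrib)
  moreover from this have "\<sigma> (\<theta> ^ CHAR('a) - \<theta>) = \<theta> ^ CHAR('a) - \<theta>"
    using \<theta>L by (simp add: hom_diff hom_power freshmans_dream[OF prime_CHAR_field[OF p] refl])
  then have "\<theta> ^ CHAR('a) - \<theta> \<in> K" using \<theta>L fix_eq by (auto simp: fixed_field_def)
  ultimately show ?thesis using that \<theta>L by blast
qed

end

section \<open>Consequences of nontrivial defect\<close>

context valued
begin

lemma defectD: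
  assumes "artin_schreier_defect_extension v K L"
  shows "CHAR('a) > 0" "subfield K \<Omega>" "subfield L \<Omega>" "K \<subseteq> L" "amb.dimension CHAR('a) K L"
    "{x\<in>L. \<forall>\<sigma>\<in>aut K L. \<sigma> x = x} = K"
  using assms
  by (auto simp: artin_schreier_defect_extension_def artin_schreier_extension_def galois_extension_def)

text \<open>The product d e f g is the prime p and d > 1, so the other factors are 1.\<close>

lemma defect_numbers:
  assumes "artin_schreier_defect_extension v K L"
  shows "ramification_index v K L = 1" "inertia_degree v K L = 1" "card (valuation_extensions v K L) = 1"
proof -
  let ?e = "ramification_index v K L" and ?f = "inertia_degree v K L" and ?g = "card (valuation_extensions v K L)"
  have p: "CHAR('a) > 0" and K: "subfield K \<Omega>" and dim: "amb.dimension CHAR('a) K L"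
    using defectD[OF assms] by simp_all
  obtain d where d: "d > 1" "amb.dimension (d * ?e * ?f * ?g) K L"
    using assms by (auto simp: artin_schreier_defect_extension_def has_defect_def)
  have eq: "d * (?e * ?f * ?g) = CHAR('a)"
    using amb.dimension_is_inj[OF K d(2) dim] by (simp add: mult.assoc)
  then have "d dvd CHAR('a)" by (metis dvd_triv_left)
  then have "d = CHAR('a)" using d(1) prime_CHAR_field[OF p] by (auto simp: prime_nat_iff)
  then have "?e * ?f * ?g = 1" using eq p by simp
  then show "?e = 1" "?f = 1" "?g = 1" by simp_all
qed

lemma defect_value_group:
  assumes "artin_schreier_defect_extension v K L"
  shows "value_group v L = value_group v K"
proof -
  have sub: "subfield K \<Omega>" "subfield L \<Omega>" "K \<subseteq> L"
    using defectD[OF assms] by simp_all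
  interpret K: valued_subfield v K by (rule valued_subfieldI[OF sub(1)])
  let ?R = "{(\<alpha>, \<beta>). \<alpha> - \<beta> \<in> value_group v K}"
  have "card (value_group v L // ?R) = 1"
    using defect_numbers(1)[OF assms] by (simp add: ramification_index_def)
  then obtain Q where Q: "value_group v L // ?R = {Q}" by (auto simp: card_1_singleton_iff)
  have "\<alpha> \<in> value_group v K" if \<alpha>: "\<alpha> \<in> value_group v L" for \<alpha>
  proof -
    have "0 \<in> value_group v L" using value_group_mono[OF sub(3)] K.value_group.zero_mem by blast
    moreover have "?R `` {\<beta>} = Q" if "\<beta> \<in> value_group v L" for \<beta>
      using quotientI[OF that, of ?R] unfolding Q by (rule singletonD)
    ultimately have "?R `` {\<alpha>} = ?R `` {0}" using \<alpha> by metis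
    moreover have "\<alpha> \<in> ?R `` {\<alpha>}" by auto
    ultimately have "\<alpha> \<in> ?R `` {0}" by blast
    then show ?thesis by simp
  qed
  then show ?thesis using value_group_mono[OF sub(3)] by blast
qed

text \<open>Equality of value groups provides k in \<open>K\<close> with (b - c)/k a unit. Equality
  of residue fields provides l in \<open>K\<close> with the same residue, and c + k l approximates b
  better than c.\<close>

lemma defect_approximation:
  assumes "artin_schreier_defect_extension v K L" "b \<in> L - K"
  shows "approximation v K b"
proof -
  have sub: "subfield K \<Omega>" "subfield L \<Omega>" "K \<subseteq> L" and dim: "amb.dimension CHAR('a) K L"
    using defectD[OF assms(1)] by simp_all
  interpret K: valued_subfield v K by (rule valued_subfieldI[OF sub(1)])
  interpret L: valued_subfield v L by (rule valued_subfieldI[OF sub(2)])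
  show ?thesis
  proof
    show "b \<notin> K" using assms(2) by blast
    fix c assume c: "c \<in> K"
    then have bc: "b - c \<in> L" "b - c \<noteq> 0" using assms(2) sub(3) by auto
    then have "v (b - c) \<in> value_group v K" using defect_value_group[OF assms(1)] L.value_groupI by blast
    then obtain k where "k \<in> K - {0}" "v (b - c) = v k" unfolding value_group_def by blast
    then have k: "k \<in> K" "k \<noteq> 0" "v k = v (b - c)" by simp_all
    define u where "u = (b - c) / k"
    have u: "u \<in> valuation_ring v L"
      using bc k sub(3) by (auto simp: u_def valuation_ring_def v_divide)
    obtain l where l: "l \<in> valuation_ring v K" "u - l \<in> valuation_ideal v L"
      using L.residue_degree_one[OF sub(1,3) dim defect_numbers(2)[OF assms(1)] u] by blast
    define c' where "c' = c + k * l"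
    have c': "c' \<in> K" using c k l(1) by (auto simp: c'_def valuation_ring_def)
    have eq: "b - c' = k * (u - l)" using k(2) by (simp add: c'_def u_def field_simps)
    have "b - c' \<noteq> 0" using c' assms(2) by auto
    then have "u - l \<noteq> 0" using eq by auto
    then have "v (b - c) < v (b - c')"
      using l(2) k by (simp add: eq v_mult valuation_ideal_def)
    with c' show "\<exists>c'\<in>K. v (b - c) < v (b - c')" by blast
  qed
qed

text \<open>The composition of v with \<sigma> also extends v from \<open>K\<close> to
  \<open>L\<close>, and there is only one extension.\<close>

lemma defect_unique_extension:
  assumes "artin_schreier_defect_extension v K L" "\<sigma> \<in> aut K L" "x \<in> L" "x \<noteq> 0"
  shows "v (\<sigma> x) = v x"
proof -
  have sub: "subfield K \<Omega>" "subfield L \<Omega>" "K \<subseteq> L"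
    using defectD[OF assms(1)] by simp_all
  interpret L: ambient_subfield L by (rule ambient_subfield.intro) (rule sub)
  note \<sigma> = aut_props[OF assms(2)]
  interpret L: field_automorphism L \<sigma> by unfold_locales (use \<sigma> in auto)
  \<comment> \<open>Restriction to nonzero elements of \<open>L\<close> matches
    \<open>valuation_extensions\<close>, whose members are extensional functions.\<close>
  define w where "w = restrict v (L - {0})"
  define w' where "w' = restrict (\<lambda>x. v (\<sigma> x)) (L - {0})"
  have nz: "\<sigma> x \<noteq> 0" if "x \<in> L" "x \<noteq> 0" for x using L.hom_eq_0_iff that by blast
  have "w \<in> valuation_extensions v K L"
    using sub(3) v_add by (auto simp: w_def valuation_extensions_def valuation_on_def v_mult)
  moreover have "w' \<in> valuation_extensions v K L"
  proof -
    have "min (v (\<sigma> x)) (v (\<sigma> y)) \<le> v (\<sigma> (x + y))"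
      if "x \<in> L" "y \<in> L" "x \<noteq> 0" "y \<noteq> 0" "x + y \<noteq> 0" for x y
      using v_add[of "\<sigma> x" "\<sigma> y"] nz[of x] nz[of y] nz[of "x + y"] that by (simp add: L.hom_add)
    then show ?thesis
      using sub(3) \<sigma>(6) nz
      by (auto simp: w'_def valuation_extensions_def valuation_on_def v_mult L.hom_mult)
  qed
  moreover have "\<exists>W. valuation_extensions v K L = {W}"
    using defect_numbers(3)[OF assms(1)] by (simp add: card_1_singleton_iff)
  ultimately have "w = w'" by auto
  then have "w x = w' x" by simp
  then show ?thesis using assms(3,4) by (simp add: w_def w'_def)
qed

lemma artin_schreier_defect_generator:
  assumes "artin_schreier_defect_extension v K L"
  obtains \<theta> where "approximation v K \<theta>" "\<theta> ^ CHAR('a) - \<theta> \<in> K" "\<And>c. c \<in> K \<Longrightarrow> v (\<theta> - c) < 0"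
    "\<And>b. b \<in> L - K \<Longrightarrow> (dist_cut v K \<theta>, dist_cut v K b) \<in> equal_modulo (value_group v K)"
proof -
  have p: "CHAR('a) > 0" and sub: "subfield K \<Omega>" "subfield L \<Omega>" "K \<subseteq> L" and dim: "amb.dimension CHAR('a) K L"
    and fixed: "{x\<in>L. \<forall>\<sigma>\<in>aut K L. \<sigma> x = x} = K"
    using defectD[OF assms] by simp_all
  have prime: "prime CHAR('a)" by (rule prime_CHAR_field[OF p])
  interpret K: valued_subfield v K by (rule valued_subfieldI[OF sub(1)])
  have "K \<noteq> L"
  proof
    assume "K = L"
    then have "CHAR('a) = 1"
      using amb.dimension_is_inj[OF sub(1) amb.dimension_one[OF sub(1)]] dim by simp
    then show False using prime by simp
  qed
  then obtain b where b: "b \<in> L" "b \<notin> K" using sub(3) by blast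
  then obtain \<sigma> where \<sigma>: "\<sigma> \<in> aut K L" "\<sigma> b \<noteq> b" using fixed by blast
  interpret L: ambient_subfield L by (rule ambient_subfield.intro) (rule sub)
  interpret L: field_automorphism L \<sigma> by unfold_locales (use aut_props[OF \<sigma>(1)] in auto)
  have "K \<subseteq> L.fixed_field" using sub(3) aut_props(6)[OF \<sigma>(1)] by (auto simp: L.fixed_field_def)
  moreover have "L.fixed_field \<subseteq> L" "L.fixed_field \<noteq> L" using b \<sigma>(2) by (auto simp: L.fixed_field_def)
  \<comment> \<open>Since the degree is prime, one automorphism that moves b already has fixed field
    \<open>K\<close>.\<close>
  ultimately have fix_eq: "L.fixed_field = K"
    using intermediate_prime_dimension[OF sub(1) L.fixed_field_subfield _ _ sub(2) dim prime] by blast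
  obtain \<theta> where \<theta>: "\<theta> \<in> L" "\<sigma> \<theta> = \<theta> + 1" "\<theta> ^ CHAR('a) - \<theta> \<in> K"
    using L.artin_schreier_generator[OF p fix_eq sub(1) dim b] by blast
  have \<theta>K: "\<theta> \<notin> K" using \<theta>(2) aut_props(6)[OF \<sigma>(1), of \<theta>] by auto
  have approx: "approximation v K \<theta>" using defect_approximation[OF assms] \<theta>(1) \<theta>K by blast
  then interpret \<theta>: approximation v K \<theta> .
  \<comment> \<open>Absence of a maximum turns a nonnegative value into a positive one for some c'.
    Then y = \<theta> - c' and \<sigma> y = y + 1 have different values, contrary to the uniqueness
    of the extension.\<close>
  have neg: "v (\<theta> - c) < 0" if c: "c \<in> K" for c
  proof (rule ccontr)
    assume "\<not> ?thesis"
    then obtain c' where c': "c' \<in> K" "0 < v (\<theta> - c')"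
      using \<theta>.no_max[OF c] by (meson le_less_trans not_less)
    define y where "y = \<theta> - c'"
    have y: "y \<in> L" "y \<noteq> 0" "0 < v y" using c' \<theta>(1) sub(3) by (auto simp: y_def)
    have "\<sigma> y = y + 1"
      using \<theta> c' sub(3) aut_props(6)[OF \<sigma>(1), of c'] by (auto simp: y_def L.hom_diff)
    then have "v (1 + y) = v y" using defect_unique_extension[OF assms \<sigma>(1) y(1,2)] by (simp add: add.commute)
    moreover have "v (1 + y) = 0" using v_add_eq(2)[of 1 y] y(3) by (simp add: vgt_def)
    ultimately show False using y(3) by simp
  qed
  let ?g = "monom 1 CHAR('a) - [:\<theta> ^ CHAR('a) - \<theta>, 1:]"
  interpret g: kaplansky v K \<theta> "CHAR('a)" ?g
    by (rule \<theta>.kaplansky_artin_schreier[OF p \<theta>(3) neg])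
  have root: "poly ?g \<theta> = 0" by (simp add: poly_monom)
  \<comment> \<open>By Kaplansky's lemma the left side has degree p over \<open>K\<close>, so it
    fills \<open>L\<close>.\<close>
  have "adjoin K \<theta> \<subseteq> L"
    by (rule amb.simple_extension_subring_incl[OF subfieldE(1)[OF sub(2)] sub(3) \<theta>(1)])
  then have L_eq: "adjoin K \<theta> = L"
    by (rule dimension_eq_subset[OF sub(1) g.dimension_simple_extension[OF root] dim])
  have "(dist_cut v K \<theta>, dist_cut v K x) \<in> equal_modulo (value_group v K)" if x: "x \<in> L - K" for x
  proof -
    obtain \<beta> where \<beta>: "\<beta> \<in> value_group v K"
      "\<And>c. c \<in> K \<Longrightarrow> \<exists>c'\<in>K. \<beta> + v (\<theta> - c) \<le> v (x - c')"
      "\<And>c'. c' \<in> K \<Longrightarrow> \<exists>c\<in>K. v (x - c') \<le> \<beta> + v (\<theta> - c)"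
      using g.simple_extension_distance[OF root refl, of x] x L_eq by blast
    show ?thesis using x by (intro K.dist_cut_shift[OF approx _ \<beta>]) auto
  qed
  with approx \<theta>(3) neg show ?thesis by (rule that)
qed

end

subsection \<open>Counting distances\<close>

lemma (in algebraic_closure) splitted_over_carrier: "P \<in> carrier (poly_ring L) \<Longrightarrow> splitted P"
  by (rule roots_over_carrier)

lemma algebraic_closure_roots:
  fixes K :: "'a::field set"
  assumes "algebraic_closure \<Omega> K" "0 < n"
  shows "\<exists>x::'a. x ^ n = a"
proof -
  \<comment> \<open>The coefficient list of X^n - a, leading coefficient first.\<close>
  define P :: "'a list" where "P = 1 # replicate (n - 1) 0 @ [- a]"
  have "P \<in> carrier (poly_ring \<Omega>)"
    by (simp add: P_def univ_poly_carrier[symmetric] polynomial_def)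
  have tail: "amb.eval (replicate m 0 @ [- a]) x = - a" for m x
    by (induction m) auto
  have "amb.splitted P"
    by (rule algebraic_closure.splitted_over_carrier[OF assms(1)]) fact
  then have "size (amb.roots P) = n"
    using assms(2) by (simp add: amb.splitted_def P_def)
  then obtain x where "x \<in># amb.roots P" using assms(2) by (metis multiset_nonemptyE not_gr0 size_empty)
  then have "amb.eval P x = 0"
    using amb.roots_mem_iff_is_root[of P x] \<open>P \<in> carrier (poly_ring \<Omega>)\<close> by (simp add: amb.is_root_def)
  then show ?thesis
    using assms(2) by (intro exI[of _ x]) (simp add: P_def tail)
qed

text \<open>Finite sets of classes are bounded through representatives. Finiteness follows from the
  same bound and has to be shown, since \<open>card\<close> is 0 on infinite sets.\<close>

lemma card_quotient_le:
  assumes R: "equiv UNIV R"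
    and bound: "\<And>S. finite S \<Longrightarrow> S \<subseteq> A \<Longrightarrow> (\<And>x y. x \<in> S \<Longrightarrow> y \<in> S \<Longrightarrow> (x, y) \<in> R \<Longrightarrow> x = y) \<Longrightarrow> card S \<le> n"
  shows "finite (A // R)" "card (A // R) \<le> n"
proof -
  have fin: "card Q \<le> n" if Q: "finite Q" "Q \<subseteq> A // R" for Q
  proof -
    have "\<forall>q\<in>Q. \<exists>x\<in>A. q = R `` {x}" using Q(2) by (auto simp: quotient_def)
    then obtain f where f: "\<And>q. q \<in> Q \<Longrightarrow> f q \<in> A" "\<And>q. q \<in> Q \<Longrightarrow> q = R `` {f q}" by metis
    have inj: "inj_on f Q" by (rule inj_onI) (metis f(2))
    have "card (f ` Q) \<le> n"
    proof (rule bound)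
      show "finite (f ` Q)" "f ` Q \<subseteq> A" using Q(1) f(1) by auto
      fix x y assume "x \<in> f ` Q" "y \<in> f ` Q" "(x, y) \<in> R"
      then obtain q q' where q: "q \<in> Q" "q' \<in> Q" "x = f q" "y = f q'" by blast
      have "R `` {x} = R `` {y}" using \<open>(x, y) \<in> R\<close> equiv_class_eq[OF R] by blast
      then have "q = q'" using f(2) q by metis
      then show "x = y" using q by simp
    qed
    then show ?thesis using card_image[OF inj] by simp
  qed
  show finite: "finite (A // R)"
  proof (rule ccontr)
    assume "infinite (A // R)"
    then obtain Q where "Q \<subseteq> A // R" "finite Q" "card Q = Suc n"
      using infinite_arbitrarily_large by blast
    then show False using fin[of Q] by simp
  qed
  show "card (A // R) \<le> n" using fin[OF finite] by simp
qed

theorem theorem1: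
  fixes K0 K :: "'a::field set"
    and v :: "'a \<Rightarrow> 'g::linordered_ab_group_add"
  assumes "CHAR('a) > 0"
    and "algebraic_closure \<Omega> K"
    and "finitely_generated_over K0 K"
    and "perfect_field K0"
    and "valuation_on UNIV v"
    and "\<forall>x\<in>K0 - {0}. v x = 0"
  shows "finite (artin_schreier_defect_distances v K // equal_modulo (value_group v K)) \<and>
    card (artin_schreier_defect_distances v K // equal_modulo (value_group v K)) \<le> 2 * trdeg K0 K"
proof -
  note p = assms(1)
  let ?p = "CHAR('a)" and ?R = "equal_modulo (value_group v K)"
  have K: "subfield K \<Omega>" and K0: "subfield K0 \<Omega>"
    using assms(3) by (auto simp: finitely_generated_over_def)
  interpret valued v by (rule valued.intro) (rule assms(5))
  interpret K: valued_subfield v K by (rule valued_subfieldI[OF K])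
  have roots: "\<exists>x. x ^ ?p = a" for a :: 'a by (rule algebraic_closure_roots[OF assms(2) p])
  obtain B where B: "finite B" "card B = trdeg K0 K" "B \<subseteq> K"
    "\<And>x. x \<in> K \<Longrightarrow> amb.algebraic (gen (K0 \<union> B)) x"
    using trdeg_basis[OF assms(3)] by blast
  let ?F = "gen (K0 \<union> B)" and ?V = "divisible_hull (value_group v K)"
  interpret F: valued_subfield v ?F by (rule valued_subfieldI[OF gen_subfield])
  have eq: "equiv UNIV ?R" by (rule K.value_group.equiv_equal_modulo)
  have "K0 \<subseteq> K" using assms(3) subset_gen by (fastforce simp: finitely_generated_over_def)
  then have FK: "?F \<subseteq> K" using B(3) by (intro gen_subset K) blast
  have "rank_le (divisible_hull (value_group v ?F)) (card B)"
    by (rule rank_le_generate_field[OF K0 _ B(1)]) (use assms(6) in blast)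
  \<comment> \<open>K is algebraic over the field generated by the basis, so its values lie in the
    divisible hull of the smaller value group.\<close>
  moreover have "?V \<subseteq> divisible_hull (value_group v ?F)"
    using divisible_hull_mono[OF F.algebraic_value_group[OF FK B(4)]] by (simp add: divisible_hull_idem)
  ultimately have rank: "rank_le ?V (trdeg K0 K)" unfolding B(2) by (rule rank_le_mono[rotated])
  define I where "I = {C. division_closed_cut ?p ?V C}"
  define H where "H = {\<eta>. approximation v K \<eta> \<and> \<eta> ^ ?p \<in> K}"
  define D where "D = dist_cut v K ` H"
  have I: "finite (I // ?R)" "card (I // ?R) \<le> trdeg K0 K"
  proof -
    \<comment> \<open>Division closed cuts are bounded in number themselves, not only modulo
      shifts.\<close>
    have "card S \<le> trdeg K0 K" if S: "finite S" "S \<subseteq> I" for S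
    proof -
      have "\<exists>T. finite T \<and> T \<subseteq> ?V \<and> arch_chain T \<and> card T = card S"
        using S prime_gt_1_nat[OF prime_CHAR_field[OF p]]
        by (intro division_closed_cuts_arch_chain[OF K.value_group.divisible_hull_subgroup])
           (auto simp: I_def)
      then show ?thesis using rank by (auto simp: rank_le_def)
    qed
    then show "finite (I // ?R)" "card (I // ?R) \<le> trdeg K0 K"
      using card_quotient_le[OF eq, of I "trdeg K0 K"] by blast+
  qed
  have D: "finite (D // ?R)" "card (D // ?R) \<le> trdeg K0 K"
  proof -
    have "card S \<le> trdeg K0 K" if S: "finite S" "S \<subseteq> D"
      and ineq: "\<And>x y. x \<in> S \<Longrightarrow> y \<in> S \<Longrightarrow> (x, y) \<in> ?R \<Longrightarrow> x = y" for S
    proof -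
      \<comment> \<open>One root is chosen for each cut in S, so that inequivalence of the cuts
        separates the roots as the tower requires.\<close>
      obtain T where T: "T \<subseteq> H" "S = dist_cut v K ` T" "inj_on (dist_cut v K) T"
        using S(2) unfolding D_def subset_image_inj by blast
      have fT: "finite T" using S(1) T(2,3) finite_imageD by blast
      have "\<exists>E. subfield E \<Omega> \<and> K \<subseteq> E \<and> E \<subseteq> {x. x ^ ?p \<in> K} \<and> amb.dimension (?p ^ card T) K E \<and>
        (\<forall>x\<in>E - K. approximation v K x \<and> (\<exists>\<eta>\<in>T. (dist_cut v K \<eta>, dist_cut v K x) \<in> ?R))"
      proof (rule K.root_extension_tower[OF p fT])
        show "approximation v K \<eta> \<and> \<eta> ^ ?p \<in> K" if "\<eta> \<in> T" for \<eta> using that T(1) by (auto simp: H_def)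
        show "\<eta> = \<theta>" if "\<eta> \<in> T" "\<theta> \<in> T" "(dist_cut v K \<eta>, dist_cut v K \<theta>) \<in> ?R" for \<eta> \<theta>
          using that ineq T(2,3) by (auto simp: inj_on_def)
      qed
      then obtain E where "E \<subseteq> {x. x ^ ?p \<in> K}" "amb.dimension (?p ^ card T) K E" by blast
      then have "card T \<le> card B"
        by (intro root_extension_degree_bound[OF p roots assms(4,3) B(1,3,4)])
      then show ?thesis using T(2) card_image[OF T(3)] B(2) by simp
    qed
    then show "finite (D // ?R)" "card (D // ?R) \<le> trdeg K0 K"
      using card_quotient_le[OF eq, of D "trdeg K0 K"] by blast+
  qed
  have sub: "artin_schreier_defect_distances v K // ?R \<subseteq> I // ?R \<union> D // ?R"
  proof
    fix Q assume "Q \<in> artin_schreier_defect_distances v K // ?R"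
    then obtain b L where b: "artin_schreier_defect_extension v K L" "b \<in> L - K" "Q = ?R `` {dist_cut v K b}"
      by (auto simp: quotient_def artin_schreier_defect_distances_def)
    obtain \<theta> where \<theta>: "approximation v K \<theta>" "\<theta> ^ ?p - \<theta> \<in> K" "\<And>c. c \<in> K \<Longrightarrow> v (\<theta> - c) < 0"
      and "(dist_cut v K \<theta>, dist_cut v K b) \<in> ?R"
      using artin_schreier_defect_generator[OF b(1)] b(2) by metis
    then have Q: "Q = ?R `` {dist_cut v K \<theta>}" using equiv_class_eq[OF eq] b(3) by blast
    have "dist_cut v K \<theta> \<in> I \<union> D"
      using K.artin_schreier_dichotomy[OF p roots \<theta>] unfolding I_def D_def H_def by (metis (mono_tags, lifting) UnI1 UnI2 image_eqI mem_Collect_eq)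
    then show "Q \<in> I // ?R \<union> D // ?R" unfolding Q by (auto intro: quotientI)
  qed
  have "finite (I // ?R \<union> D // ?R)" using I(1) D(1) by simp
  moreover have "card (I // ?R \<union> D // ?R) \<le> 2 * trdeg K0 K"
    using card_Un_le[of "I // ?R" "D // ?R"] I(2) D(2) by simp
  ultimately show ?thesis using sub by (meson card_mono finite_subset order_trans)
qed

end
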